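(* Let $\mathfrak a=\langle f_1,\dots,f_r\rangle\subset\mathbb C[\boldsymbol x]=\mathbb C[x_1,\dots,x_n]$ be an ideal with system of generators $\boldsymbol f=(f_1,\dots,f_r)$, let $g\in\mathbb C[\boldsymbol x]$ be nonzero, and let $\mathfrak p\subset\mathbb C[\boldsymbol x]$ be a prime ideal. Let $I_{(\boldsymbol f;g),3}=\tilde I_{(\boldsymbol f;g),3}$ be the ideal of $\mathbb C[\boldsymbol x,s]$ described in the context, with a primary decomposition $I_{(\boldsymbol f;g),3}=\bigcap_{i=1}^{\ell}\mathfrak q_i$. Then the local generalized Bernstein–Sato polynomial $b^{\mathfrak p}_{\mathfrak a,g}(s)$ at $\mathfrak p$ is the (monic) generator of the ideal $$\Big(\bigcap_{\mathfrak q_i\cap\mathbb C[\boldsymbol x]\subset\mathfrak p}\mathfrak q_i\Big)\cap\mathbb C[s].$$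
   Context: Rings. $D_X=\mathbb C\langle x_1,\dots,x_n,\partial_{x_1},\dots,\partial_{x_n}\rangle$ and $D_Y=\mathbb C\langle x_1,\dots,x_n,t_1,\dots,t_r,\partial_{x_1},\dots,\partial_{x_n},\partial_{t_1},\dots,\partial_{t_r}\rangle$ are the Weyl algebras in $n$ and $n+r$ variables. The letters $u,u_1,u_2,s$ denote new variables commuting with everything; $\langle\cdots\rangle$ denotes the left ideal generated. Put $\sigma=-\sum_{i=1}^r\partial_{t_i}t_i\in D_Y$. For an ideal $I$ of $\mathbb C[\boldsymbol x,s]$, $I:g=\{h\in\mathbb C[\boldsymbol x,s]\mid hg\in I\}$. An empty intersection of ideals of $\mathbb C[\boldsymbol x,s]$ is $\mathbb C[\boldsymbol x,s]$. The ideal $I_{(\boldsymbol f;g),3}$. Let $I_{\boldsymbol f}=\langle t_iu_1-f_i\mid1\le i\le r\rangle+\langle u_1\partial_{x_j}+\sum_{i=1}^r\partial_{x_j}(f_i)\partial_{t_i}\mid1\le j\le n\rangle+\langle u_1u_2-1\rangle$, a left ideal of $D_Y[u_1,u_2]$; $I_{\boldsymbol f,1}=I_{\boldsymbol f}\cap D_Y$; $I_{(\boldsymbol f;g),2}=D_Y[s](I_{\boldsymbol f,1}+g\mathfrak a+\langle s-\sigma\rangle)\cap\mathbb C[\boldsymbol x,s]$; and $I_{(\boldsymbol f;g),3}=I_{(\boldsymbol f;g),2}:g$. The ideal $\tilde I_{(\boldsymbol f;g),3}$. Grade $D_Y$ by giving each $\partial_{t_j}$ degree $1$, each $t_j$ degree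 $-1$, and all $x_i,\partial_{x_i}$ degree $0$; for $P\neq0$ let $\mathrm{in}(P)$ be the nonzero homogeneous component of $P$ of highest degree, and for a left ideal $I$ let $\mathrm{in}(I)$ be the left ideal of $D_Y$ generated by all $\mathrm{in}(P)$, $0\ne P\in I$. Let $\tilde I_{\boldsymbol f}=\langle t_i-f_i\mid1\le i\le r\rangle+\langle\partial_{x_j}+\sum_{i=1}^r\partial_{x_j}(f_i)\partial_{t_i}\mid1\le j\le n\rangle\subset D_Y$; $\tilde I_{(\boldsymbol f;g),0}=\tilde I_{\boldsymbol f}\cap D_Yg=D_Y[u](u\tilde I_{\boldsymbol f}+(1-u)g)\cap D_Y$; $\tilde I_{(\boldsymbol f;g),1}=\mathrm{in}(\tilde I_{(\boldsymbol f;g),0})$; $\tilde I_{(\boldsymbol f;g),2}=(\tilde I_{(\boldsymbol f;g),1}+\langle s-\sigma\rangle)\cap\mathbb C[\boldsymbol x,s]$ (sum as left ideal of $D_Y[s]$); and $\tilde I_{(\boldsymbol f;g),3}=\tilde I_{(\boldsymbol f;g),2}:g$. The ideals $I_{(\boldsymbol f;g),3}$ and $\tilde I_{(\boldsymbol f;g),3}$ coincide. The module $N_{\boldsymbol f}$. The $f_i$ are nonzero. Let $s_1,\dots,s_r$ be independent variables and $N_{\boldsymbol f}=\mathbb C[\boldsymbol x][\prod_if_i^{-1},s_1,\dots,s_r]\prod_if_i^{s_i}$, where $\prod_if_i^{s_i}$ is a formal symbol (free module of rank one). It is a left $D_Y$-module: $\mathbb C[\boldsymbol x]$ acts by multiplication,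 and for $h\in\mathbb C[\boldsymbol x][\prod_i f_i^{-1},s_1,\dots,s_r]$, $$\partial_{x_j}\Big(h\prod_if_i^{s_i}\Big)=\Big(\partial_{x_j}(h)+h\sum_{k=1}^rs_k\frac{\partial_{x_j}(f_k)}{f_k}\Big)\prod_if_i^{s_i},$$ $$t_j\Big(h(x,s_1,\dots,s_r)\prod_if_i^{s_i}\Big)=h(x,s_1,\dots,s_j+1,\dots,s_r)f_j\prod_if_i^{s_i},$$ $$\partial_{t_j}\Big(h(x,s_1,\dots,s_r)\prod_if_i^{s_i}\Big)=-s_jh(x,s_1,\dots,s_j-1,\dots,s_r)f_j^{-1}\prod_if_i^{s_i}.$$ Definition of $b^{\mathfrak p}_{\mathfrak a,g}$. The local generalized Bernstein–Sato polynomial $b^{\mathfrak p}_{\mathfrak a,g}(s)$ at $\mathfrak p$ is the monic polynomial $b(s)\in\mathbb C[s]$ of minimal degree satisfying $$b(\sigma)\,g h\prod_if_i^{s_i}=\sum_{j=1}^rP_j\,g f_j\prod_if_i^{s_i}$$ for some $P_1,\dots,P_r\in D_X\langle-\partial_{t_j}t_k\mid1\le j,k\le r\rangle$ (the subalgebra of $D_Y$ generated by $D_X$ and the elements $-\partial_{t_j}t_k$) and some $h\in\mathbb C[\boldsymbol x]$ with $h\notin\mathfrak p$. It is known (Budur–Mustaţă–Saito) that such polynomials exist. *)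

theory Defs
  imports "HOL-Library.Poly_Mapping" "HOL-Library.Product_Plus"
    "HOL-Computational_Algebra.Computational_Algebra"
begin

text \<open>
  The variables \<open>x_1, \<dots>, x_n\<close> are indexed by a finite linearly ordered type \<open>'n\<close>, the generators
  \<open>f_1, \<dots>, f_r\<close> and the variables \<open>t_1, \<dots>, t_r\<close>, \<open>s_1, \<dots>, s_r\<close> by a finite type \<open>'r\<close>. The order
  on \<open>'n\<close> carries no mathematical content: it provides the integral domain instance of polynomials.
\<close>

subsection \<open>Multivariate polynomials\<close>

type_synonym ('v, 'a) mpol = "('v \<Rightarrow>\<^sub>0 nat) \<Rightarrow>\<^sub>0 'a"

definition Cst :: "'a::zero \<Rightarrow> ('v, 'a) mpol"
  where "Cst c = Poly_Mapping.single 0 c"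

definition Ind :: "'v \<Rightarrow> ('v, 'a::zero_neq_one) mpol"
  where "Ind i = Poly_Mapping.single (Poly_Mapping.single i 1) 1"

text \<open>Extension of a map given on monomials \<open>c * k\<close> to formal sums.\<close>

definition pm_extend :: "('a \<Rightarrow> 'b \<Rightarrow> 'c) \<Rightarrow> ('a \<Rightarrow>\<^sub>0 'b::zero) \<Rightarrow> 'c::comm_monoid_add"
  where "pm_extend \<phi> p = (\<Sum>k\<in>Poly_Mapping.keys p. \<phi> k (Poly_Mapping.lookup p k))"

definition mp_deriv :: "'v \<Rightarrow> ('v, 'a) mpol \<Rightarrow> ('v, 'a::comm_semiring_1) mpol"
  where "mp_deriv i =
    pm_extend (\<lambda>m c. Poly_Mapping.single (m - Poly_Mapping.single i 1)
      (of_nat (Poly_Mapping.lookup m i) * c))"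

definition mp_subst :: "('v \<Rightarrow> ('v, 'a) mpol) \<Rightarrow> ('v::finite, 'a) mpol \<Rightarrow> ('v, 'a::comm_semiring_1) mpol"
  where "mp_subst \<phi> = pm_extend (\<lambda>m c. Cst c * (\<Prod>i\<in>UNIV. \<phi> i ^ Poly_Mapping.lookup m i))"

lemma pm_induct [case_names zero single add]:
  assumes "P 0" "\<And>k v. P (Poly_Mapping.single k v)" "\<And>a b. P a \<Longrightarrow> P b \<Longrightarrow> P (a + b)"
  shows "P (p :: 'a \<Rightarrow>\<^sub>0 'b::comm_monoid_add)"
proof (induction p rule: update_induct)
  case const
  show ?case by (fact assms)
next
  case (update f a b)
  have "Poly_Mapping.update a b f = Poly_Mapping.single a b + f"
    using update(1)
    by (intro poly_mapping_eqI) (auto simp: lookup_update lookup_add lookup_single not_in_keys_iff_lookup_eq_zero)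
  then show ?case using assms update by simp
qed

lemma pm_extend_superset:
  assumes "\<And>k. \<phi> k 0 = 0" "finite S" "Poly_Mapping.keys p \<subseteq> S"
  shows "pm_extend \<phi> p = (\<Sum>k\<in>S. \<phi> k (Poly_Mapping.lookup p k))"
  unfolding pm_extend_def using assms
  by (intro sum.mono_neutral_left) (auto simp: in_keys_iff)

lemma pm_extend_add:
  assumes "\<And>k a b. \<phi> k (a + b) = \<phi> k a + \<phi> k b" "\<And>k. \<phi> k 0 = 0"
  shows "pm_extend \<phi> (p + q) = pm_extend \<phi> p + pm_extend \<phi> (q :: 'a \<Rightarrow>\<^sub>0 'b::comm_monoid_add)"
proof -
  let ?S = "Poly_Mapping.keys p \<union> Poly_Mapping.keys q"
  have "Poly_Mapping.keys (p + q) \<subseteq> ?S" by (rule keys_add)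
  then show ?thesis
    using pm_extend_superset[where \<phi> = \<phi> and S = ?S, OF assms(2)]
    by (simp add: lookup_add assms(1) sum.distrib)
qed

lemma pm_extend_0 [simp]: "pm_extend \<phi> 0 = 0"
  by (simp add: pm_extend_def)

lemma pm_extend_single:
  assumes "\<phi> k 0 = 0"
  shows "pm_extend \<phi> (Poly_Mapping.single k c) = \<phi> k c"
  using assms by (cases "c = 0") (auto simp: pm_extend_def)

lemma mp_deriv_add [simp]: "mp_deriv i (p + q) = mp_deriv i p + mp_deriv i q"
  unfolding mp_deriv_def by (rule pm_extend_add) (auto simp: algebra_simps single_add)

lemma mp_deriv_0 [simp]: "mp_deriv i 0 = 0"
  by (simp add: mp_deriv_def)

lemma mp_deriv_single:
  "mp_deriv i (Poly_Mapping.single m c) =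
     Poly_Mapping.single (m - Poly_Mapping.single i 1) (of_nat (Poly_Mapping.lookup m i) * c)"
  unfolding mp_deriv_def by (rule pm_extend_single) simp

lemma mp_deriv_uminus [simp]: "mp_deriv i (- p) = - mp_deriv i (p :: ('v, 'a::comm_ring_1) mpol)"
  by (metis add_eq_0_iff add.right_inverse mp_deriv_add mp_deriv_0)

lemma mp_deriv_diff [simp]:
  "mp_deriv i (p - q) = mp_deriv i p - mp_deriv i (q :: ('v, 'a::comm_ring_1) mpol)"
  using mp_deriv_add[of i p "- q"] by simp

lemma exponent_diff_add:
  fixes m k :: "'v \<Rightarrow>\<^sub>0 nat"
  assumes "Poly_Mapping.lookup m i > 0"
  shows "(m - Poly_Mapping.single i 1) + k = (m + k) - Poly_Mapping.single i 1"
  using assms by (intro poly_mapping_eqI) (auto simp: lookup_add lookup_minus lookup_single when_def)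

lemma mp_deriv_mult:
  "mp_deriv i (p * q) = mp_deriv i p * q + p * mp_deriv i (q :: ('v, 'a::comm_semiring_1) mpol)"
proof (induction p rule: pm_induct)
  case (single m c)
  show ?case
  proof (induction q rule: pm_induct)
    case (single k d)
    have 1: "Poly_Mapping.single (m - Poly_Mapping.single i 1 + k) (of_nat (Poly_Mapping.lookup m i) * c * d)
      = Poly_Mapping.single (m + k - Poly_Mapping.single i 1) (of_nat (Poly_Mapping.lookup m i) * c * d)"
      using exponent_diff_add[of m i k] by (cases "Poly_Mapping.lookup m i = 0") auto
    have 2: "Poly_Mapping.single (m + (k - Poly_Mapping.single i 1)) (c * (of_nat (Poly_Mapping.lookup k i) * d))
      = Poly_Mapping.single (m + k - Poly_Mapping.single i 1) (c * (of_nat (Poly_Mapping.lookup k i) * d))"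
      using exponent_diff_add[of k i m] by (cases "Poly_Mapping.lookup k i = 0") (auto simp: add.commute)
    have "mp_deriv i (Poly_Mapping.single m c * Poly_Mapping.single k d)
      = Poly_Mapping.single (m + k - Poly_Mapping.single i 1) (of_nat (Poly_Mapping.lookup m i) * c * d)
        + Poly_Mapping.single (m + k - Poly_Mapping.single i 1) (c * (of_nat (Poly_Mapping.lookup k i) * d))"
      by (simp add: mult_single mp_deriv_single lookup_add single_add[symmetric] algebra_simps)
    then show ?case
      unfolding 1[symmetric] 2[symmetric] by (simp add: mult_single mp_deriv_single)
  qed (auto simp: algebra_simps)
qed (auto simp: algebra_simps)

lemma mp_deriv_Cst [simp]: "mp_deriv i (Cst c) = 0"
  by (simp add: Cst_def mp_deriv_single)

lemma mp_deriv_Ind: "mp_deriv i (Ind j) = (if i = j then 1 else 0)"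
  by (auto simp: Ind_def mp_deriv_single lookup_single)

lemma mp_deriv_commute: "mp_deriv i (mp_deriv j p) = mp_deriv j (mp_deriv i p)"
proof (induction p rule: pm_induct)
  case (single m c)
  show ?case
    by (cases "i = j")
      (auto simp: mp_deriv_single lookup_minus lookup_single algebra_simps diff_diff_eq when_def)
qed auto

lemma Cst_add: "Cst (a + b) = Cst a + Cst b"
  by (simp add: Cst_def single_add)

lemma Cst_mult: "Cst (a * b) = Cst a * Cst b"
  by (simp add: Cst_def mult_single)

lemma Cst_0 [simp]: "Cst 0 = 0"
  by (simp add: Cst_def)

lemma Cst_1 [simp]: "Cst 1 = 1"
  by (simp add: Cst_def)

lemma mp_subst_add [simp]: "mp_subst \<phi> (p + q) = mp_subst \<phi> p + mp_subst \<phi> q"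
  unfolding mp_subst_def by (rule pm_extend_add) (auto simp: algebra_simps Cst_add)

lemma mp_subst_0 [simp]: "mp_subst \<phi> 0 = 0"
  by (simp add: mp_subst_def)

lemma mp_subst_single:
  "mp_subst \<phi> (Poly_Mapping.single m c) = Cst c * (\<Prod>i\<in>UNIV. \<phi> i ^ Poly_Mapping.lookup m i)"
  unfolding mp_subst_def by (rule pm_extend_single) simp

lemma mp_subst_mult [simp]: "mp_subst \<phi> (p * q) = mp_subst \<phi> p * mp_subst \<phi> q"
proof (induction p rule: pm_induct)
  case (single m c)
  show ?case
    by (induction q rule: pm_induct)
      (auto simp: mult_single mp_subst_single lookup_add power_add prod.distrib Cst_mult algebra_simps)
qed (auto simp: algebra_simps)

lemma mp_subst_Cst [simp]: "mp_subst \<phi> (Cst c) = Cst c"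
  by (simp add: Cst_def mp_subst_single)

lemma mp_subst_Ind [simp]: "mp_subst \<phi> (Ind i) = \<phi> i"
proof -
  have "(\<Prod>j\<in>UNIV. \<phi> j ^ Poly_Mapping.lookup (Poly_Mapping.single i 1) j) = (\<Prod>j\<in>UNIV. if j = i then \<phi> i else 1)"
    by (intro prod.cong) (auto simp: lookup_single)
  then show ?thesis by (simp add: Ind_def mp_subst_single)
qed

subsection \<open>Weyl algebras\<close>

text \<open>
  The Weyl algebra on the variables \<^typ>\<open>'v\<close> is the free algebra on symbols \<open>x_i\<close> (\<open>GenX i\<close>) and
  \<open>\<partial>_i\<close> (\<open>GenD i\<close>), that is, the algebra of the monoid of words, modulo the two-sided ideal of the
  commutation relations. \<open>D_Y\<close> is the Weyl algebra on \<open>'n + 'r\<close>: \<open>Inl i\<close> is the index of \<open>x_i\<close>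
  and \<open>Inr j\<close> that of \<open>t_j\<close>.
\<close>

datatype 'v gen = GenX 'v | GenD 'v

datatype 'v word = Word (letters: "'v gen list")

instantiation word :: (type) monoid_add
begin
definition "0 = Word []"
definition "v + w = Word (letters v @ letters w)"
instance by standard (auto simp: zero_word_def plus_word_def)
end

type_synonym 'v falg = "'v word \<Rightarrow>\<^sub>0 complex"

definition fgen :: "'v gen \<Rightarrow> 'v falg"
  where "fgen y = Poly_Mapping.single (Word [y]) 1"

definition two_sided_ideal :: "'a::ring set \<Rightarrow> bool"
  where "two_sided_ideal I \<longleftrightarrow>
    0 \<in> I \<and> (\<forall>a\<in>I. \<forall>b\<in>I. a + b \<in> I) \<and> (\<forall>a. \<forall>b\<in>I. a * b \<in> I \<and> b * a \<in> I)"

inductive_set weyl_rels :: "'v falg set"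
  where
    "fgen (GenX i) * fgen (GenX j) - fgen (GenX j) * fgen (GenX i) \<in> weyl_rels"
  | "fgen (GenD i) * fgen (GenD j) - fgen (GenD j) * fgen (GenD i) \<in> weyl_rels"
  | "fgen (GenD i) * fgen (GenX j) - fgen (GenX j) * fgen (GenD i) - (if i = j then 1 else 0)
      \<in> weyl_rels"

definition weyl_eq :: "'v falg \<Rightarrow> 'v falg \<Rightarrow> bool"
  where "weyl_eq a b \<longleftrightarrow> a - b \<in> two_sided_ideal hull weyl_rels"

lemma two_sided_ideal_hull: "two_sided_ideal (two_sided_ideal hull S)"
  by (rule hull_in) (auto simp: two_sided_ideal_def)

lemma weyl_ideal_closed:
  fixes a b :: "'v falg"
  defines "I \<equiv> two_sided_ideal hull weyl_rels :: 'v falg set"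
  shows "0 \<in> I" "a \<in> I \<Longrightarrow> b \<in> I \<Longrightarrow> a + b \<in> I" "b \<in> I \<Longrightarrow> a * b \<in> I" "b \<in> I \<Longrightarrow> b * a \<in> I"
    "b \<in> I \<Longrightarrow> - b \<in> I"
proof -
  have I: "two_sided_ideal I"
    unfolding I_def by (rule two_sided_ideal_hull)
  then show "0 \<in> I" "a \<in> I \<Longrightarrow> b \<in> I \<Longrightarrow> a + b \<in> I" "b \<in> I \<Longrightarrow> a * b \<in> I" "b \<in> I \<Longrightarrow> b * a \<in> I"
    by (auto simp: two_sided_ideal_def)
  show "b \<in> I \<Longrightarrow> - b \<in> I"
    using I unfolding two_sided_ideal_def by (metis mult_minus1)
qed

lemma weyl_eq_refl: "weyl_eq a a"
  by (simp add: weyl_eq_def weyl_ideal_closed)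

lemma weyl_eq_uminus: "weyl_eq a b \<Longrightarrow> weyl_eq (- a) (- b)"
  unfolding weyl_eq_def using weyl_ideal_closed(5)[of "a - b"] by (simp add: algebra_simps)

lemma weyl_eq_add: "weyl_eq a b \<Longrightarrow> weyl_eq c d \<Longrightarrow> weyl_eq (a + c) (b + d)"
  unfolding weyl_eq_def using weyl_ideal_closed(2)[of "a - b" "c - d"] by (simp add: algebra_simps)

lemma weyl_eq_mult:
  assumes "weyl_eq a b" "weyl_eq c d"
  shows "weyl_eq (a * c) (b * d)"
proof -
  have "a * c - b * d = a * (c - d) + (a - b) * d"
    by (simp add: algebra_simps)
  then show ?thesis
    using assms by (simp add: weyl_eq_def weyl_ideal_closed)
qed

lemma equivp_weyl_eq: "equivp (weyl_eq :: 'v falg \<Rightarrow> _)"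
proof (rule equivpI)
  show "reflp (weyl_eq :: 'v falg \<Rightarrow> _)"
    by (simp add: reflpI weyl_eq_refl)
  show "symp (weyl_eq :: 'v falg \<Rightarrow> _)"
    unfolding weyl_eq_def by (rule sympI) (metis minus_diff_eq weyl_ideal_closed(5))
  show "transp (weyl_eq :: 'v falg \<Rightarrow> _)"
  proof (rule transpI)
    fix a b c
    assume "weyl_eq a b" "weyl_eq b c"
    then show "weyl_eq a c"
      unfolding weyl_eq_def using weyl_ideal_closed(2)[of "a - b" "b - c"] by simp
  qed
qed

quotient_type 'v weyl = "'v falg" / weyl_eq
  by (rule equivp_weyl_eq)

definition free_act :: "(complex \<Rightarrow> 'm) \<Rightarrow> ('v gen \<Rightarrow> 'm \<Rightarrow> 'm) \<Rightarrow> 'v falg \<Rightarrow> 'm \<Rightarrow> 'm::comm_ring_1"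
  where "free_act sc \<rho> e m = pm_extend (\<lambda>w c. sc c * foldr \<rho> (letters w) m) e"

locale weyl_rep =
  fixes sc :: "complex \<Rightarrow> 'm::comm_ring_1" and \<rho> :: "'v gen \<Rightarrow> 'm \<Rightarrow> 'm"
  assumes sc_add: "sc (a + b) = sc a + sc b"
    and sc_mult: "sc (a * b) = sc a * sc b"
    and sc_1: "sc 1 = 1"
    and rho_add: "\<rho> y (m + m') = \<rho> y m + \<rho> y m'"
    and rho_sc: "\<rho> y (sc c * m) = sc c * \<rho> y m"
    and rho_XX: "\<rho> (GenX i) (\<rho> (GenX j) m) = \<rho> (GenX j) (\<rho> (GenX i) m)"
    and rho_DD: "\<rho> (GenD i) (\<rho> (GenD j) m) = \<rho> (GenD j) (\<rho> (GenD i) m)"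
    and rho_DX: "\<rho> (GenD i) (\<rho> (GenX j) m) = \<rho> (GenX j) (\<rho> (GenD i) m) + (if i = j then m else 0)"
begin

lemma sc_0: "sc 0 = 0"
  using sc_add[of 0 0] by simp

lemma foldr_add: "foldr \<rho> ys (m + m') = foldr \<rho> ys m + foldr \<rho> ys m'"
  by (induction ys) (auto simp: rho_add)

lemma foldr_sc: "foldr \<rho> ys (sc c * m) = sc c * foldr \<rho> ys m"
  by (induction ys) (auto simp: rho_sc)

lemma free_act_add: "free_act sc \<rho> (a + b) m = free_act sc \<rho> a m + free_act sc \<rho> b m"
  unfolding free_act_def by (rule pm_extend_add) (auto simp: sc_add sc_0 algebra_simps)

lemma free_act_0: "free_act sc \<rho> 0 m = 0"
  by (simp add: free_act_def)

lemma free_act_uminus: "free_act sc \<rho> (- a) m = - free_act sc \<rho> a m"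
  by (metis add_eq_0_iff add.right_inverse free_act_add free_act_0)

lemma free_act_diff: "free_act sc \<rho> (a - b) m = free_act sc \<rho> a m - free_act sc \<rho> b m"
  using free_act_add[of a "- b"] by (simp add: free_act_uminus)

lemma free_act_single: "free_act sc \<rho> (Poly_Mapping.single w c) m = sc c * foldr \<rho> (letters w) m"
  unfolding free_act_def by (rule pm_extend_single) (simp add: sc_0)

lemma free_act_add_right: "free_act sc \<rho> a (m + m') = free_act sc \<rho> a m + free_act sc \<rho> a m'"
  by (induction a rule: pm_induct)
    (auto simp: free_act_0 free_act_single free_act_add foldr_add algebra_simps)

lemma free_act_0_right: "free_act sc \<rho> a 0 = 0"
  using free_act_add_right[of a 0 0] by simp

lemma free_act_mult: "free_act sc \<rho> (a * b) m = free_act sc \<rho> a (free_act sc \<rho> b m)"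
proof (induction a rule: pm_induct)
  case (single v c)
  show ?case
  proof (induction b rule: pm_induct)
    case zero
    show ?case by (simp add: free_act_0 free_act_0_right)
  next
    case (single w d)
    show ?case
      by (simp add: mult_single free_act_single foldr_sc plus_word_def sc_mult algebra_simps)
  next
    case (add a b)
    then show ?case by (simp add: free_act_add free_act_add_right distrib_left)
  qed
qed (auto simp: free_act_0 free_act_add distrib_right)

lemma free_act_1: "free_act sc \<rho> 1 m = m"
  by (simp flip: single_one add: free_act_single zero_word_def sc_1)

lemma free_act_fgen: "free_act sc \<rho> (fgen y) m = \<rho> y m"
  by (simp add: fgen_def free_act_single sc_1)

lemma free_act_weyl_rels:
  assumes "a \<in> two_sided_ideal hull weyl_rels"
  shows "free_act sc \<rho> a m = 0"
proof -
  have "two_sided_ideal {a. \<forall>m. free_act sc \<rho> a m = 0}"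
    by (auto simp: two_sided_ideal_def free_act_0 free_act_add free_act_mult free_act_0_right)
  moreover have "weyl_rels \<subseteq> {a. \<forall>m. free_act sc \<rho> a m = 0}"
    by (auto elim!: weyl_rels.cases
        simp: free_act_diff free_act_mult free_act_fgen rho_XX rho_DD rho_DX free_act_1 free_act_0)
  ultimately show ?thesis
    using hull_minimal[of weyl_rels "{a. \<forall>m. free_act sc \<rho> a m = 0}" two_sided_ideal] assms by blast
qed

lemma free_act_weyl_eq: "weyl_eq a b \<Longrightarrow> free_act sc \<rho> a m = free_act sc \<rho> b m"
  using free_act_weyl_rels[of "a - b"] by (simp add: weyl_eq_def free_act_diff)

end

text \<open>The action on polynomials shows that the quotient is not zero.\<close>

fun poly_rho :: "'v gen \<Rightarrow> ('v, complex) mpol \<Rightarrow> ('v, complex) mpol"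
  where
    "poly_rho (GenX i) p = Ind i * p"
  | "poly_rho (GenD i) p = mp_deriv i p"

interpretation poly_rep: weyl_rep Cst "poly_rho :: 'v gen \<Rightarrow> _"
proof
  fix y :: "'v gen" and m m' c
  show "poly_rho y (m + m') = poly_rho y m + poly_rho y m'"
    by (cases y) (auto simp: algebra_simps)
  show "poly_rho y (Cst c * m) = Cst c * poly_rho y m"
    by (cases y) (auto simp: algebra_simps mp_deriv_mult)
qed (auto simp: Cst_add Cst_mult mp_deriv_mult mp_deriv_Ind algebra_simps mp_deriv_commute)

instantiation weyl :: (type) ring_1
begin

lift_definition zero_weyl :: "'a weyl" is 0 .
lift_definition one_weyl :: "'a weyl" is 1 .
lift_definition plus_weyl :: "'a weyl \<Rightarrow> 'a weyl \<Rightarrow> 'a weyl" is "(+)" by (rule weyl_eq_add)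
lift_definition uminus_weyl :: "'a weyl \<Rightarrow> 'a weyl" is uminus by (rule weyl_eq_uminus)
lift_definition minus_weyl :: "'a weyl \<Rightarrow> 'a weyl \<Rightarrow> 'a weyl" is "(-)"
  using weyl_eq_add weyl_eq_uminus by fastforce
lift_definition times_weyl :: "'a weyl \<Rightarrow> 'a weyl \<Rightarrow> 'a weyl" is "(*)" by (rule weyl_eq_mult)

instance
proof
  show "(0 :: 'a weyl) \<noteq> 1"
  proof (transfer, rule notI)
    assume "weyl_eq (0 :: 'a falg) 1"
    then have "free_act Cst poly_rho (0 :: 'a falg) 1 = free_act Cst poly_rho (1 :: 'a falg) 1"
      by (rule poly_rep.free_act_weyl_eq)
    then show False
      by (simp add: poly_rep.free_act_0 poly_rep.free_act_1)
  qed
qed (transfer; simp add: weyl_eq_refl algebra_simps)+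

end

lift_definition weyl_const :: "complex \<Rightarrow> 'v weyl" is "Poly_Mapping.single 0" .
lift_definition weyl_X :: "'v \<Rightarrow> 'v weyl" is "\<lambda>i. fgen (GenX i)" .
lift_definition weyl_D :: "'v \<Rightarrow> 'v weyl" is "\<lambda>i. fgen (GenD i)" .

lemma weyl_relations:
  "weyl_X i * weyl_X j = weyl_X j * weyl_X i"
  "weyl_D i * weyl_D j = weyl_D j * weyl_D i"
  "weyl_D i * weyl_X j - weyl_X j * weyl_D i = (if i = j then 1 else 0)"
proof -
  have *: "abs_weyl a = abs_weyl b" if "a - b \<in> weyl_rels" for a b :: "'a falg"
    using that unfolding weyl.abs_eq_iff weyl_eq_def by (rule hull_inc)
  show "weyl_X i * weyl_X j = weyl_X j * weyl_X i"
    unfolding weyl_X.abs_eq times_weyl.abs_eq by (rule *) (rule weyl_rels.intros)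
  show "weyl_D i * weyl_D j = weyl_D j * weyl_D i"
    unfolding weyl_D.abs_eq times_weyl.abs_eq by (rule *) (rule weyl_rels.intros)
  have "weyl_D i * weyl_X j - weyl_X j * weyl_D i = abs_weyl (if i = j then 1 else 0)"
    unfolding weyl_X.abs_eq weyl_D.abs_eq times_weyl.abs_eq minus_weyl.abs_eq
    by (rule *) (rule weyl_rels.intros)
  then show "weyl_D i * weyl_X j - weyl_X j * weyl_D i = (if i = j then 1 else 0)"
    by (simp add: one_weyl_def zero_weyl_def)
qed

subsection \<open>The grading of \<open>D_Y\<close> by the order in \<open>\<partial>_t\<close>\<close>

fun gen_deg :: "('n + 'r) gen \<Rightarrow> int"
  where
    "gen_deg (GenX (Inl i)) = 0"
  | "gen_deg (GenD (Inl i)) = 0"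
  | "gen_deg (GenX (Inr j)) = - 1"
  | "gen_deg (GenD (Inr j)) = 1"

definition word_deg :: "('n + 'r) word \<Rightarrow> int"
  where "word_deg w = sum_list (map gen_deg (letters w))"

definition free_comp :: "int \<Rightarrow> ('n + 'r) falg \<Rightarrow> ('n + 'r) falg"
  where "free_comp k = pm_extend (\<lambda>w c. if word_deg w = k then Poly_Mapping.single w c else 0)"

lemma free_comp_add: "free_comp k (a + b) = free_comp k a + free_comp k b"
  unfolding free_comp_def by (rule pm_extend_add) (auto simp: single_add)

lemma free_comp_0: "free_comp k 0 = 0"
  by (simp add: free_comp_def)

lemma free_comp_uminus: "free_comp k (- a) = - free_comp k a"
  by (metis add_eq_0_iff add.right_inverse free_comp_add free_comp_0)

lemma free_comp_diff: "free_comp k (a - b) = free_comp k a - free_comp k b"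
  using free_comp_add[of k a "- b"] by (simp add: free_comp_uminus)

lemma free_comp_single:
  "free_comp k (Poly_Mapping.single w c) = (if word_deg w = k then Poly_Mapping.single w c else 0)"
  unfolding free_comp_def by (rule pm_extend_single) simp

lemma free_comp_single_mult:
  "free_comp k (Poly_Mapping.single w c * a) = Poly_Mapping.single w c * free_comp (k - word_deg w) a"
  by (induction a rule: pm_induct)
    (auto simp: free_comp_0 free_comp_add free_comp_single mult_single word_deg_def plus_word_def algebra_simps)

lemma free_comp_mult_single:
  "free_comp k (a * Poly_Mapping.single w c) = free_comp (k - word_deg w) a * Poly_Mapping.single w c"
  by (induction a rule: pm_induct)
    (auto simp: free_comp_0 free_comp_add free_comp_single mult_single word_deg_def plus_word_def algebra_simps)

lemma free_comp_weyl_rels: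
  assumes "a \<in> two_sided_ideal hull weyl_rels"
  shows "free_comp k a \<in> two_sided_ideal hull weyl_rels"
proof -
  let ?I = "two_sided_ideal hull weyl_rels :: ('n + 'r) falg set"
  let ?J = "{a. \<forall>k. free_comp k a \<in> ?I}"
  have I: "two_sided_ideal ?I" by (rule two_sided_ideal_hull)
  then have I0: "0 \<in> ?I" and Iadd: "\<And>a b. a \<in> ?I \<Longrightarrow> b \<in> ?I \<Longrightarrow> a + b \<in> ?I"
    and Il: "\<And>a b. b \<in> ?I \<Longrightarrow> a * b \<in> ?I" and Ir: "\<And>a b. b \<in> ?I \<Longrightarrow> b * a \<in> ?I"
    by (auto simp: two_sided_ideal_def)
  have l: "free_comp k (a * b) \<in> ?I" if "b \<in> ?J" for a b k
    using that by (induction a rule: pm_induct)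
      (auto simp: free_comp_0 free_comp_single_mult free_comp_add distrib_right I0 Iadd Il)
  have r: "free_comp k (b * a) \<in> ?I" if "b \<in> ?J" for a b k
    using that by (induction a rule: pm_induct)
      (auto simp: free_comp_0 free_comp_mult_single free_comp_add distrib_left I0 Iadd Ir)
  have J: "two_sided_ideal ?J"
    using l r by (auto simp: two_sided_ideal_def free_comp_0 free_comp_add I0 Iadd)
  have gen: "free_comp k (fgen x * fgen y) = (if gen_deg x + gen_deg y = k then fgen x * fgen y else 0)"
    for k and x y :: "('n + 'r) gen"
    by (simp add: fgen_def mult_single free_comp_single word_deg_def plus_word_def)
  have one: "free_comp k 1 = (if k = 0 then 1 else 0 :: ('n + 'r) falg)" for k
    by (simp flip: single_one add: free_comp_single word_deg_def zero_word_def)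
  have deg: "gen_deg (GenX i) = - gen_deg (GenD i)" for i :: "'n + 'r"
    by (cases i) auto
  have "free_comp k b \<in> ?I" if "b \<in> weyl_rels" for k and b :: "('n + 'r) falg"
  proof -
    have "b \<in> ?I"
      using that by (rule hull_inc)
    moreover have "free_comp k b = b \<or> free_comp k b = 0"
      using that by cases (auto simp: free_comp_diff free_comp_0 gen one deg add.commute)
    ultimately show ?thesis
      using I0 by auto
  qed
  then have "weyl_rels \<subseteq> ?J"
    by blast
  then show ?thesis
    using hull_minimal[of weyl_rels ?J two_sided_ideal] J assms by blast
qed

lift_definition hom_comp :: "int \<Rightarrow> ('n + 'r) weyl \<Rightarrow> ('n + 'r) weyl" is free_comp
  using free_comp_weyl_rels by (auto simp: weyl_eq_def simp flip: free_comp_diff)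

text \<open>Meaningful only for \<open>P \<noteq> 0\<close>.\<close>

definition in_form :: "('n + 'r) weyl \<Rightarrow> ('n + 'r) weyl"
  where "in_form P = hom_comp (Max {k. hom_comp k P \<noteq> 0}) P"

subsection \<open>The module \<open>N_f\<close>\<close>

text \<open>Derivations of the field of rational functions.\<close>

type_synonym 'n cpol = "('n, complex) mpol"

definition fderiv :: "'n \<Rightarrow> 'n::linorder cpol fract \<Rightarrow> 'n cpol fract"
  where "fderiv j x = (THE y. \<forall>a b. b \<noteq> 0 \<longrightarrow> x = Fract a b \<longrightarrow>
    y = Fract (mp_deriv j a * b - a * mp_deriv j b) (b * b))"

lemma fderiv_Fract:
  assumes b: "b \<noteq> 0"
  shows "fderiv j (Fract a b) = Fract (mp_deriv j a * b - a * mp_deriv j b) (b * b)"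
  unfolding fderiv_def
proof (rule the_equality, intro allI impI)
  fix c d
  assume d: "d \<noteq> 0" and "Fract a b = Fract c d"
  then have *: "a * d = c * b"
    using b by (simp add: eq_fract)
  have "mp_deriv j (a * d) = mp_deriv j (c * b)"
    using * by simp
  then have **: "mp_deriv j a * d = mp_deriv j c * b + c * mp_deriv j b - a * mp_deriv j d"
    by (simp add: mp_deriv_mult algebra_simps)
  have "(mp_deriv j a * b - a * mp_deriv j b) * (d * d)
    = b * d * (mp_deriv j a * d) - mp_deriv j b * d * (a * d)"
    by (simp add: algebra_simps)
  also have "\<dots> = (mp_deriv j c * d) * (b * b) - mp_deriv j d * b * (a * d)"
    unfolding ** by (simp add: * algebra_simps)
  also have "\<dots> = (mp_deriv j c * d - c * mp_deriv j d) * (b * b)"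
    unfolding * by (simp add: algebra_simps)
  finally show "Fract (mp_deriv j a * b - a * mp_deriv j b) (b * b)
      = Fract (mp_deriv j c * d - c * mp_deriv j d) (d * d)"
    using b d by (simp add: eq_fract)
qed (use b in blast)

lemma fderiv_add [simp]: "fderiv j (x + y) = fderiv j x + fderiv j y"
  by (cases x; cases y) (simp add: fderiv_Fract eq_fract mp_deriv_mult algebra_simps)

lemma fderiv_mult: "fderiv j (x * y) = fderiv j x * y + x * fderiv j y"
  by (cases x; cases y) (simp add: fderiv_Fract eq_fract mp_deriv_mult algebra_simps)

lemma fderiv_poly [simp]: "fderiv j (Fract p 1) = Fract (mp_deriv j p) 1"
  using mp_deriv_Cst[of j "1::complex"] by (simp add: fderiv_Fract)

lemma fderiv_0 [simp]: "fderiv j 0 = 0"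
  using fderiv_poly[of j 0] by (simp del: fderiv_poly add: Zero_fract_def)

lemma fderiv_commute: "fderiv i (fderiv j x) = fderiv j (fderiv i x)"
proof (cases x)
  case (Fract a b)
  then show ?thesis
    by (simp add: fderiv_Fract eq_fract mp_deriv_mult algebra_simps mp_deriv_commute[of i j])
qed

lemma fderiv_dlog_commute:
  "p \<noteq> 0 \<Longrightarrow> fderiv i (Fract (mp_deriv j p) p) = fderiv j (Fract (mp_deriv i p) p)"
  by (simp add: fderiv_Fract mp_deriv_commute[of i j] mult.commute)

text \<open>
  A multiple \<open>h \<Prod>\<^sub>i f_i^{s_i}\<close> is represented by \<open>h\<close> alone; in particular \<open>\<Prod>\<^sub>i f_i^{s_i}\<close> is
  represented by \<open>1\<close>. The action is defined on the larger module \<open>\<complex>(x)[s_1, \<dots>, s_r] \<Prod>\<^sub>i f_i^{s_i}\<close>,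
  of which \<open>N_f\<close> (\<open>N_mod\<close> below) is a submodule, by lemma \<open>N_mod_act\<close>.
\<close>

type_synonym ('n, 'r) smod = "('r, 'n cpol fract) mpol"

definition cderiv :: "'n \<Rightarrow> ('n::linorder, 'r) smod \<Rightarrow> ('n, 'r) smod"
  where "cderiv j = Poly_Mapping.map (fderiv j)"

lemma cderiv_add [simp]: "cderiv j (p + q) = cderiv j p + cderiv j q"
  unfolding cderiv_def
  by (intro poly_mapping_eqI) (auto simp: Poly_Mapping.map.rep_eq lookup_add when_def, metis add_0 fderiv_0 fderiv_add)

lemma cderiv_0 [simp]: "cderiv j 0 = 0"
  using cderiv_add[of j 0 0] by (simp del: cderiv_add)

lemma cderiv_single: "cderiv j (Poly_Mapping.single m c) = Poly_Mapping.single m (fderiv j c)"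
  by (simp add: cderiv_def)

lemma cderiv_uminus [simp]: "cderiv j (- p) = - cderiv j p"
  by (metis add_eq_0_iff add.right_inverse cderiv_add cderiv_0)

lemma cderiv_diff [simp]: "cderiv j (p - q) = cderiv j p - cderiv j q"
  using cderiv_add[of j p "- q"] by simp

lemma cderiv_mult: "cderiv j (p * q) = cderiv j p * q + p * cderiv j q"
proof (induction p rule: pm_induct)
  case (single m c)
  show ?case
    by (induction q rule: pm_induct)
      (auto simp: mult_single cderiv_single fderiv_mult single_add algebra_simps)
qed (auto simp: algebra_simps)

lemma cderiv_commute: "cderiv i (cderiv j p) = cderiv j (cderiv i p)"
  by (induction p rule: pm_induct) (auto simp: cderiv_single fderiv_commute)

lemma cderiv_Cst [simp]: "cderiv j (Cst c) = Cst (fderiv j c)"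
  by (simp add: Cst_def cderiv_single)

lemma fderiv_1 [simp]: "fderiv j 1 = 0"
  using fderiv_poly[of j 1] mp_deriv_Cst[of j "1::complex"]
  by (simp del: fderiv_poly mp_deriv_Cst add: One_fract_def Zero_fract_def)

lemma fderiv_uminus [simp]: "fderiv j (- x) = - fderiv j x"
  by (metis add_eq_0_iff add.right_inverse fderiv_add fderiv_0)

lemma cderiv_1 [simp]: "cderiv j 1 = 0"
  using cderiv_mult[of j 1 1] by simp

lemma cderiv_Ind [simp]: "cderiv j (Ind i) = 0"
  by (simp add: Ind_def cderiv_single)

lemma cderiv_sum: "cderiv j (sum h A) = (\<Sum>i\<in>A. cderiv j (h i))"
  by (induction A rule: infinite_finite_induct) auto

lemma cderiv_power_const: "cderiv j p = 0 \<Longrightarrow> cderiv j (p ^ n) = 0"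
  by (induction n) (auto simp: cderiv_mult)

lemma cderiv_prod_const: "(\<And>i. i \<in> A \<Longrightarrow> cderiv j (p i) = 0) \<Longrightarrow> cderiv j (prod p A) = 0"
  by (induction A rule: infinite_finite_induct) (auto simp: cderiv_mult)

lemma cderiv_subst:
  assumes "\<And>i. cderiv j (\<phi> i) = 0"
  shows "cderiv j (mp_subst \<phi> p) = mp_subst \<phi> (cderiv j p)"
  by (induction p rule: pm_induct)
    (auto simp: mp_subst_single cderiv_single cderiv_mult cderiv_prod_const cderiv_power_const assms)

lemma mp_subst_1 [simp]: "mp_subst \<phi> 1 = 1"
  using mp_subst_Cst[of \<phi> 1] by (simp del: mp_subst_Cst)

lemma mp_subst_prod: "mp_subst \<phi> (prod h A) = (\<Prod>i\<in>A. mp_subst \<phi> (h i))"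
  by (induction A rule: infinite_finite_induct) auto

lemma mp_subst_power: "mp_subst \<phi> (p ^ n) = mp_subst \<phi> p ^ n"
  by (induction n) auto

lemma mp_subst_subst: "mp_subst \<phi> (mp_subst \<psi> p) = mp_subst (\<lambda>i. mp_subst \<phi> (\<psi> i)) p"
  by (induction p rule: pm_induct) (auto simp: mp_subst_single mp_subst_prod mp_subst_power)

lemma Ind_power: "Ind i ^ n = Poly_Mapping.single (Poly_Mapping.single i n) 1"
proof (induction n)
  case (Suc n)
  then show ?case
    by (simp add: Ind_def mult_single flip: single_add)
qed auto

lemma Ind_prod:
  "(\<Prod>i\<in>A. Poly_Mapping.single (e i) 1) = Poly_Mapping.single (\<Sum>i\<in>A. e i) (1 :: 'a::comm_semiring_1)"
  by (induction A rule: infinite_finite_induct) (auto simp: mult_single)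

lemma exponent_sum: "(\<Sum>i\<in>UNIV. Poly_Mapping.single i (Poly_Mapping.lookup m i)) = (m :: 'v::finite \<Rightarrow>\<^sub>0 nat)"
  by (intro poly_mapping_eqI) (simp add: lookup_sum lookup_single when_def)

lemma mp_subst_Ind_id: "mp_subst Ind p = p"
  by (induction p rule: pm_induct)
    (auto simp: mp_subst_single Ind_power Ind_prod exponent_sum Cst_def mult_single)

text \<open>Substitution of \<open>s_j + c\<close> for \<open>s_j\<close>.\<close>

definition shift :: "'v \<Rightarrow> 'a \<Rightarrow> ('v::finite, 'a::comm_ring_1) mpol \<Rightarrow> ('v, 'a) mpol"
  where "shift j c = mp_subst (\<lambda>i. if i = j then Ind i + Cst c else Ind i)"

lemma shift_simps [simp]:
  "shift j c (p + q) = shift j c p + shift j c q"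
  "shift j c (p * q) = shift j c p * shift j c q"
  "shift j c (Cst b) = Cst b"
  "shift j c (Ind i) = (if i = j then Ind i + Cst c else Ind i)"
  "shift j c 0 = 0"
  by (auto simp: shift_def)

lemma shift_1 [simp]: "shift j c 1 = 1"
  by (metis Cst_1 shift_simps(3))

lemma shift_uminus [simp]: "shift j c (- p) = - shift j c p"
  by (metis add_eq_0_iff add.right_inverse shift_simps(1,5))

lemma shift_diff [simp]: "shift j c (p - q) = shift j c p - shift j c q"
  using shift_simps(1)[of j c p "- q"] by simp

lemma shift_sum: "shift j c (sum h A) = (\<Sum>i\<in>A. shift j c (h i))"
  by (induction A rule: infinite_finite_induct) auto

lemma shift_shift: "shift j c (shift j d p) = shift j (c + d) p"
  unfolding shift_def mp_subst_subst
  by (intro arg_cong2[of _ _ _ _ mp_subst]) (auto simp: Cst_add algebra_simps)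

lemma shift_0 [simp]: "shift j 0 p = p"
proof -
  have "(\<lambda>i. if i = j then Ind i + Cst 0 else Ind i) = (Ind :: 'a \<Rightarrow> ('a, 'b) mpol)"
    by auto
  then show ?thesis by (simp only: shift_def mp_subst_Ind_id)
qed

lemma shift_inverse [simp]: "shift j c (shift j (- c) p) = p" "shift j (- c) (shift j c p) = p"
  by (auto simp: shift_shift)

lemma shift_commute: "shift i c (shift j d p) = shift j d (shift i c p)"
  by (auto simp: shift_def mp_subst_subst if_distrib[of "mp_subst _"] intro!: arg_cong2[of _ _ _ _ mp_subst])

lemma cderiv_shift:
  assumes "fderiv k c = 0"
  shows "cderiv k (shift j c p) = shift j c (cderiv k p)"
  unfolding shift_def using assms by (intro cderiv_subst) auto

definition fpol :: "'n::linorder cpol \<Rightarrow> ('n, 'r) smod"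
  where "fpol p = Cst (Fract p 1)"

fun s_rho :: "('r \<Rightarrow> 'n cpol) \<Rightarrow> ('n + 'r) gen \<Rightarrow> ('n::linorder, 'r::finite) smod \<Rightarrow> ('n, 'r) smod"
  where
    "s_rho f (GenX (Inl i)) h = fpol (Ind i) * h"
  | "s_rho f (GenD (Inl j)) h =
       cderiv j h + h * (\<Sum>k\<in>UNIV. Ind k * Cst (Fract (mp_deriv j (f k)) (f k)))"
  | "s_rho f (GenX (Inr j)) h = shift j 1 h * fpol (f j)"
  | "s_rho f (GenD (Inr j)) h = - Ind j * shift j (- 1) h * Cst (Fract 1 (f j))"

lemma s_rep:
  fixes f :: "'r::finite \<Rightarrow> 'n::linorder cpol"
  assumes f: "\<And>j. f j \<noteq> 0"
  shows "weyl_rep (\<lambda>c. fpol (Cst c)) (s_rho f)"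
proof
  define L where "L j = (\<Sum>k\<in>UNIV. Ind k * Cst (Fract (mp_deriv j (f k)) (f k)))" for j
  have inv: "Cst (Fract 1 (f j)) * fpol (f j) = (1 :: ('n, 'r) smod)" for j
  proof -
    have "Fract 1 (f j) * Fract (f j) 1 = 1"
      using f by (simp add: One_fract_def eq_fract)
    then show ?thesis by (simp add: fpol_def flip: Cst_mult)
  qed
  have fpol_mult: "fpol (p * q) = fpol p * (fpol q :: ('n, 'r) smod)" for p q
    by (simp add: fpol_def flip: Cst_mult)
  have cderiv_fpol: "cderiv j (fpol p) = (fpol (mp_deriv j p) :: ('n, 'r) smod)" for j p
    by (simp add: fpol_def)
  have fpol_0: "fpol 0 = (0 :: ('n, 'r) smod)"
    by (simp add: fpol_def Zero_fract_def[symmetric])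
  have fpol_1: "fpol 1 = (1 :: ('n, 'r) smod)"
    by (simp add: fpol_def One_fract_def[symmetric])
  have shift_L: "shift k 1 (L j) = L j + Cst (Fract (mp_deriv j (f k)) (f k))" for j k
  proof -
    have "shift k 1 (L j) = (\<Sum>i\<in>UNIV. Ind i * Cst (Fract (mp_deriv j (f i)) (f i))
        + (if i = k then Cst (Fract (mp_deriv j (f i)) (f i)) else 0))"
      unfolding L_def shift_sum by (intro sum.cong) (auto simp: algebra_simps)
    also have "\<dots> = L j + Cst (Fract (mp_deriv j (f k)) (f k))"
      by (simp add: sum.distrib L_def)
    finally show ?thesis .
  qed
  have dlog: "Cst (Fract (mp_deriv j (f k)) (f k)) * fpol (f k) = (fpol (mp_deriv j (f k)) :: ('n, 'r) smod)" for j k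
  proof -
    have "Fract (mp_deriv j (f k)) (f k) * Fract (f k) 1 = Fract (mp_deriv j (f k)) 1"
      using f by (simp add: eq_fract)
    then show ?thesis by (simp add: fpol_def flip: Cst_mult)
  qed
  have shift_L': "shift k (- 1) (L j) = L j - Cst (Fract (mp_deriv j (f k)) (f k))" for j k
  proof -
    have "shift k (- 1) (shift k 1 (L j)) = shift k (- 1) (L j) + Cst (Fract (mp_deriv j (f k)) (f k))"
      unfolding shift_L by simp
    then show ?thesis by (simp add: algebra_simps)
  qed
  have cderiv_L: "cderiv i (L j) = cderiv j (L i)" for i j
    unfolding L_def cderiv_sum using f by (simp add: cderiv_mult fderiv_dlog_commute[of _ i j])
  have deriv_inv: "Cst (fderiv i (Fract 1 (f j)))
      = - (Cst (Fract (mp_deriv i (f j)) (f j)) * (Cst (Fract 1 (f j)) :: ('n, 'r) smod))" for i j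
  proof -
    have "mp_deriv i 1 = (0 :: 'n cpol)"
      using mp_deriv_Cst[of i "1::complex"] by simp
    then have "fderiv i (Fract 1 (f j)) + Fract (mp_deriv i (f j)) (f j) * Fract 1 (f j) = 0"
      using f by (simp add: fderiv_Fract eq_fract Zero_fract_def)
    then have "Cst (fderiv i (Fract 1 (f j))) + Cst (Fract (mp_deriv i (f j)) (f j)) * Cst (Fract 1 (f j))
       = (0 :: ('n, 'r) smod)"
      by (simp flip: Cst_mult Cst_add)
    then show ?thesis by (simp add: add_eq_0_iff2)
  qed
  have sDx: "s_rho f (GenD (Inl j)) h = cderiv j h + h * L j" for j h
    by (simp add: L_def)
  have shift_fpol [simp]: "shift j c (fpol p) = (fpol p :: ('n, 'r) smod)" for j c p
    by (simp add: fpol_def)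
  fix c d y i j and m m' :: "('n, 'r) smod"
  show "fpol (Cst (c + d)) = fpol (Cst c) + (fpol (Cst d) :: ('n, 'r) smod)"
    by (simp add: fpol_def Cst_add flip: Cst_add)
  show "fpol (Cst (c * d)) = fpol (Cst c) * (fpol (Cst d) :: ('n, 'r) smod)"
    by (simp add: Cst_mult fpol_mult)
  show "fpol (Cst 1) = (1 :: ('n, 'r) smod)"
    by (simp add: fpol_1)
  show "s_rho f y (m + m') = s_rho f y m + s_rho f y m'"
    by (cases "(f, y, m)" rule: s_rho.cases) (auto simp: algebra_simps)
  show "s_rho f y (fpol (Cst c) * m) = fpol (Cst c) * s_rho f y m"
    by (cases "(f, y, m)" rule: s_rho.cases)
      (auto simp: algebra_simps cderiv_mult cderiv_fpol fpol_0)
  show "s_rho f (GenX i) (s_rho f (GenX j) m) = s_rho f (GenX j) (s_rho f (GenX i) m)"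
    by (cases i; cases j) (auto simp: algebra_simps shift_commute)
  show "s_rho f (GenD i) (s_rho f (GenD j) m) = s_rho f (GenD j) (s_rho f (GenD i) m)"
  proof (cases i; cases j)
    fix a b assume "i = Inl a" "j = Inl b"
    then show ?thesis
      by (simp del: s_rho.simps(2) add: sDx cderiv_mult cderiv_commute[of a b] cderiv_L[of a b] algebra_simps)
  next
    fix a b assume "i = Inl a" "j = Inr b"
    then show ?thesis
      by (simp del: s_rho.simps(2) add: sDx cderiv_mult cderiv_shift shift_L' deriv_inv algebra_simps)
  next
    fix a b assume "i = Inr a" "j = Inl b"
    then show ?thesis
      by (simp del: s_rho.simps(2) add: sDx cderiv_mult cderiv_shift shift_L' deriv_inv algebra_simps)
  next
    fix a b assume "i = Inr a" "j = Inr b"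
    then show ?thesis
      by (cases "a = b") (auto simp: algebra_simps shift_commute[of a _ b])
  qed
  show "s_rho f (GenD i) (s_rho f (GenX j) m) =
    s_rho f (GenX j) (s_rho f (GenD i) m) + (if i = j then m else 0)"
  proof (cases i; cases j)
    fix a b assume "i = Inl a" "j = Inl b"
    then show ?thesis
      by (auto simp del: s_rho.simps(2) simp: sDx cderiv_mult cderiv_fpol mp_deriv_Ind fpol_0 fpol_1 algebra_simps)
  next
    fix a b assume "i = Inl a" "j = Inr b"
    then show ?thesis
      by (simp del: s_rho.simps(2) add: sDx cderiv_mult cderiv_fpol cderiv_shift shift_L algebra_simps flip: dlog)
  next
    fix a b assume "i = Inr a" "j = Inl b"
    then show ?thesis
      by (simp add: algebra_simps)
  next
    fix a b assume ij: "i = Inr a" "j = Inr b"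
    show ?thesis
    proof (cases "a = b")
      case True
      have "s_rho f (GenD i) (s_rho f (GenX j) m) = - Ind b * m * (Cst (Fract 1 (f b)) * fpol (f b))"
        using ij True by (simp add: algebra_simps)
      moreover have "s_rho f (GenX j) (s_rho f (GenD i) m)
          = - (Ind b + 1) * m * (Cst (Fract 1 (f b)) * fpol (f b))"
        using ij True by (simp add: algebra_simps)
      ultimately show ?thesis
        using ij True by (simp add: inv[unfolded mult.commute[of "Cst _"]] algebra_simps)
    next
      case False
      then show ?thesis
        using ij by (simp add: algebra_simps shift_commute[of a _ b])
    qed
  qed
qed

text \<open>\<open>N_f\<close> is only defined for nonzero \<open>f_i\<close>; otherwise the relations are not respected.\<close>

lift_definition s_act ::
    "('r \<Rightarrow> 'n cpol) \<Rightarrow> ('n + 'r) weyl \<Rightarrow> ('n::linorder, 'r::finite) smod \<Rightarrow> ('n, 'r) smod"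
  is "\<lambda>f e h. if \<forall>j. f j \<noteq> 0 then free_act (\<lambda>c. fpol (Cst c)) (s_rho f) e h else 0"
  using weyl_rep.free_act_weyl_eq[OF s_rep] by (auto simp: fun_eq_iff)

context
  fixes f :: "'r::finite \<Rightarrow> 'n::linorder cpol"
  assumes f: "\<And>j. f j \<noteq> 0"
begin

interpretation weyl_rep "\<lambda>c. fpol (Cst c)" "s_rho f"
  using f by (rule s_rep)

lemma s_act_abs: "s_act f (abs_weyl e) h = free_act (\<lambda>c. fpol (Cst c)) (s_rho f) e h"
  using f by (simp add: s_act.abs_eq)

lemma s_act_add: "s_act f (P + Q) h = s_act f P h + s_act f Q h"
  by (induction P rule: weyl.abs_induct; induction Q rule: weyl.abs_induct)
    (simp add: plus_weyl.abs_eq s_act_abs free_act_add)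

lemma s_act_add_right: "s_act f P (h + h') = s_act f P h + s_act f P h'"
  by (induction P rule: weyl.abs_induct) (simp add: s_act_abs free_act_add_right)

lemma s_act_mult: "s_act f (P * Q) h = s_act f P (s_act f Q h)"
  by (induction P rule: weyl.abs_induct; induction Q rule: weyl.abs_induct)
    (simp add: times_weyl.abs_eq s_act_abs free_act_mult)

lemma s_act_1: "s_act f 1 h = h"
  by (simp add: one_weyl_def s_act_abs free_act_1)

lemma s_act_const: "s_act f (weyl_const c) h = fpol (Cst c) * h"
  by (simp add: weyl_const.abs_eq s_act_abs free_act_single zero_word_def)

lemma s_act_gen:
  "s_act f (weyl_X i) h = s_rho f (GenX i) h"
  "s_act f (weyl_D i) h = s_rho f (GenD i) h"
  by (simp_all add: weyl_X.abs_eq weyl_D.abs_eq s_act_abs free_act_fgen)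

end

lemma Cst_uminus: "Cst (- a) = - Cst (a :: 'a::comm_ring_1)"
  by (simp add: Cst_def single_uminus)

definition subring :: "'a::ring_1 set \<Rightarrow> bool"
  where "subring A \<longleftrightarrow> 1 \<in> A \<and> (\<forall>a\<in>A. \<forall>b\<in>A. a - b \<in> A \<and> a * b \<in> A)"

lemma subring_hull: "subring (subring hull S)"
  by (rule hull_in) (auto simp: subring_def)

lemma subring_closed:
  fixes a b :: "'a::ring_1"
  assumes "subring A"
  shows "1 \<in> A" "0 \<in> A" "a \<in> A \<Longrightarrow> b \<in> A \<Longrightarrow> a - b \<in> A" "a \<in> A \<Longrightarrow> b \<in> A \<Longrightarrow> a * b \<in> A"
    "a \<in> A \<Longrightarrow> - a \<in> A" "a \<in> A \<Longrightarrow> b \<in> A \<Longrightarrow> a + b \<in> A"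
proof -
  show 1: "1 \<in> A" and d: "a \<in> A \<Longrightarrow> b \<in> A \<Longrightarrow> a - b \<in> A" and "a \<in> A \<Longrightarrow> b \<in> A \<Longrightarrow> a * b \<in> A" for a b
    using assms by (auto simp: subring_def)
  show 0: "0 \<in> A"
    using d[OF 1 1] by simp
  show m: "a \<in> A \<Longrightarrow> - a \<in> A" for a
    using d[OF 0] by fastforce
  show "a \<in> A \<Longrightarrow> b \<in> A \<Longrightarrow> a + b \<in> A"
    using d[of a "- b"] m by simp
qed

definition N_mod :: "('r::finite \<Rightarrow> 'n cpol) \<Rightarrow> ('n::linorder, 'r) smod set"
  where "N_mod f = subring hull (range fpol \<union> {Cst (Fract 1 (\<Prod>j\<in>UNIV. f j))} \<union> range Ind)"

lemma N_mod_induct: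
  assumes "h \<in> N_mod f" "\<And>p. P (fpol p)" "P (Cst (Fract 1 (\<Prod>j\<in>UNIV. f j)))" "\<And>k. P (Ind k)"
    and "subring {h. P h}"
  shows "P h"
  using assms(1) unfolding N_mod_def by (rule hull_induct) (use assms(2-5) in auto)

lemma N_mod_act:
  fixes f :: "'r::finite \<Rightarrow> 'n::linorder cpol"
  assumes f: "\<And>j. f j \<noteq> 0" and h: "h \<in> N_mod f"
  shows "s_act f P h \<in> N_mod f"
proof -
  let ?F = "\<Prod>j\<in>UNIV. f j"
  have F: "?F \<noteq> 0" using f by simp
  have N: "subring (N_mod f)"
    unfolding N_mod_def by (rule subring_hull)
  note cl = subring_closed[OF N]
  have gens: "fpol p \<in> N_mod f" "Cst (Fract 1 ?F) \<in> N_mod f" "Ind k \<in> N_mod f" for p k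
    unfolding N_mod_def by (auto intro!: hull_inc)
  have inv: "Cst (Fract 1 (f j)) \<in> N_mod f" for j
  proof -
    have "Fract 1 (f j) = Fract (\<Prod>i\<in>UNIV - {j}. f i) 1 * Fract 1 ?F"
      using f F by (simp add: eq_fract prod.remove[of UNIV j] mult.commute)
    then have "Cst (Fract 1 (f j)) = fpol (\<Prod>i\<in>UNIV - {j}. f i) * (Cst (Fract 1 ?F) :: ('n, 'r) smod)"
      by (simp add: fpol_def flip: Cst_mult)
    then show ?thesis using gens cl by simp
  qed
  have frac: "Cst (Fract p (f j)) \<in> N_mod f" for p j
  proof -
    have "Fract p (f j) = Fract p 1 * Fract 1 (f j)"
      by simp
    then have "Cst (Fract p (f j)) = fpol p * (Cst (Fract 1 (f j)) :: ('n, 'r) smod)"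
      by (simp only: fpol_def Cst_mult)
    then show ?thesis using gens inv cl by simp
  qed
  have sh: "shift j c h \<in> N_mod f" if "h \<in> N_mod f" "Cst c \<in> N_mod f" for j c h
    using that(1)
    by (rule N_mod_induct) (use gens that(2) cl in \<open>auto simp: subring_def fpol_def\<close>)
  have dF: "cderiv j (Cst (Fract 1 ?F)) \<in> N_mod f" for j
  proof -
    have "mp_deriv j 1 = (0 :: 'n cpol)"
      using mp_deriv_Cst[of j "1::complex"] by simp
    then have "fderiv j (Fract 1 ?F) = - (Fract (mp_deriv j ?F) 1 * Fract 1 ?F * Fract 1 ?F)"
      using F by (simp add: fderiv_Fract)
    then have "cderiv j (Cst (Fract 1 ?F))
        = Cst (- (Fract (mp_deriv j ?F) 1 * Fract 1 ?F * Fract 1 ?F))"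
      by simp
    also have "\<dots> = - (fpol (mp_deriv j ?F) * Cst (Fract 1 ?F) * (Cst (Fract 1 ?F) :: ('n, 'r) smod))"
      by (simp only: fpol_def Cst_mult Cst_uminus)
    finally show ?thesis using gens cl by simp
  qed
  have de: "cderiv j h \<in> N_mod f" if "h \<in> N_mod f" for j h
  proof -
    from that have "h \<in> N_mod f \<and> cderiv j h \<in> N_mod f"
    proof (rule N_mod_induct)
      show "subring {h. h \<in> N_mod f \<and> cderiv j h \<in> N_mod f}"
        using cl by (auto simp: subring_def cderiv_mult)
      show "fpol p \<in> N_mod f \<and> cderiv j (fpol p) \<in> N_mod f" for p
        using gens(1) by (simp add: fpol_def)
    qed (use gens dF cl in auto)
    then show ?thesis by simp
  qed
  have one: "Cst 1 \<in> N_mod f" "Cst (- 1) \<in> N_mod f"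
    using cl by (auto simp: Cst_uminus)
  have sum: "(\<Sum>k\<in>A. Ind k * Cst (Fract (p k) (f k))) \<in> N_mod f" for p and A :: "'r set"
    by (induction A rule: infinite_finite_induct) (auto intro!: cl gens frac)
  have rho: "s_rho f y h \<in> N_mod f" if "h \<in> N_mod f" for y h
    using that by (cases "(f, y, h)" rule: s_rho.cases)
      (auto intro!: cl gens inv sh de sum one simp del: mult_minus_left)
  interpret weyl_rep "\<lambda>c. fpol (Cst c)" "s_rho f"
    using f by (rule s_rep)
  have "free_act (\<lambda>c. fpol (Cst c)) (s_rho f) e h \<in> N_mod f" for e
  proof (induction e rule: pm_induct)
    case (single w c)
    have "foldr (s_rho f) ys h \<in> N_mod f" for ys
      by (induction ys) (auto intro: h rho)
    then show ?case
      by (simp add: free_act_single cl gens)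
  qed (simp_all add: free_act_0 free_act_add cl)
  then show ?thesis
    by (induction P rule: weyl.abs_induct) (simp add: s_act_abs f)
qed

subsection \<open>The polynomial rings inside \<open>D_Y\<close>, \<open>D_Y[s]\<close> and \<open>D_Y[u_1, u_2]\<close>\<close>

text \<open>
  Since \<open>D_Y\<close> is not commutative, the product over the variables is taken along the order of the
  index type; the order is irrelevant because the \<open>x_i\<close> commute.
\<close>

definition weyl_poly :: "'n::{finite,linorder} cpol \<Rightarrow> ('n + 'r) weyl"
  where "weyl_poly = pm_extend (\<lambda>m c. weyl_const c *
    prod_list (map (\<lambda>i. weyl_X (Inl i) ^ Poly_Mapping.lookup m i) (sorted_list_of_set UNIV)))"

lemma s_act_weyl_poly:
  fixes f :: "'r::finite \<Rightarrow> 'n::{finite,linorder} cpol"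
  assumes f: "\<And>j. f j \<noteq> 0"
  shows "s_act f (weyl_poly p) h = fpol p * h"
proof (induction p rule: pm_induct)
  case zero
  show ?case
    using s_act_add[OF f, where P = 0 and Q = 0 and h = h] by (simp add: weyl_poly_def fpol_def Zero_fract_def[symmetric])
next
  case (add a b)
  have c_add: "weyl_const (c + d) = weyl_const c + (weyl_const d :: ('n + 'r) weyl)" for c d
    by transfer (simp add: single_add weyl_eq_refl)
  have c_0: "weyl_const 0 = (0 :: ('n + 'r) weyl)"
    using c_add[of 0 0] by simp
  have "weyl_poly (a + b) = weyl_poly a + (weyl_poly b :: ('n + 'r) weyl)"
    unfolding weyl_poly_def by (rule pm_extend_add) (auto simp: c_add c_0 distrib_right)
  moreover have "fpol (a + b) = fpol a + (fpol b :: ('n, 'r) smod)"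
    by (simp add: fpol_def flip: Cst_add)
  ultimately show ?case
    using add f by (simp add: s_act_add distrib_right)
next
  case (single m c)
  have c_add: "weyl_const (c + d) = weyl_const c + (weyl_const d :: ('n + 'r) weyl)" for c d
    by transfer (simp add: single_add weyl_eq_refl)
  have c_0: "weyl_const 0 = (0 :: ('n + 'r) weyl)"
    using c_add[of 0 0] by simp
  have fpol_mult: "fpol (p * q) = fpol p * (fpol q :: ('n, 'r) smod)" for p q
    by (simp add: fpol_def flip: Cst_mult)
  have fpol_1: "fpol 1 = (1 :: ('n, 'r) smod)"
    by (simp add: fpol_def One_fract_def[symmetric])
  have pow: "s_act f (weyl_X (Inl i) ^ k) h = fpol (Ind i ^ k) * h" for i k h
    by (induction k arbitrary: h)
      (auto simp: s_act_1 s_act_mult s_act_gen f fpol_mult fpol_1 algebra_simps)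
  have "s_act f (prod_list (map (\<lambda>i. weyl_X (Inl i) ^ Poly_Mapping.lookup m i) xs)) h
      = fpol (prod_list (map (\<lambda>i. Ind i ^ Poly_Mapping.lookup m i) xs)) * h" for xs
    by (induction xs arbitrary: h) (auto simp: s_act_1 s_act_mult f pow fpol_mult fpol_1 algebra_simps)
  moreover have "prod_list (map (\<lambda>i. Ind i ^ Poly_Mapping.lookup m i) (sorted_list_of_set UNIV))
      = (\<Prod>i\<in>UNIV. Ind i ^ Poly_Mapping.lookup m i :: 'n cpol)"
    by (subst prod.distinct_set_conv_list[symmetric]) auto
  moreover have "(\<Prod>i\<in>UNIV. Ind i ^ Poly_Mapping.lookup m i :: 'n cpol) = Poly_Mapping.single m 1"
    by (simp add: Ind_power Ind_prod exponent_sum)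
  moreover have "fpol (Cst c) * fpol (Poly_Mapping.single m 1)
      = (fpol (Poly_Mapping.single m c) :: ('n, 'r) smod)"
    by (simp add: Cst_def mult_single flip: fpol_mult)
  ultimately show ?case
    using f by (simp add: weyl_poly_def pm_extend_single c_0 s_act_mult s_act_const mult.assoc[symmetric])
qed

definition weyl_sigma :: "('n + 'r::finite) weyl"
  where "weyl_sigma = - (\<Sum>j\<in>UNIV. weyl_D (Inr j) * weyl_X (Inr j))"

definition weyl_eval :: "complex poly \<Rightarrow> 'v weyl \<Rightarrow> 'v weyl"
  where "weyl_eval b P = (\<Sum>i\<le>degree b. weyl_const (coeff b i) * P ^ i)"

text \<open>\<open>\<complex>[x, s]\<close> is \<open>\<complex>[x][s]\<close>, and \<open>s\<close> is \<open>Poly_Mapping.single 1 1\<close> in \<open>D_Y[s]\<close>.\<close>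

definition s_embed :: "'n::{finite,linorder} cpol poly \<Rightarrow> nat \<Rightarrow>\<^sub>0 ('n + 'r) weyl"
  where "s_embed p = (\<Sum>k\<le>degree p. Poly_Mapping.single k (weyl_poly (coeff p k)))"

subsection \<open>Ideals\<close>

text \<open>In a commutative ring these are the ideals.\<close>

definition left_ideal :: "'a::ring_1 set \<Rightarrow> bool"
  where "left_ideal I \<longleftrightarrow> 0 \<in> I \<and> (\<forall>a\<in>I. \<forall>b\<in>I. a + b \<in> I) \<and> (\<forall>a. \<forall>b\<in>I. a * b \<in> I)"

definition prime_ideal :: "'a::comm_ring_1 set \<Rightarrow> bool"
  where "prime_ideal I \<longleftrightarrow> left_ideal I \<and> I \<noteq> UNIV \<and> (\<forall>a b. a * b \<in> I \<longrightarrow> a \<in> I \<or> b \<in> I)"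

definition primary_ideal :: "'a::comm_ring_1 set \<Rightarrow> bool"
  where "primary_ideal I \<longleftrightarrow>
    left_ideal I \<and> I \<noteq> UNIV \<and> (\<forall>a b. a * b \<in> I \<longrightarrow> a \<in> I \<or> (\<exists>k>0. b ^ k \<in> I))"

definition ideal_colon :: "'n cpol poly set \<Rightarrow> 'n cpol \<Rightarrow> 'n cpol poly set"
  where "ideal_colon I g = {h. h * [:g:] \<in> I}"

subsection \<open>The two ideals attached to \<open>f\<close> and \<open>g\<close>\<close>

text \<open>\<open>D_Y[u_1, u_2]\<close> is the algebra over \<open>D_Y\<close> of the monoid of exponent pairs.\<close>

definition u1 :: "nat \<times> nat \<Rightarrow>\<^sub>0 ('n + 'r) weyl"
  where "u1 = Poly_Mapping.single (1, 0) 1"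

definition u2 :: "nat \<times> nat \<Rightarrow>\<^sub>0 ('n + 'r) weyl"
  where "u2 = Poly_Mapping.single (0, 1) 1"

context
  fixes f :: "'r::finite \<Rightarrow> 'n::{finite,linorder} cpol"
begin

definition I_f :: "(nat \<times> nat \<Rightarrow>\<^sub>0 ('n + 'r) weyl) set"
  where "I_f = left_ideal hull
     (range (\<lambda>i. Poly_Mapping.single 0 (weyl_X (Inr i)) * u1 - Poly_Mapping.single 0 (weyl_poly (f i)))
    \<union> range (\<lambda>j. u1 * Poly_Mapping.single 0 (weyl_D (Inl j))
        + (\<Sum>i\<in>UNIV. Poly_Mapping.single 0 (weyl_poly (mp_deriv j (f i)) * weyl_D (Inr i))))
    \<union> {u1 * u2 - 1})"

definition I_f1 :: "('n + 'r) weyl set"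
  where "I_f1 = {P. Poly_Mapping.single 0 P \<in> I_f}"

text \<open>Here \<open>left_ideal hull range f\<close> is the ideal of the polynomial ring generated by the \<open>f_i\<close>.\<close>

definition I_fg2 :: "'n cpol \<Rightarrow> 'n cpol poly set"
  where "I_fg2 g = {p. s_embed p \<in> left_ideal hull
     (Poly_Mapping.single 0 ` I_f1
    \<union> (\<lambda>a. Poly_Mapping.single 0 (weyl_poly (g * a))) ` (left_ideal hull range f)
    \<union> {Poly_Mapping.single 1 1 - Poly_Mapping.single 0 weyl_sigma})}"

definition I_fg3 :: "'n cpol \<Rightarrow> 'n cpol poly set"
  where "I_fg3 g = ideal_colon (I_fg2 g) g"

definition It_f :: "('n + 'r) weyl set"
  where "It_f = left_ideal hull
     (range (\<lambda>i. weyl_X (Inr i) - weyl_poly (f i))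
    \<union> range (\<lambda>j. weyl_D (Inl j) + (\<Sum>i\<in>UNIV. weyl_poly (mp_deriv j (f i)) * weyl_D (Inr i))))"

definition It_fg0 :: "'n cpol \<Rightarrow> ('n + 'r) weyl set"
  where "It_fg0 g = It_f \<inter> range (\<lambda>P. P * weyl_poly g)"

definition It_fg1 :: "'n cpol \<Rightarrow> ('n + 'r) weyl set"
  where "It_fg1 g = left_ideal hull (in_form ` (It_fg0 g - {0}))"

definition It_fg2 :: "'n cpol \<Rightarrow> 'n cpol poly set"
  where "It_fg2 g = {p. s_embed p \<in> left_ideal hull
     (Poly_Mapping.single 0 ` It_fg1 g
    \<union> {Poly_Mapping.single 1 1 - Poly_Mapping.single 0 weyl_sigma})}"

definition It_fg3 :: "'n cpol \<Rightarrow> 'n cpol poly set"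
  where "It_fg3 g = ideal_colon (It_fg2 g) g"

end

subsection \<open>The local Bernstein--Sato polynomial\<close>

text \<open>The subalgebra generated by \<open>x_i\<close>, \<open>\<partial>_{x_i}\<close> and \<open>-\<partial>_{t_j} t_k\<close>.\<close>

definition D_X_gl :: "('n + 'r) weyl set"
  where "D_X_gl = subring hull
     (range weyl_const
    \<union> range (\<lambda>i. weyl_X (Inl i)) \<union> range (\<lambda>i. weyl_D (Inl i))
    \<union> range (\<lambda>(j, k). - (weyl_D (Inr j) * weyl_X (Inr k))))"

definition local_bs_identity ::
    "('r::finite \<Rightarrow> 'n::{finite,linorder} cpol) \<Rightarrow> 'n cpol \<Rightarrow> 'n cpol set \<Rightarrow> complex poly \<Rightarrow> bool"
  where "local_bs_identity f g p b \<longleftrightarrow> (\<exists>P h. range P \<subseteq> D_X_gl \<and> h \<notin> p \<and>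
    s_act f (weyl_eval b weyl_sigma * weyl_poly g * weyl_poly h) 1
    = (\<Sum>j\<in>UNIV. s_act f (P j * weyl_poly g * weyl_poly (f j)) 1))"

definition is_local_bs_poly ::
    "('r::finite \<Rightarrow> 'n::{finite,linorder} cpol) \<Rightarrow> 'n cpol \<Rightarrow> 'n cpol set \<Rightarrow> complex poly \<Rightarrow> bool"
  where "is_local_bs_poly f g p b \<longleftrightarrow>
    lead_coeff b = 1 \<and> local_bs_identity f g p b \<and>
    (\<forall>c. lead_coeff c = 1 \<and> local_bs_identity f g p c \<longrightarrow> degree b \<le> degree c)"

end

(*
  Let E be the degree 0 part of D_Y, which is the subalgebra generated by D_X and the -d_{t_j} t_k, and
  write F for the symbol prod f_i^{s_i}. Modulo It_f every operator is a sum of terms a(x) d_t^M, and the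
  d_t^M F are linearly independent because they are falling factorials in s; hence It_f is the
  annihilator of F, and I_{f,1} is generated by the homogeneous elements of It_f. With sigma for s,
  both h in I_{(f;g),3} and h in It_{(f;g),3} amount to: h(x, sigma) g F lies in sum_j E g f_j F. For the
  first ideal one takes degree 0 parts. For the second, t_j F = f_j F turns operators of negative degree,
  which lie in sum_j D_Y t_j, into elements of sum_j D_Y f_j. So the local functional equation for b(s)
  says that h b lies in this ideal for some h outside p, and those b(s) are read off from the primary
  components whose contraction is contained in p.
*)

theory Submission
  imports Defs "HOL-Library.Multiset"
begin

subsection \<open>The grading\<close>

text \<open>Substituting \<open>weyl_sigma\<close> for \<open>s\<close> is not a ring homomorphism
  on \<open>D_Y[s]\<close>, since \<open>s\<close> is central and \<open>weyl_sigma\<close> is not.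
  It is only left linear over \<open>D_Y\<close>, with \<open>s\<close> acting as right
  multiplication by \<open>weyl_sigma\<close>. Membership tests therefore use left ideals of
  \<open>D_Y\<close> that are stable under this right multiplication. Conditions on homogeneous
  components provide them: an operator of degree \<open>k\<close> satisfies
  \<open>P sigma = (sigma - k) P\<close>, so on each component the right multiplication is a left
  one. This is why the auxiliary sets below constrain every component and not just the one of degree
  0. The Weyl algebra is a quotient of a free algebra, and no basis of it is established. Whatever
  would rest on unique representation is obtained differently: the grading descends from words,
  graded pieces are shown to lie in explicit sums, and normal forms modulo \<open>It_f\<close>
  become unique through the action on \<open>N_f\<close>.\<close>

lemma hom_comp_add: "hom_comp k (P + Q) = hom_comp k P + hom_comp k Q"
  by transfer (simp add: free_comp_add weyl_eq_refl)

lemma hom_comp_0 [simp]: "hom_comp k 0 = 0"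
  using hom_comp_add[of k 0 0] by simp

lemma hom_comp_uminus: "hom_comp k (- P) = - hom_comp k P"
  by (metis add_eq_0_iff add.right_inverse hom_comp_add hom_comp_0)

lemma hom_comp_diff: "hom_comp k (P - Q) = hom_comp k P - hom_comp k Q"
  using hom_comp_add[of k P "- Q"] by (simp add: hom_comp_uminus)

lemma hom_comp_sum: "hom_comp k (sum h A) = (\<Sum>i\<in>A. hom_comp k (h i))"
  by (induction A rule: infinite_finite_induct) (auto simp: hom_comp_add)

definition homog :: "int \<Rightarrow> ('n + 'r) weyl \<Rightarrow> bool"
  where "homog k P \<longleftrightarrow> hom_comp k P = P"

lemma free_comp_free_comp: "free_comp i (free_comp k a) = (if i = k then free_comp k a else 0)"
  by (induction a rule: pm_induct) (auto simp: free_comp_0 free_comp_single free_comp_add)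

lemma hom_comp_hom_comp: "hom_comp i (hom_comp k P) = (if i = k then hom_comp k P else 0)"
  by transfer (simp add: free_comp_free_comp weyl_eq_refl)

lemma homog_hom_comp [simp]: "homog k (hom_comp k P)"
  by (simp add: homog_def hom_comp_hom_comp)

lemma hom_comp_homog: "homog k P \<Longrightarrow> hom_comp i P = (if i = k then P else 0)"
  unfolding homog_def by (metis hom_comp_hom_comp)

lemma homog_0 [simp]: "homog k 0"
  and homog_add: "homog k P \<Longrightarrow> homog k Q \<Longrightarrow> homog k (P + Q)"
  and homog_uminus: "homog k P \<Longrightarrow> homog k (- P)"
  and homog_diff: "homog k P \<Longrightarrow> homog k Q \<Longrightarrow> homog k (P - Q)"
  by (auto simp: homog_def hom_comp_add hom_comp_uminus hom_comp_diff)

lemma homog_sum: "(\<And>i. i \<in> A \<Longrightarrow> homog k (h i)) \<Longrightarrow> homog k (sum h A)"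
  by (simp add: homog_def hom_comp_sum)

text \<open>\<open>homog k P\<close> is a statement in the quotient. Replacing \<open>P\<close> by
  \<open>hom_comp k P\<close> provides a representative whose words all have degree
  \<open>k\<close>, and for those the identity holds already in the free algebra.\<close>

lemma hom_comp_mult_left:
  fixes P Q :: "('n + 'r) weyl"
  assumes "homog k P"
  shows "hom_comp i (P * Q) = P * hom_comp (i - k) Q"
proof -
  have free: "free_comp i (free_comp k e * a) = free_comp k e * free_comp (i - k) a"
    for e a :: "('n + 'r) falg" and i k
    by (induction e rule: pm_induct)
      (auto simp: free_comp_0 free_comp_single free_comp_add free_comp_single_mult distrib_right)
  have "hom_comp i (hom_comp k P * Q) = hom_comp k P * hom_comp (i - k) Q"
    by transfer (simp add: free weyl_eq_refl)
  then show ?thesis using assms by (simp add: homog_def)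
qed

lemma hom_comp_mult_right:
  fixes P Q :: "('n + 'r) weyl"
  assumes "homog k P"
  shows "hom_comp i (Q * P) = hom_comp (i - k) Q * P"
proof -
  have free: "free_comp i (a * free_comp k e) = free_comp (i - k) a * free_comp k e"
    for e a :: "('n + 'r) falg" and i k
    by (induction e rule: pm_induct)
      (auto simp: free_comp_0 free_comp_single free_comp_add free_comp_mult_single distrib_left)
  have "hom_comp i (Q * hom_comp k P) = hom_comp (i - k) Q * hom_comp k P"
    by transfer (simp add: free weyl_eq_refl)
  then show ?thesis using assms by (simp add: homog_def)
qed

lemma homog_mult: "homog i P \<Longrightarrow> homog k Q \<Longrightarrow> homog (i + k) (P * Q)"
  unfolding homog_def[of "i + k"] by (simp add: hom_comp_mult_left hom_comp_homog)

lemma homog_const [simp]: "homog 0 (weyl_const c)"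
  unfolding homog_def by transfer (simp add: free_comp_single word_deg_def zero_word_def weyl_eq_refl)

lemma homog_X: "homog (gen_deg (GenX i)) (weyl_X i)"
  and homog_D: "homog (gen_deg (GenD i)) (weyl_D i)"
  unfolding homog_def
  by (transfer, simp add: fgen_def free_comp_single word_deg_def weyl_eq_refl)+

lemma homog_gens [simp]:
  "homog 0 (weyl_X (Inl i))" "homog 0 (weyl_D (Inl i))"
  "homog (- 1) (weyl_X (Inr j))" "homog 1 (weyl_D (Inr j))"
  using homog_X[of "Inl i"] homog_X[of "Inr j"] homog_D[of "Inl i"] homog_D[of "Inr j"] by simp_all

text \<open>A component is represented by a sum of words of degree \<open>k\<close>, and each word
  arises from a constant by prefixing letters. So only left multiplication by generators has to be
  checked, with the degree carried along as a parameter.\<close>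

lemma weyl_graded_induct [case_names zero add const Xl Dl Xr Dr]:
  assumes zero: "\<And>k. \<Phi> k 0" and add: "\<And>k P Q. \<Phi> k P \<Longrightarrow> \<Phi> k Q \<Longrightarrow> \<Phi> k (P + Q)"
    and const: "\<And>c. \<Phi> 0 (weyl_const c)"
    and Xl: "\<And>i k P. \<Phi> k P \<Longrightarrow> \<Phi> k (weyl_X (Inl i) * P)"
    and Dl: "\<And>i k P. \<Phi> k P \<Longrightarrow> \<Phi> k (weyl_D (Inl i) * P)"
    and Xr: "\<And>j k P. \<Phi> k P \<Longrightarrow> \<Phi> (k - 1) (weyl_X (Inr j) * P)"
    and Dr: "\<And>j k P. \<Phi> k P \<Longrightarrow> \<Phi> (k + 1) (weyl_D (Inr j) * P)"
  shows "\<Phi> k (hom_comp k P)"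
proof (induction P rule: weyl.abs_induct)
  case (1 e)
  have word: "\<Phi> (sum_list (map gen_deg ys)) (abs_weyl (Poly_Mapping.single (Word ys) c))" for ys c
  proof (induction ys)
    case Nil
    show ?case using const[of c] by (simp add: weyl_const.abs_eq zero_word_def)
  next
    case (Cons y ys)
    have *: "abs_weyl (Poly_Mapping.single (Word (y # ys)) c)
        = abs_weyl (fgen y) * abs_weyl (Poly_Mapping.single (Word ys) c)"
      by (simp add: times_weyl.abs_eq fgen_def mult_single plus_word_def)
    show ?case
      using Cons Xl[OF Cons] Dl[OF Cons] Xr[OF Cons] Dr[OF Cons] unfolding *
      by (cases y rule: gen_deg.cases) (auto simp: weyl_X.abs_eq weyl_D.abs_eq algebra_simps)
  qed
  have "\<Phi> k (abs_weyl (free_comp k e))"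
  proof (induction e rule: pm_induct)
    case zero
    show ?case using assms(1) by (simp add: free_comp_0 zero_weyl_def)
  next
    case (single w c)
    then show ?case using word[of "letters w" c] assms(1)
      by (auto simp: free_comp_single word_deg_def zero_weyl_def)
  next
    case (add a b)
    then show ?case using assms(2) by (simp add: free_comp_add plus_weyl.abs_eq[symmetric])
  qed
  then show ?case by (simp add: hom_comp.abs_eq)
qed

lemma hom_comp_sum_support:
  "finite {k. hom_comp k P \<noteq> 0} \<and> P = (\<Sum>k | hom_comp k P \<noteq> 0. hom_comp k P)"
proof -
  \<comment> \<open>A superset of the support is tracked because it passes to sums by union, whereas
    cancellation can shrink the support itself.\<close>
  have ex: "\<exists>K. finite K \<and> (\<forall>k. k \<notin> K \<longrightarrow> hom_comp k P = 0) \<and> P = (\<Sum>k\<in>K. hom_comp k P)"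
  proof (induction P rule: weyl.abs_induct)
    case (1 e)
    let ?Q = "\<lambda>K P. finite K \<and> (\<forall>k. k \<notin> K \<longrightarrow> hom_comp k P = 0) \<and> P = (\<Sum>k\<in>K. hom_comp k P)"
    have mono: "?Q K' P" if "?Q K P" "finite K'" "K \<subseteq> K'" for K K' P
      using that sum.mono_neutral_left[of K' K "\<lambda>k. hom_comp k P"] by auto
    show ?case
    proof (induction e rule: pm_induct)
      case zero
      show ?case by (rule exI[of _ "{}"]) (simp add: zero_weyl_def[symmetric])
    next
      case (single w c)
      have "hom_comp k (abs_weyl (Poly_Mapping.single w c))
          = (if word_deg w = k then abs_weyl (Poly_Mapping.single w c) else 0)" for k
        by (simp add: hom_comp.abs_eq free_comp_single zero_weyl_def)
      then show ?case by (intro exI[of _ "{word_deg w}"]) auto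
    next
      case (add a b)
      then obtain K L where "?Q K (abs_weyl a)" "?Q L (abs_weyl b)" by blast
      then have "?Q (K \<union> L) (abs_weyl a)" "?Q (K \<union> L) (abs_weyl b)"
        using mono[of K _ "K \<union> L"] mono[of L _ "K \<union> L"] by blast+
      then show ?case
        by (intro exI[of _ "K \<union> L"])
          (auto simp: plus_weyl.abs_eq[symmetric] hom_comp_add sum.distrib)
    qed
  qed
  then obtain K where K: "finite K" "\<And>k. k \<notin> K \<Longrightarrow> hom_comp k P = 0" "P = (\<Sum>k\<in>K. hom_comp k P)"
    by blast
  have sub: "{k. hom_comp k P \<noteq> 0} \<subseteq> K" using K(2) by blast
  moreover have "(\<Sum>k | hom_comp k P \<noteq> 0. hom_comp k P) = (\<Sum>k\<in>K. hom_comp k P)"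
    using K(1) sub by (intro sum.mono_neutral_left) auto
  ultimately show ?thesis using K finite_subset by metis
qed

lemmas finite_hom_comp = conjunct1[OF hom_comp_sum_support]
lemmas hom_comp_decomp = conjunct2[OF hom_comp_sum_support]

lemma weyl_homog_induct [case_names zero add homog]:
  assumes "\<Phi> 0" "\<And>P Q. \<Phi> P \<Longrightarrow> \<Phi> Q \<Longrightarrow> \<Phi> (P + Q)" "\<And>k P. homog k P \<Longrightarrow> \<Phi> P"
  shows "\<Phi> P"
proof -
  have "\<Phi> (\<Sum>k\<in>K. hom_comp k P)" for K
    by (induction K rule: infinite_finite_induct) (auto intro: assms homog_hom_comp)
  then show ?thesis using hom_comp_decomp[of P] by metis
qed

subsection \<open>Polynomials in the Weyl algebra\<close>

lemma weyl_const_add: "weyl_const (c + d) = weyl_const c + weyl_const d"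
  by transfer (simp add: single_add weyl_eq_refl)

lemma weyl_const_mult: "weyl_const (c * d) = weyl_const c * weyl_const d"
  by transfer (simp add: mult_single weyl_eq_refl)

lemma weyl_const_0 [simp]: "weyl_const 0 = 0"
  by transfer (simp add: weyl_eq_refl)

lemma weyl_const_1 [simp]: "weyl_const 1 = 1"
  by transfer (simp add: weyl_eq_refl)

lemma weyl_const_commute: "P * weyl_const c = weyl_const c * P"
proof -
  have "a * Poly_Mapping.single 0 c = Poly_Mapping.single 0 c * a" for a :: "'a falg"
    by (induction a rule: pm_induct) (auto simp: mult_single distrib_left distrib_right mult.commute)
  then show ?thesis by transfer (simp add: weyl_eq_refl)
qed

text \<open>\<open>mp_subst Ind\<close> is the identity, and its definition writes \<open>p\<close>
  as a sum of products of constants and variables.\<close>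

lemma mpol_induct [case_names Cst Ind add mult]:
  fixes p :: "('v::finite, 'a::comm_semiring_1) mpol"
  assumes "\<And>c. \<Phi> (Cst c)" "\<And>i. \<Phi> (Ind i)" "\<And>p q. \<Phi> p \<Longrightarrow> \<Phi> q \<Longrightarrow> \<Phi> (p + q)"
    and "\<And>p q. \<Phi> p \<Longrightarrow> \<Phi> q \<Longrightarrow> \<Phi> (p * q)"
  shows "\<Phi> p"
proof -
  have one: "\<Phi> 1" using assms(1)[of 1] by simp
  have zero: "\<Phi> 0" using assms(1)[of 0] by simp
  have pow: "\<Phi> (Ind i ^ n)" for i n
    by (induction n) (auto intro: one assms)
  have "\<Phi> (\<Prod>i\<in>A. Ind i ^ m i)" for A m
    by (induction A rule: infinite_finite_induct) (auto intro: one pow assms)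
  then have "\<Phi> (mp_subst Ind p)"
    by (induction p rule: pm_induct) (auto simp: mp_subst_single intro: zero assms)
  then show ?thesis by (simp add: mp_subst_Ind_id)
qed

lemma prod_list_commute:
  fixes y :: "'a::monoid_mult"
  assumes "\<And>x. x \<in> set xs \<Longrightarrow> x * y = y * x"
  shows "prod_list xs * y = y * prod_list xs"
  using assms by (induction xs) (auto simp: mult.assoc, metis mult.assoc)

lemma weyl_poly_add: "weyl_poly (a + b) = weyl_poly a + weyl_poly b"
  unfolding weyl_poly_def by (rule pm_extend_add) (auto simp: weyl_const_add distrib_right)

lemma weyl_poly_0 [simp]: "weyl_poly 0 = 0"
  by (simp add: weyl_poly_def)

lemma weyl_poly_single:
  "weyl_poly (Poly_Mapping.single m c) = weyl_const c *
    prod_list (map (\<lambda>i. weyl_X (Inl i) ^ Poly_Mapping.lookup m i) (sorted_list_of_set UNIV))"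
  unfolding weyl_poly_def by (rule pm_extend_single) simp

lemma prod_list_map_1: "prod_list (map (\<lambda>i. 1) xs) = (1 :: 'a::monoid_mult)"
  by (induction xs) auto

lemma weyl_poly_Cst [simp]: "weyl_poly (Cst c) = weyl_const c"
  by (simp add: Cst_def weyl_poly_single prod_list_map_1)

lemma weyl_poly_1 [simp]: "weyl_poly 1 = 1"
  using weyl_poly_Cst[of 1] by (simp del: weyl_poly_Cst)

lemma weyl_poly_Ind [simp]: "weyl_poly (Ind i) = weyl_X (Inl i)"
proof -
  have "prod_list (map (\<lambda>j. weyl_X (Inl j) ^ Poly_Mapping.lookup (Poly_Mapping.single i 1) j) xs)
      = (if i \<in> set xs then weyl_X (Inl i) else 1)" if "distinct xs" for xs
    using that by (induction xs) (auto simp: lookup_single when_def)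
  from this[of "sorted_list_of_set UNIV"] show ?thesis by (simp add: Ind_def weyl_poly_single)
qed

lemma weyl_poly_mult: "weyl_poly (a * b) = weyl_poly a * weyl_poly b"
proof -
  let ?M = "\<lambda>m xs. prod_list (map (\<lambda>i. weyl_X (Inl i) ^ Poly_Mapping.lookup m i) xs)
    :: ('a + 'b) weyl"
  have XX: "weyl_X (Inl i) ^ k * weyl_X (Inl j) ^ l = weyl_X (Inl j) ^ l * weyl_X (Inl i) ^ k"
    for i j :: 'a and k l
    by (intro power_commuting_commutes power_commuting_commutes[symmetric] weyl_relations)
  \<comment> \<open>Ordered monomials multiply by moving each power of a variable in the second one
    past the later variables of the first.\<close>
  have M: "?M (m + k) xs = ?M m xs * ?M k xs" for m k xs
  proof (induction xs)
    case (Cons x xs)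
    have "?M m xs * weyl_X (Inl x) ^ l = weyl_X (Inl x) ^ l * ?M m xs" for l
      by (rule prod_list_commute) (auto simp: XX)
    then have "?M m xs * (weyl_X (Inl x) ^ l * Q) = weyl_X (Inl x) ^ l * (?M m xs * Q)" for l Q
      by (simp flip: mult.assoc)
    then show ?case using Cons
      by (simp add: lookup_add power_add mult.assoc)
  qed auto
  show ?thesis
  proof (induction a rule: pm_induct)
    case (single m c)
    show ?case
    proof (induction b rule: pm_induct)
      case (single k d)
      have "P * (weyl_const d * Q) = weyl_const d * (P * Q)" for P Q :: "('a + 'b) weyl"
        by (simp flip: mult.assoc add: weyl_const_commute)
      then show ?case
        by (simp add: mult_single weyl_poly_single M weyl_const_mult mult.assoc)
    qed (auto simp: distrib_left weyl_poly_add)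
  qed (auto simp: distrib_right weyl_poly_add)
qed

lemma weyl_poly_uminus: "weyl_poly (- a) = - weyl_poly a"
  by (metis add_eq_0_iff add.right_inverse weyl_poly_add weyl_poly_0)

lemma weyl_poly_sum: "weyl_poly (sum h A) = (\<Sum>i\<in>A. weyl_poly (h i))"
  by (induction A rule: infinite_finite_induct) (auto simp: weyl_poly_add)

lemma weyl_poly_commute: "weyl_poly a * weyl_poly b = weyl_poly b * weyl_poly a"
  by (metis weyl_poly_mult mult.commute)

lemma weyl_poly_commuteI:
  assumes "\<And>i. weyl_X (Inl i) * P = P * weyl_X (Inl i)"
  shows "weyl_poly a * P = P * weyl_poly a"
proof (induction a rule: mpol_induct)
  case (mult a b)
  then show ?case by (simp add: weyl_poly_mult) (metis mult.assoc)
qed (auto simp: assms weyl_poly_add weyl_const_commute distrib_left distrib_right)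

lemma weyl_poly_X: "weyl_X i * weyl_poly a = weyl_poly a * weyl_X i"
  by (rule weyl_poly_commuteI[symmetric]) (rule weyl_relations)

lemma weyl_poly_Dr: "weyl_D (Inr j) * weyl_poly a = weyl_poly a * weyl_D (Inr j)"
proof (rule weyl_poly_commuteI[symmetric])
  fix i
  have "weyl_D (Inr j) * weyl_X (Inl i) = weyl_X (Inl i) * weyl_D (Inr j)"
    using weyl_relations(3)[of "Inr j" "Inl i"] by simp
  then show "weyl_X (Inl i) * weyl_D (Inr j) = weyl_D (Inr j) * weyl_X (Inl i)"
    by (rule sym)
qed

lemma weyl_poly_Dl:
  "(weyl_D (Inl j) :: ('n::{finite,linorder} + 'r) weyl) * weyl_poly a
    = weyl_poly a * weyl_D (Inl j) + weyl_poly (mp_deriv j a)"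
proof (induction a rule: mpol_induct)
  case (Ind i)
  show ?case using weyl_relations(3)[of "Inl j" "Inl i"]
    by (auto simp: mp_deriv_Ind algebra_simps)
next
  case (mult a b)
  have "(weyl_D (Inl j) :: ('n + 'r) weyl) * weyl_poly (a * b) = weyl_D (Inl j) * weyl_poly a * weyl_poly b"
    by (simp add: weyl_poly_mult mult.assoc)
  also have "\<dots> = (weyl_poly a * weyl_D (Inl j) + weyl_poly (mp_deriv j a)) * weyl_poly b"
    by (simp only: mult(1))
  also have "\<dots> = weyl_poly a * (weyl_D (Inl j) * weyl_poly b) + weyl_poly (mp_deriv j a) * weyl_poly b"
    by (simp add: algebra_simps)
  finally show ?case unfolding mult(2)
    by (simp add: mp_deriv_mult weyl_poly_add weyl_poly_mult weyl_poly_commute[of b "mp_deriv j a"]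
      algebra_simps)
qed (auto simp: weyl_poly_add weyl_const_commute distrib_left distrib_right)

lemma homog_weyl_poly [simp]: "homog 0 (weyl_poly a)"
proof (induction a rule: mpol_induct)
  case (mult a b)
  then show ?case using homog_mult[of 0 _ 0] by (simp add: weyl_poly_mult)
qed (auto simp: weyl_poly_add homog_add)

subsection \<open>Left ideals\<close>

lemma left_ideal_closed:
  assumes "left_ideal I"
  shows "0 \<in> I" "a \<in> I \<Longrightarrow> b \<in> I \<Longrightarrow> a + b \<in> I" "b \<in> I \<Longrightarrow> a * b \<in> I"
    "b \<in> I \<Longrightarrow> - b \<in> I" "a \<in> I \<Longrightarrow> b \<in> I \<Longrightarrow> a - b \<in> I"
proof -
  show 1: "0 \<in> I" "a \<in> I \<Longrightarrow> b \<in> I \<Longrightarrow> a + b \<in> I" "b \<in> I \<Longrightarrow> a * b \<in> I" for a b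
    using assms by (auto simp: left_ideal_def)
  show 2: "b \<in> I \<Longrightarrow> - b \<in> I" for b
    using 1(3)[of b "- 1"] by simp
  show "a \<in> I \<Longrightarrow> b \<in> I \<Longrightarrow> a - b \<in> I"
    using 1(2)[of a "- b"] 2 by simp
qed

lemma left_ideal_sum: "left_ideal I \<Longrightarrow> (\<And>i. i \<in> A \<Longrightarrow> h i \<in> I) \<Longrightarrow> sum h A \<in> I"
  by (induction A rule: infinite_finite_induct) (auto simp: left_ideal_closed)

lemma left_ideal_hull: "left_ideal (left_ideal hull S)"
  by (rule hull_in) (auto simp: left_ideal_def)

lemma left_ideal_hull_subset: "left_ideal I \<Longrightarrow> S \<subseteq> I \<Longrightarrow> left_ideal hull S \<subseteq> I"
  by (rule hull_minimal)

text \<open>The sets to which this is applied are given by conditions on homogeneous components or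
  on homogenizations, whose product formulas ask for a homogeneous left factor.\<close>

lemma left_ideal_weylI:
  assumes "0 \<in> I" "\<And>a b. a \<in> I \<Longrightarrow> b \<in> I \<Longrightarrow> a + b \<in> I"
    and "\<And>k a b. homog k a \<Longrightarrow> b \<in> I \<Longrightarrow> a * b \<in> I"
  shows "left_ideal I"
proof -
  have "a * b \<in> I" if "b \<in> I" for a b
    using that by (induction a rule: weyl_homog_induct) (auto simp: distrib_right assms)
  then show ?thesis using assms by (auto simp: left_ideal_def)
qed

lemma left_ideal_weyl_algebraI:
  fixes I :: "('k::monoid_add \<Rightarrow>\<^sub>0 ('n + 'r) weyl) set"
  assumes "0 \<in> I" "\<And>a b. a \<in> I \<Longrightarrow> b \<in> I \<Longrightarrow> a + b \<in> I"
    and "\<And>m k a b. homog k a \<Longrightarrow> b \<in> I \<Longrightarrow> Poly_Mapping.single m a * b \<in> I"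
  shows "left_ideal I"
proof -
  have 1: "Poly_Mapping.single m a * b \<in> I" if "b \<in> I" for m a b
    using that by (induction a rule: weyl_homog_induct) (auto simp: distrib_right single_add assms)
  have "a * b \<in> I" if "b \<in> I" for a b
    using that by (induction a rule: pm_induct) (auto simp: distrib_right assms 1)
  then show ?thesis using assms by (auto simp: left_ideal_def)
qed

subsection \<open>The homogeneous components of \<open>D_Y\<close>\<close>

lemma subring_D_X_gl: "subring D_X_gl"
  unfolding D_X_gl_def by (rule subring_hull)

lemmas D_X_gl_closed = subring_closed[OF subring_D_X_gl]

lemma D_X_gl_sum: "(\<And>i. i \<in> A \<Longrightarrow> h i \<in> D_X_gl) \<Longrightarrow> sum h A \<in> D_X_gl"
  by (induction A rule: infinite_finite_induct) (auto simp: D_X_gl_closed)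

lemma Xr_Dr: "weyl_X (Inr k) * weyl_D (Inr j)
    = weyl_D (Inr j) * weyl_X (Inr k) - (if j = k then 1 else 0 :: ('n + 'r) weyl)"
  using weyl_relations(3)[of "Inr j :: 'n + 'r" "Inr k"] by (simp add: algebra_simps)

lemma Xr_Dl: "weyl_X (Inr k) * weyl_D (Inl j) = (weyl_D (Inl j) * weyl_X (Inr k) :: ('n + 'r) weyl)"
  using weyl_relations(3)[of "Inl j :: 'n + 'r" "Inr k"] by simp

lemma Dr_Xl: "weyl_D (Inr k) * weyl_X (Inl j) = (weyl_X (Inl j) * weyl_D (Inr k) :: ('n + 'r) weyl)"
  using weyl_relations(3)[of "Inr k :: 'n + 'r" "Inl j"] by simp

lemma D_X_gl_gens [simp]:
  "weyl_const c \<in> D_X_gl" "weyl_X (Inl i) \<in> D_X_gl" "weyl_D (Inl i) \<in> D_X_gl"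
  "weyl_D (Inr j) * weyl_X (Inr k) \<in> D_X_gl"
proof -
  show "weyl_const c \<in> D_X_gl" "weyl_X (Inl i) \<in> D_X_gl" "weyl_D (Inl i) \<in> D_X_gl"
    unfolding D_X_gl_def by (auto intro!: hull_inc)
  have "- (weyl_D (Inr j) * weyl_X (Inr k)) \<in> D_X_gl"
    unfolding D_X_gl_def by (intro hull_inc) auto
  from D_X_gl_closed(5)[OF this] show "weyl_D (Inr j) * weyl_X (Inr k) \<in> D_X_gl"
    by simp
qed

lemma D_X_gl_Xr_Dr [simp]: "weyl_X (Inr k) * weyl_D (Inr j) \<in> D_X_gl"
  unfolding Xr_Dr by (auto intro: D_X_gl_closed)

lemma D_X_gl_homog: "P \<in> D_X_gl \<Longrightarrow> homog 0 P"
proof -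
  have "subring {P. homog 0 (P :: ('a + 'b) weyl)}"
    using homog_mult[of 0 _ 0] homog_const[of 1] by (auto simp: subring_def homog_diff simp del: homog_const)
  moreover have "homog 0 (weyl_D (Inr j) * weyl_X (Inr k) :: ('a + 'b) weyl)" for j k
    using homog_mult[OF homog_gens(4,3)] by simp
  ultimately have "D_X_gl \<subseteq> {P. homog 0 (P :: ('a + 'b) weyl)}"
    unfolding D_X_gl_def by (intro hull_minimal) (auto intro: homog_uminus)
  then show "P \<in> D_X_gl \<Longrightarrow> homog 0 P" for P :: "('a + 'b) weyl" by blast
qed

text \<open>
  With \<open>y_j = \<partial>_{t_j}\<close> this is the part of degree \<open>n\<close>, with \<open>y_j = t_j\<close> that of degree \<open>-n\<close>, written
  with the \<open>y_j\<close> on the right.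
\<close>

fun deg_part :: "('r::finite \<Rightarrow> ('n + 'r) weyl) \<Rightarrow> nat \<Rightarrow> ('n + 'r) weyl set"
  where
    "deg_part y 0 = D_X_gl"
  | "deg_part y (Suc n) = {\<Sum>j\<in>UNIV. v j * y j | v. \<forall>j. v j \<in> deg_part y n}"

declare deg_part.simps(2) [simp del]

lemma deg_part_SucI: "(\<And>j. v j \<in> deg_part y n) \<Longrightarrow> (\<Sum>j\<in>UNIV. v j * y j) \<in> deg_part y (Suc n)"
  unfolding deg_part.simps(2) by blast

lemma deg_part_SucE:
  assumes "w \<in> deg_part y (Suc n)"
  obtains v where "w = (\<Sum>j\<in>UNIV. v j * y j)" "\<And>j. v j \<in> deg_part y n"
  using assms unfolding deg_part.simps(2) by blast

lemma deg_part_0: "0 \<in> deg_part y n"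
proof (induction n)
  case (Suc n)
  then show ?case using deg_part_SucI[of "\<lambda>_. 0" y n] by simp
qed (simp add: D_X_gl_closed)

lemma deg_part_add: "v \<in> deg_part y n \<Longrightarrow> w \<in> deg_part y n \<Longrightarrow> v + w \<in> deg_part y n"
proof (induction n arbitrary: v w)
  case (Suc n)
  obtain v' where v: "v = (\<Sum>j\<in>UNIV. v' j * y j)" "\<And>j. v' j \<in> deg_part y n"
    using Suc.prems(1) by (rule deg_part_SucE) blast
  obtain w' where w: "w = (\<Sum>j\<in>UNIV. w' j * y j)" "\<And>j. w' j \<in> deg_part y n"
    using Suc.prems(2) by (rule deg_part_SucE) blast
  show ?case
    using deg_part_SucI[of "\<lambda>j. v' j + w' j" y n] Suc.IH v w by (simp add: distrib_right sum.distrib)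
qed (simp add: D_X_gl_closed)

lemma deg_part_sum: "(\<And>i. i \<in> A \<Longrightarrow> h i \<in> deg_part y n) \<Longrightarrow> sum h A \<in> deg_part y n"
  by (induction A rule: infinite_finite_induct) (auto simp: deg_part_0 deg_part_add)

lemma deg_part_left: "e \<in> D_X_gl \<Longrightarrow> v \<in> deg_part y n \<Longrightarrow> e * v \<in> deg_part y n"
proof (induction n arbitrary: v)
  case (Suc n)
  obtain v' where v: "v = (\<Sum>j\<in>UNIV. v' j * y j)" "\<And>j. v' j \<in> deg_part y n"
    using Suc.prems(2) by (rule deg_part_SucE) blast
  show ?case
    using deg_part_SucI[of "\<lambda>j. e * v' j" y n] Suc v by (simp add: sum_distrib_left mult.assoc)
qed (simp add: D_X_gl_closed)

lemma deg_part_uminus: "v \<in> deg_part y n \<Longrightarrow> - v \<in> deg_part y n"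
  using deg_part_left[of "- 1" v y n] by (simp add: D_X_gl_closed)

lemma deg_part_Suc: "v \<in> deg_part y n \<Longrightarrow> v * y i \<in> deg_part y (Suc n)"
proof -
  assume "v \<in> deg_part y n"
  then have "(\<Sum>j\<in>UNIV. (if j = i then v else 0) * y j) \<in> deg_part y (Suc n)"
    by (intro deg_part_SucI) (simp add: deg_part_0)
  moreover have "v * y i = (\<Sum>j\<in>UNIV. (if j = i then v else 0) * y j)"
    by (subst sum.remove[of _ i]) auto
  ultimately show ?thesis by simp
qed

text \<open>The elements past which every \<open>y i\<close> can be moved to the right form a
  subring, so the generators of \<open>D_X_gl\<close> suffice. Only the generators of the form
  \<open>d_{t_j} t_k\<close> fail to commute with \<open>y i\<close> in general.\<close>

lemma deg_part_1:
  assumes X: "\<And>i l. y i * weyl_X (Inl l) = weyl_X (Inl l) * y i"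
    and D: "\<And>i l. y i * weyl_D (Inl l) = weyl_D (Inl l) * y i"
    and DX: "\<And>i j k. y i * (weyl_D (Inr j) * weyl_X (Inr k)) \<in> deg_part y (Suc 0)"
    and "e \<in> D_X_gl"
  shows "y i * e \<in> deg_part y (Suc 0)"
proof -
  \<comment> \<open>All \<open>i\<close> at once: moving one \<open>y i\<close> past
    \<open>a\<close> can produce every \<open>y j\<close>, each of which must then pass
    \<open>b\<close>.\<close>
  let ?S = "{e. \<forall>i. y i * e \<in> deg_part y (Suc 0)}"
  have one: "y i * 1 \<in> deg_part y (Suc 0)" for i
    using deg_part_Suc[of 1 y 0 i] by (simp add: D_X_gl_closed)
  have mult: "y i * (a * b) \<in> deg_part y (Suc 0)" if ab: "a \<in> ?S" "b \<in> ?S" for a b i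
  proof -
    from ab(1) have "y i * a \<in> deg_part y (Suc 0)" by blast
    then obtain v where v: "y i * a = (\<Sum>j\<in>UNIV. v j * y j)" "\<And>j. v j \<in> deg_part y 0"
      by (rule deg_part_SucE) blast
    have "y i * (a * b) = y i * a * b"
      by (simp add: mult.assoc)
    also have "\<dots> = (\<Sum>j\<in>UNIV. v j * (y j * b))"
      by (simp only: v(1) sum_distrib_right mult.assoc)
    also have "\<dots> \<in> deg_part y (Suc 0)"
      by (rule deg_part_sum, rule deg_part_left) (use ab(2) v(2) in auto)
    finally show "y i * (a * b) \<in> deg_part y (Suc 0)" .
  qed
  have diff: "y i * (a - b) \<in> deg_part y (Suc 0)" if "a \<in> ?S" "b \<in> ?S" for a b i
    using deg_part_add[of "y i * a" y "Suc 0" "- (y i * b)"] that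
    by (simp add: algebra_simps deg_part_uminus)
  have "subring ?S"
    unfolding subring_def using one mult diff by blast
  moreover have "range weyl_const \<union> range (\<lambda>i. weyl_X (Inl i)) \<union> range (\<lambda>i. weyl_D (Inl i))
    \<union> range (\<lambda>(j, k). - (weyl_D (Inr j) * weyl_X (Inr k))) \<subseteq> ?S"
    using DX by (auto simp: X D weyl_const_commute intro!: deg_part_Suc deg_part_uminus D_X_gl_gens)
  ultimately have "D_X_gl \<subseteq> ?S"
    unfolding D_X_gl_def by (intro hull_minimal) auto
  then show ?thesis using assms(4) by blast
qed

lemma Xr_D_X_gl: "e \<in> D_X_gl \<Longrightarrow> weyl_X (Inr i) * e \<in> deg_part (\<lambda>j. weyl_X (Inr j)) (Suc 0)"
proof (rule deg_part_1)
  fix i j k and l :: 'a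
  let ?y = "\<lambda>j. weyl_X (Inr j) :: ('a + 'b) weyl"
  show "?y i * weyl_X (Inl l) = weyl_X (Inl l) * ?y i"
    by (rule weyl_relations)
  show "?y i * weyl_D (Inl l) = weyl_D (Inl l) * ?y i"
    by (rule Xr_Dl)
  show "?y i * (weyl_D (Inr j) * ?y k) \<in> deg_part ?y (Suc 0)"
    using deg_part_Suc[of "?y i * weyl_D (Inr j)" ?y 0 k] by (simp add: D_X_gl_gens mult.assoc)
qed

lemma Dr_D_X_gl: "e \<in> D_X_gl \<Longrightarrow> weyl_D (Inr i) * e \<in> deg_part (\<lambda>j. weyl_D (Inr j)) (Suc 0)"
proof (rule deg_part_1)
  fix i j k and l :: 'a
  let ?y = "\<lambda>j. weyl_D (Inr j) :: ('a + 'b) weyl"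
  let ?x = "\<lambda>j. weyl_X (Inr j) :: ('a + 'b) weyl"
  show "?y i * weyl_D (Inl l) = weyl_D (Inl l) * ?y i"
    by (rule weyl_relations)
  show "?y i * weyl_X (Inl l) = weyl_X (Inl l) * ?y i"
    by (rule Dr_Xl)
  have "?y i * (?y j * ?x k) = ?y j * (?y i * ?x k)"
    by (simp add: weyl_relations(2)[of "Inr i"] flip: mult.assoc)
  also have "?y i * ?x k = ?x k * ?y i + (if i = k then 1 else 0)"
    by (simp add: Xr_Dr)
  also have "?y j * \<dots> = ?y j * ?x k * ?y i + (if i = k then 1 else 0) * ?y j"
    by (simp add: algebra_simps)
  also have "\<dots> \<in> deg_part ?y (Suc 0)"
    by (intro deg_part_add deg_part_Suc) (auto simp: D_X_gl_closed D_X_gl_gens)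
  finally show "?y i * (?y j * ?x k) \<in> deg_part ?y (Suc 0)" .
qed

lemma deg_part_up:
  assumes y: "\<And>i e. e \<in> D_X_gl \<Longrightarrow> y i * e \<in> deg_part y (Suc 0)"
  shows "v \<in> deg_part y n \<Longrightarrow> y i * v \<in> deg_part y (Suc n)"
proof (induction n arbitrary: v)
  case 0
  then show ?case using y by simp
next
  case (Suc n)
  obtain v' where v: "v = (\<Sum>j\<in>UNIV. v' j * y j)" "\<And>j. v' j \<in> deg_part y n"
    using Suc.prems by (rule deg_part_SucE) blast
  have "y i * v = (\<Sum>j\<in>UNIV. (y i * v' j) * y j)"
    by (simp add: v(1) sum_distrib_left mult.assoc)
  also have "\<dots> \<in> deg_part y (Suc (Suc n))"
    by (intro deg_part_SucI Suc.IH v(2))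
  finally show ?case .
qed

text \<open>\<open>y i\<close> is moved right past the coefficient of degree 0 until it meets the
  first \<open>z j\<close>. The resulting products \<open>y k * z j\<close> lie in
  \<open>D_X_gl\<close>, so one factor \<open>z\<close> is consumed.\<close>

lemma deg_part_down:
  assumes y: "\<And>i e. e \<in> D_X_gl \<Longrightarrow> y i * e \<in> deg_part y (Suc 0)"
    and yz: "\<And>k j. y k * z j \<in> D_X_gl"
  shows "v \<in> deg_part z (Suc n) \<Longrightarrow> y i * v \<in> deg_part z n"
proof (induction n arbitrary: v)
  case 0
  obtain v' where v: "v = (\<Sum>j\<in>UNIV. v' j * z j)" "\<And>j. v' j \<in> deg_part z 0"
    using 0 by (rule deg_part_SucE) blast
  have "y i * v' j * z j \<in> D_X_gl" for j
  proof -
    from v(2) have "y i * v' j \<in> deg_part y (Suc 0)" by (intro y) simp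
    then obtain w where w: "y i * v' j = (\<Sum>k\<in>UNIV. w k * y k)" "\<And>k. w k \<in> deg_part y 0"
      by (rule deg_part_SucE) blast
    have "(\<Sum>k\<in>UNIV. w k * (y k * z j)) \<in> D_X_gl"
      using w(2) by (intro D_X_gl_sum D_X_gl_closed(4) yz) auto
    then show ?thesis
      by (simp add: w(1) sum_distrib_right mult.assoc)
  qed
  then have "(\<Sum>j\<in>UNIV. y i * v' j * z j) \<in> D_X_gl"
    by (intro D_X_gl_sum)
  then show ?case
    by (simp add: v(1) sum_distrib_left mult.assoc)
next
  case (Suc n)
  obtain v' where v: "v = (\<Sum>j\<in>UNIV. v' j * z j)" "\<And>j. v' j \<in> deg_part z (Suc n)"
    using Suc.prems by (rule deg_part_SucE) blast
  have "y i * v = (\<Sum>j\<in>UNIV. (y i * v' j) * z j)"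
    by (simp add: v(1) sum_distrib_left mult.assoc)
  also have "\<dots> \<in> deg_part z (Suc n)"
    by (intro deg_part_SucI Suc.IH v(2))
  finally show ?case .
qed

text \<open>Prefixing \<open>t_j\<close> either lengthens a tail of \<open>t\<close>'s or consumes
  one \<open>d_t\<close> of the tail; prefixing \<open>d_{t_j}\<close> behaves symmetrically. Having
  the tail on the right lets operators of negative degree be evaluated on \<open>F\<close>, and in
  degree 0 only \<open>D_X_gl\<close> is left.\<close>

lemma hom_comp_deg_part:
  "hom_comp k P \<in> (if k \<ge> 0 then deg_part (\<lambda>j. weyl_D (Inr j)) (nat k)
    else deg_part (\<lambda>j. weyl_X (Inr j)) (nat (- k)))"
proof (induction k P rule: weyl_graded_induct)
  case (Xr j k P)
  show ?case
  proof (cases "k > 0")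
    case True
    then have "nat k = Suc (nat (k - 1))" by simp
    with True Xr deg_part_down[OF Xr_D_X_gl, of "\<lambda>j. weyl_D (Inr j)" P "nat (k - 1)" j] show ?thesis
      by (simp add: D_X_gl_gens)
  next
    case False
    then have "nat (- (k - 1)) = Suc (nat (- k))" by simp
    \<comment> \<open>In degree 0 the induction hypothesis is stated with the \<open>d_t\<close>
      family, but both families begin with \<open>D_X_gl\<close>.\<close>
    moreover have "P \<in> deg_part (\<lambda>j. weyl_X (Inr j)) (nat (- k))"
      using Xr False by (cases "k = 0") auto
    ultimately show ?thesis
      using False deg_part_up[OF Xr_D_X_gl, of P "nat (- k)" j] by (simp)
  qed
next
  case (Dr j k P)
  show ?case
  proof (cases "k \<ge> 0")
    case True
    then have "nat (k + 1) = Suc (nat k)" by simp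
    with True Dr deg_part_up[OF Dr_D_X_gl, of P "nat k" j] show ?thesis
      by (simp)
  next
    case False
    then have *: "nat (- k) = Suc (nat (- (k + 1)))" by simp
    then have "weyl_D (Inr j) * P \<in> deg_part (\<lambda>j. weyl_X (Inr j)) (nat (- (k + 1)))"
      using Dr False by (intro deg_part_down[OF Dr_D_X_gl]) (simp_all add: D_X_gl_gens)
    then show ?thesis
      using False by (cases "k = - 1") auto
  qed
qed (auto simp: deg_part_0 deg_part_add deg_part_left D_X_gl_gens)

lemma homog_0_D_X_gl: "homog 0 (P :: ('n + 'r::finite) weyl) \<Longrightarrow> P \<in> D_X_gl"
  using hom_comp_deg_part[of 0 P] by (simp add: homog_def)

subsection \<open>Substitution of \<open>\<sigma>\<close> for \<open>s\<close>\<close>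

lemma homog_sigma [simp]: "homog 0 weyl_sigma"
proof -
  have "homog 0 (weyl_D (Inr j) * weyl_X (Inr j) :: ('n + 'r) weyl)" for j
    using homog_mult[OF homog_gens(4,3)] by simp
  then show ?thesis unfolding weyl_sigma_def by (intro homog_uminus homog_sum)
qed

lemma sigma_commute_Inl:
  "weyl_X (Inl i) * weyl_sigma = weyl_sigma * weyl_X (Inl i)"
  "weyl_D (Inl i) * weyl_sigma = weyl_sigma * weyl_D (Inl i)"
proof -
  have *: "P * weyl_sigma = weyl_sigma * P"
    if "\<And>j. P * weyl_D (Inr j) = weyl_D (Inr j) * P" "\<And>j. P * weyl_X (Inr j) = weyl_X (Inr j) * P"
    for P :: "('n + 'r::finite) weyl"
  proof -
    have "P * (weyl_D (Inr j) * weyl_X (Inr j)) = weyl_D (Inr j) * weyl_X (Inr j) * P" for j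
      by (metis that mult.assoc)
    then show ?thesis by (simp add: weyl_sigma_def sum_distrib_left sum_distrib_right)
  qed
  show "weyl_X (Inl i) * weyl_sigma = weyl_sigma * weyl_X (Inl i)"
    by (rule *) (simp_all add: Dr_Xl weyl_relations(1)[of "Inl i"])
  show "weyl_D (Inl i) * weyl_sigma = weyl_sigma * weyl_D (Inl i)"
    by (rule *) (simp_all add: Xr_Dl weyl_relations(2)[of "Inl i"])
qed

lemma sigma_commute_Inr:
  "weyl_X (Inr i) * weyl_sigma = weyl_sigma * weyl_X (Inr i) + (weyl_X (Inr i) :: ('n + 'r::finite) weyl)"
  "weyl_D (Inr i) * weyl_sigma = weyl_sigma * weyl_D (Inr i) - (weyl_D (Inr i) :: ('n + 'r::finite) weyl)"
proof -
  let ?X = "\<lambda>j. weyl_X (Inr j) :: ('n + 'r) weyl" and ?D = "\<lambda>j. weyl_D (Inr j) :: ('n + 'r) weyl"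
  have "?X i * (?D j * ?X j) = ?D j * ?X j * ?X i - (if i = j then ?X i else 0)" for i j
    by (simp add: Xr_Dr mult.assoc left_diff_distrib weyl_relations(1)[of "Inr i"] flip: mult.assoc[of "?X i"])
  then have "?X i * weyl_sigma = weyl_sigma * ?X i + (\<Sum>j\<in>UNIV. if i = j then ?X i else 0)" for i
    by (simp add: weyl_sigma_def sum_distrib_left sum_distrib_right sum_subtractf del: sum.delta sum.delta')
  then show "?X i * weyl_sigma = weyl_sigma * ?X i + ?X i" for i by simp
  have "?D i * (?D j * ?X j) = ?D j * (?X j * ?D i + (if i = j then 1 else 0))" for i j
    by (simp add: Xr_Dr weyl_relations(2)[of "Inr i"] flip: mult.assoc)
  then have "?D i * (?D j * ?X j) = ?D j * ?X j * ?D i + (if i = j then ?D i else 0)" for i j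
    by (simp add: distrib_left mult.assoc)
  then have "?D i * weyl_sigma = weyl_sigma * ?D i - (\<Sum>j\<in>UNIV. if i = j then ?D i else 0)" for i
    by (simp add: weyl_sigma_def sum_distrib_left sum_distrib_right sum.distrib)
  then show "?D i * weyl_sigma = weyl_sigma * ?D i - ?D i" for i by simp
qed

text \<open>Up to an additive constant \<open>weyl_sigma\<close> is minus the Euler operator of the
  \<open>t_j\<close>, so commutators with it read off the degree.\<close>

lemma homog_sigma_commute:
  assumes "homog k P"
  shows "P * weyl_sigma = (weyl_sigma - of_int k) * P"
proof -
  have comm: "P * of_int k = of_int k * P" for P :: "('a + 'b) weyl" and k
    by (rule mult_of_int_commute[symmetric])
  have "hom_comp k P * weyl_sigma = (weyl_sigma - of_int k) * hom_comp k P"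
  proof (induction k P rule: weyl_graded_induct)
    case (const c)
    show ?case by (simp add: weyl_const_commute)
  next
    case (Xl i k P)
    then show ?case
      by (simp add: mult.assoc right_diff_distrib left_diff_distrib sigma_commute_Inl comm
        flip: mult.assoc[of "weyl_X (Inl i)"])
  next
    case (Dl i k P)
    then show ?case
      by (simp add: mult.assoc right_diff_distrib left_diff_distrib sigma_commute_Inl comm
        flip: mult.assoc[of "weyl_D (Inl i)"])
  next
    case (Xr i k P)
    then show ?case
      by (simp add: mult.assoc right_diff_distrib left_diff_distrib distrib_right sigma_commute_Inr comm
        flip: mult.assoc[of "weyl_X (Inr i)"])
  next
    case (Dr i k P)
    then show ?case
      by (simp add: mult.assoc right_diff_distrib left_diff_distrib distrib_right sigma_commute_Inr comm
        flip: mult.assoc[of "weyl_D (Inr i)"])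
  qed (simp_all add: algebra_simps)
  then show ?thesis using assms by (simp add: homog_def)
qed

lemma homog_0_mult: "homog 0 P \<Longrightarrow> homog 0 Q \<Longrightarrow> homog 0 (P * Q)"
  using homog_mult[of 0 P 0 Q] by simp

lemma homog_1 [simp]: "homog 0 1"
  using homog_const[of 1] by (simp del: homog_const)

lemma homog_power: "homog 0 P \<Longrightarrow> homog 0 (P ^ n)"
  by (induction n) (auto intro: homog_0_mult)

lemma weyl_poly_sigma: "weyl_poly a * weyl_sigma = weyl_sigma * weyl_poly a"
  by (rule weyl_poly_commuteI) (rule sigma_commute_Inl)

definition poly_at_sigma :: "'n::{finite,linorder} cpol poly \<Rightarrow> ('n + 'r::finite) weyl"
  where "poly_at_sigma p = (\<Sum>k\<le>degree p. weyl_poly (coeff p k) * weyl_sigma ^ k)"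

lemma poly_at_sigma_superset:
  assumes "degree p \<le> N"
  shows "poly_at_sigma p = (\<Sum>k\<le>N. weyl_poly (coeff p k) * weyl_sigma ^ k)"
  unfolding poly_at_sigma_def using assms by (intro sum.mono_neutral_left) (auto simp: coeff_eq_0)

lemma poly_at_sigma_add: "poly_at_sigma (p + q) = poly_at_sigma p + poly_at_sigma q"
proof -
  let ?N = "max (degree p) (degree q)"
  have "degree (p + q) \<le> ?N" "degree p \<le> ?N" "degree q \<le> ?N"
    by (auto intro: degree_add_le_max)
  then show ?thesis
    by (simp add: poly_at_sigma_superset[of _ ?N] weyl_poly_add distrib_right sum.distrib)
qed

lemma poly_at_sigma_smult: "poly_at_sigma (smult a p) = weyl_poly a * poly_at_sigma p"
  using degree_smult_le[of a p]
  by (simp add: poly_at_sigma_superset[of _ "degree p"] sum_distrib_left weyl_poly_mult mult.assoc)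

lemma poly_at_sigma_const: "poly_at_sigma [:a:] = weyl_poly a"
  by (simp add: poly_at_sigma_def)

lemma poly_at_sigma_0 [simp]: "poly_at_sigma 0 = 0"
  by (simp add: poly_at_sigma_def)

lemma poly_at_sigma_pCons: "poly_at_sigma (pCons a p) = weyl_poly a + poly_at_sigma p * weyl_sigma"
proof -
  have "poly_at_sigma (pCons a p) = (\<Sum>k\<le>Suc (degree p). weyl_poly (coeff (pCons a p) k) * weyl_sigma ^ k)"
    by (rule poly_at_sigma_superset) (rule degree_pCons_le)
  also have "\<dots> = weyl_poly a + (\<Sum>k\<le>degree p. weyl_poly (coeff p k) * weyl_sigma ^ Suc k)"
    by (subst sum.atMost_Suc_shift) simp
  also have "\<dots> = weyl_poly a + poly_at_sigma p * weyl_sigma"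
    by (simp add: poly_at_sigma_def sum_distrib_right mult.assoc power_commutes)
  finally show ?thesis .
qed

lemma poly_at_sigma_sigma: "poly_at_sigma p * weyl_sigma = weyl_sigma * poly_at_sigma p"
  by (induction p rule: pCons_induct)
    (auto simp: poly_at_sigma_pCons distrib_left distrib_right weyl_poly_sigma mult.assoc)

text \<open>The \<open>x_i\<close> commute with \<open>weyl_sigma\<close>, so on
  \<open>C[x, s]\<close>, unlike on \<open>D_Y[s]\<close>, the substitution is a ring
  homomorphism.\<close>

lemma poly_at_sigma_mult:
  "poly_at_sigma (p * q) = poly_at_sigma p * (poly_at_sigma q :: ('n::{finite,linorder} + 'r::finite) weyl)"
proof (induction p rule: pCons_induct)
  case (pCons a p)
  have "poly_at_sigma p * (weyl_sigma * poly_at_sigma q)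
      = (poly_at_sigma p :: ('n + 'r) weyl) * poly_at_sigma q * weyl_sigma"
    by (simp add: mult.assoc flip: poly_at_sigma_sigma[of q])
  then show ?case
    by (simp add: poly_at_sigma_pCons poly_at_sigma_add poly_at_sigma_smult distrib_right mult.assoc pCons.IH)
qed simp

lemma homog_poly_at_sigma [simp]: "homog 0 (poly_at_sigma p)"
  unfolding poly_at_sigma_def by (intro homog_sum homog_0_mult homog_power homog_weyl_poly homog_sigma)

lemma Cst_eq_0_iff [simp]: "Cst x = 0 \<longleftrightarrow> x = 0"
  unfolding Cst_def by (metis lookup_single_eq lookup_zero single_zero)

lemma degree_map_poly_Cst [simp]: "degree (map_poly Cst c) = degree c"
  by (intro degree_map_poly) simp

lemma poly_at_sigma_map_poly_Cst: "poly_at_sigma (map_poly Cst c) = weyl_eval c weyl_sigma"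
  by (simp add: poly_at_sigma_def weyl_eval_def coeff_map_poly)

definition eval_sigma :: "(nat \<Rightarrow>\<^sub>0 ('n + 'r::finite) weyl) \<Rightarrow> ('n + 'r) weyl"
  where "eval_sigma = pm_extend (\<lambda>k P. P * weyl_sigma ^ k)"

lemma eval_sigma_add: "eval_sigma (a + b) = eval_sigma a + eval_sigma b"
  unfolding eval_sigma_def by (rule pm_extend_add) (auto simp: distrib_right)

lemma eval_sigma_0 [simp]: "eval_sigma 0 = 0"
  by (simp add: eval_sigma_def)

lemma eval_sigma_single: "eval_sigma (Poly_Mapping.single k P) = P * weyl_sigma ^ k"
  unfolding eval_sigma_def by (rule pm_extend_single) simp

lemma eval_sigma_sum: "eval_sigma (sum h A) = (\<Sum>i\<in>A. eval_sigma (h i))"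
  by (induction A rule: infinite_finite_induct) (auto simp: eval_sigma_add)

lemma eval_sigma_uminus: "eval_sigma (- a) = - eval_sigma a"
  by (metis add_eq_0_iff add.right_inverse eval_sigma_add eval_sigma_0)

lemma eval_sigma_s_embed: "eval_sigma (s_embed p) = poly_at_sigma p"
  by (simp add: s_embed_def poly_at_sigma_def eval_sigma_sum eval_sigma_single)

lemma eval_sigma_single_mult: "eval_sigma (Poly_Mapping.single k P * a) = P * eval_sigma a * weyl_sigma ^ k"
proof (induction a rule: pm_induct)
  case (single m Q)
  have "weyl_sigma ^ (k + m) = weyl_sigma ^ m * (weyl_sigma ^ k :: ('a + 'b) weyl)"
    by (simp flip: power_add add: add.commute)
  then show ?case by (simp add: mult_single eval_sigma_single mult.assoc)
qed (auto simp: eval_sigma_add distrib_left distrib_right)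

text \<open>Left multiplication by \<open>P s^k\<close> turns into multiplication by
  \<open>P\<close> on the left and by \<open>sigma^k\<close> on the right. The stability of
  \<open>J\<close> absorbs the latter, and \<open>s - sigma\<close> evaluates to 0.\<close>

lemma eval_sigma_left_ideal:
  assumes J: "left_ideal J" "\<And>P. P \<in> J \<Longrightarrow> P * weyl_sigma \<in> J"
    and Z: "Z \<in> left_ideal hull (Poly_Mapping.single 0 ` S
      \<union> {Poly_Mapping.single 1 1 - Poly_Mapping.single 0 weyl_sigma})" and S: "S \<subseteq> J"
  shows "eval_sigma Z \<in> J"
proof -
  have pow: "P * weyl_sigma ^ n \<in> J" if "P \<in> J" for P n
    using that by (induction n arbitrary: P) (auto simp: J(2) simp flip: mult.assoc)
  have "left_ideal {Z. eval_sigma Z \<in> J}"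
    by (rule left_ideal_weyl_algebraI)
      (auto simp: eval_sigma_add eval_sigma_single_mult left_ideal_closed[OF J(1)] pow)
  moreover have "eval_sigma (Poly_Mapping.single 1 1 - Poly_Mapping.single 0 weyl_sigma)
      = (0 :: ('a + 'b) weyl)"
    using eval_sigma_add[of "Poly_Mapping.single 1 1" "- Poly_Mapping.single 0 weyl_sigma"]
    by (simp add: eval_sigma_uminus eval_sigma_single)
  ultimately have "left_ideal hull (Poly_Mapping.single 0 ` S
      \<union> {Poly_Mapping.single 1 1 - Poly_Mapping.single 0 weyl_sigma}) \<subseteq> {Z. eval_sigma Z \<in> J}"
    using S left_ideal_closed(1)[OF J(1)] by (intro left_ideal_hull_subset) (auto simp: eval_sigma_single)
  then show ?thesis using Z by blast
qed

lemma single_sum: "Poly_Mapping.single k (sum h A) = (\<Sum>i\<in>A. Poly_Mapping.single k (h i))"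
  by (induction A rule: infinite_finite_induct) (auto simp: single_add)

text \<open>The way back from the evaluation: modulo the left ideal of \<open>s - sigma\<close> each
  \<open>s^k\<close> may be replaced by \<open>sigma^k\<close>, by telescoping with the central
  \<open>s\<close>.\<close>

lemma s_embed_mod:
  fixes I :: "(nat \<Rightarrow>\<^sub>0 ('n::{finite,linorder} + 'r::finite) weyl) set"
  assumes "left_ideal I" "Poly_Mapping.single 1 1 - Poly_Mapping.single 0 weyl_sigma \<in> I"
    and "Poly_Mapping.single 0 (poly_at_sigma p) \<in> I"
  shows "s_embed p \<in> I"
proof -
  note cl = left_ideal_closed[OF assms(1)]
  have pow: "Poly_Mapping.single k 1 - Poly_Mapping.single 0 (weyl_sigma ^ k) \<in> I" for k
  proof (induction k)
    case 0
    then show ?case by (simp add: cl)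
  next
    case (Suc k)
    have "Poly_Mapping.single (Suc k) 1 - Poly_Mapping.single 0 ((weyl_sigma :: ('n + 'r) weyl) ^ Suc k)
      = Poly_Mapping.single k 1 * (Poly_Mapping.single 1 1 - Poly_Mapping.single 0 weyl_sigma)
        + Poly_Mapping.single 0 weyl_sigma * (Poly_Mapping.single k 1 - Poly_Mapping.single 0 (weyl_sigma ^ k))"
      by (simp add: right_diff_distrib mult_single)
    then show ?case using Suc assms(2) by (simp add: cl)
  qed
  have "s_embed p - Poly_Mapping.single 0 (poly_at_sigma p :: ('n + 'r) weyl)
      = (\<Sum>k\<le>degree p. Poly_Mapping.single 0 (weyl_poly (coeff p k))
      * (Poly_Mapping.single k 1 - Poly_Mapping.single 0 (weyl_sigma ^ k)))"
    by (simp add: s_embed_def poly_at_sigma_def right_diff_distrib mult_single sum_subtractf single_sum)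
  also have "\<dots> \<in> I"
    by (intro left_ideal_sum[OF assms(1)] cl(3) pow)
  finally show ?thesis using cl(2)[OF _ assms(3)] by fastforce
qed

subsection \<open>Homogenization: the ideal \<open>I_{f,1}\<close>\<close>

text \<open>
  The coefficient of \<open>u^N\<close> after the automorphism of \<open>D_Y[u^{\<plusminus>1}]\<close> that sends a homogeneous \<open>P\<close> of
  degree \<open>k\<close> to \<open>u^k P\<close>, with \<open>u_1 = u\<close> and \<open>u_2 = u^{-1}\<close>; it maps \<open>I_f\<close> to \<open>It_f[u^{\<plusminus>1}]\<close>.
\<close>

definition u_comp :: "int \<Rightarrow> (nat \<times> nat \<Rightarrow>\<^sub>0 ('n + 'r) weyl) \<Rightarrow> ('n + 'r) weyl"
  where "u_comp N = pm_extend (\<lambda>m P. hom_comp (N - int (fst m) + int (snd m)) P)"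

lemma u_comp_add: "u_comp N (a + b) = u_comp N a + u_comp N b"
  unfolding u_comp_def by (rule pm_extend_add) (auto simp: hom_comp_add)

lemma u_comp_0 [simp]: "u_comp N 0 = 0"
  by (simp add: u_comp_def)

lemma u_comp_uminus: "u_comp N (- a) = - u_comp N a"
  by (metis add_eq_0_iff add.right_inverse u_comp_add u_comp_0)

lemma u_comp_diff: "u_comp N (a - b) = u_comp N a - u_comp N b"
  using u_comp_add[of N a "- b"] by (simp add: u_comp_uminus)

lemma u_comp_sum: "u_comp N (sum h A) = (\<Sum>i\<in>A. u_comp N (h i))"
  by (induction A rule: infinite_finite_induct) (auto simp: u_comp_add)

lemma u_comp_single:
  "u_comp N (Poly_Mapping.single m P) = hom_comp (N - int (fst m) + int (snd m)) P"
  unfolding u_comp_def by (rule pm_extend_single) simp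

lemma u_comp_single_mult:
  assumes "homog k P"
  shows "u_comp N (Poly_Mapping.single m P * a) = P * u_comp (N - int (fst m) + int (snd m) - k) a"
proof (induction a rule: pm_induct)
  case (single l Q)
  show ?case
    by (simp add: mult_single u_comp_single hom_comp_mult_left[OF assms] algebra_simps)
qed (auto simp: u_comp_add distrib_left)

text \<open>Each generator of \<open>I_f\<close> has at most one nonzero
  \<open>u\<close>-coefficient: it is a generator of \<open>It_f\<close>, while
  \<open>u_1 u_2 - 1\<close> has none. For an operator free of \<open>u_1\<close> and
  \<open>u_2\<close> the coefficients are its homogeneous components.\<close>

lemma I_f1_hom_comp:
  assumes "P \<in> I_f1 f"
  shows "hom_comp k P \<in> It_f f"
proof -
  have I: "left_ideal (It_f f)"
    unfolding It_f_def by (rule left_ideal_hull)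
  note cl = left_ideal_closed[OF I]
  let ?J = "{Z. \<forall>N. u_comp N Z \<in> It_f f}"
  have "left_ideal ?J"
    by (rule left_ideal_weyl_algebraI) (auto simp: u_comp_add u_comp_single_mult cl)
  moreover have "u_comp N (Poly_Mapping.single 0 (weyl_X (Inr i)) * u1
      - Poly_Mapping.single 0 (weyl_poly (f i))) \<in> It_f f" for i N
  proof -
    have "weyl_X (Inr i) - weyl_poly (f i) \<in> It_f f"
      unfolding It_f_def by (intro hull_inc) blast
    then show ?thesis
      by (simp add: u1_def mult_single u_comp_diff u_comp_single
        hom_comp_homog[OF homog_gens(3)] hom_comp_homog[OF homog_weyl_poly] cl)
  qed
  moreover have "u_comp N (u1 * Poly_Mapping.single 0 (weyl_D (Inl j))
      + (\<Sum>i\<in>UNIV. Poly_Mapping.single 0 (weyl_poly (mp_deriv j (f i)) * weyl_D (Inr i)))) \<in> It_f f" for j N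
  proof -
    have "weyl_D (Inl j) + (\<Sum>i\<in>UNIV. weyl_poly (mp_deriv j (f i)) * weyl_D (Inr i)) \<in> It_f f"
      unfolding It_f_def by (intro hull_inc) blast
    moreover have "homog 1 (weyl_poly (mp_deriv j (f i)) * weyl_D (Inr i))" for i
      using homog_mult[OF homog_weyl_poly homog_gens(4)] by simp
    ultimately show ?thesis
      by (simp add: u1_def mult_single u_comp_add u_comp_single u_comp_sum
        hom_comp_homog[OF homog_gens(2)] hom_comp_homog[of 1] cl)
  qed
  moreover have "u_comp N (u1 * u2 - 1) \<in> It_f f" for N
    by (simp add: u1_def u2_def mult_single u_comp_diff u_comp_single cl flip: single_one)
  ultimately have "I_f f \<subseteq> ?J"
    unfolding I_f_def by (intro left_ideal_hull_subset) auto
  then have "u_comp k (Poly_Mapping.single 0 P) \<in> It_f f"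
    using assms unfolding I_f1_def by blast
  then show ?thesis by (simp add: u_comp_single)
qed

lift_definition comps :: "('n + 'r) weyl \<Rightarrow> int \<Rightarrow>\<^sub>0 ('n + 'r) weyl" is "\<lambda>P k. hom_comp k P"
  by (rule finite_hom_comp)

lemma comps_add: "comps (P + Q) = comps P + comps Q"
  by (rule poly_mapping_eqI) (simp add: comps.rep_eq lookup_add hom_comp_add)

lemma comps_homog: "homog k P \<Longrightarrow> comps P = Poly_Mapping.single k P"
  by (rule poly_mapping_eqI) (simp add: comps.rep_eq lookup_single hom_comp_homog when_def eq_commute)

text \<open>
  \<open>u_1^M\<close> times the image of \<open>P\<close> under the inverse automorphism; meaningful only for \<open>M\<close> at least the
  order of \<open>P\<close>, since \<^const>\<open>nat\<close> truncates.
\<close>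

definition homogenize :: "int \<Rightarrow> ('n + 'r) weyl \<Rightarrow> nat \<times> nat \<Rightarrow>\<^sub>0 ('n + 'r) weyl"
  where "homogenize M P = pm_extend (\<lambda>k. Poly_Mapping.single (nat (M - k), 0)) (comps P)"

lemma homogenize_add: "homogenize M (P + Q) = homogenize M P + homogenize M Q"
  unfolding homogenize_def comps_add by (rule pm_extend_add) (auto simp: single_add)

lemma homogenize_0 [simp]: "homogenize M 0 = 0"
  using homogenize_add[of M 0 0] by simp

lemma homogenize_uminus: "homogenize M (- P) = - homogenize M P"
  by (metis add_eq_0_iff add.right_inverse homogenize_add homogenize_0)

lemma homogenize_sum: "homogenize M (sum h A) = (\<Sum>i\<in>A. homogenize M (h i))"
  by (induction A rule: infinite_finite_induct) (auto simp: homogenize_add)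

lemma homogenize_homog: "homog k P \<Longrightarrow> homogenize M P = Poly_Mapping.single (nat (M - k), 0) P"
  by (simp add: homogenize_def comps_homog pm_extend_single)

lemma homogenize_mult:
  assumes "homog j P"
  shows "homogenize M (P * Q) = Poly_Mapping.single 0 P * homogenize (M - j) Q"
proof (induction Q rule: weyl_homog_induct)
  case (homog k Q)
  then show ?case
    by (simp add: homogenize_homog[OF homog_mult[OF assms homog]] homogenize_homog mult_single
      zero_prod_def algebra_simps)
qed (auto simp: homogenize_add distrib_left)

text \<open>Membership for all large \<open>M\<close> is what passes to sums and left multiples. The
  bound comes from a representation of \<open>P\<close> by generators, whose terms may have higher
  order than \<open>P\<close> itself.\<close>

lemma It_f_homogenize:
  fixes f :: "'r::finite \<Rightarrow> 'n::{finite,linorder} cpol"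
  assumes "P \<in> It_f f"
  shows "\<exists>M0. \<forall>M\<ge>M0. homogenize M P \<in> I_f f"
proof -
  have I: "left_ideal (I_f f)"
    unfolding I_f_def by (rule left_ideal_hull)
  note cl = left_ideal_closed[OF I]
  let ?G = "{P. \<exists>M0. \<forall>M\<ge>M0. homogenize M P \<in> I_f f}"
  have "left_ideal ?G"
  proof (rule left_ideal_weylI)
    show "0 \<in> ?G" by (simp add: cl)
  next
    fix a b :: "('n + 'r) weyl" assume "a \<in> ?G" "b \<in> ?G"
    then obtain M N where "\<forall>K\<ge>M. homogenize K a \<in> I_f f" "\<forall>K\<ge>N. homogenize K b \<in> I_f f"
      by blast
    then have "\<forall>K\<ge>max M N. homogenize K (a + b) \<in> I_f f"
      by (simp add: homogenize_add cl)
    then show "a + b \<in> ?G" by blast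
  next
    fix k and a b :: "('n + 'r) weyl" assume a: "homog k a" and "b \<in> ?G"
    then obtain M where "\<forall>K\<ge>M. homogenize K b \<in> I_f f"
      by blast
    then have "\<forall>K\<ge>M + k. homogenize K (a * b) \<in> I_f f"
      by (simp add: homogenize_mult[OF a] cl)
    then show "a * b \<in> ?G" by blast
  qed
  moreover have "weyl_X (Inr i) - weyl_poly (f i) \<in> ?G" for i
  proof -
    have "homogenize M (weyl_X (Inr i) - weyl_poly (f i)) \<in> I_f f" if "M \<ge> 0" for M
    proof -
      \<comment> \<open>\<open>t_i\<close> has degree -1 and carries \<open>u_1^(M+1)\<close>, while
        \<open>f_i\<close> carries \<open>u_1^M\<close>; the common factor \<open>u_1^M\<close>
        leaves the generator of \<open>I_f\<close>.\<close>
      have "nat (M + 1) = nat M + 1" using that by simp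
      then have "homogenize M (weyl_X (Inr i) - weyl_poly (f i)) = Poly_Mapping.single (nat M, 0) 1
        * (Poly_Mapping.single 0 (weyl_X (Inr i)) * u1 - Poly_Mapping.single 0 (weyl_poly (f i)))"
        unfolding diff_conv_add_uminus homogenize_add homogenize_uminus
        by (simp add: homogenize_homog[OF homog_gens(3)] homogenize_homog[OF homog_weyl_poly]
          u1_def mult_single right_diff_distrib zero_prod_def)
      moreover have "Poly_Mapping.single 0 (weyl_X (Inr i)) * u1 - Poly_Mapping.single 0 (weyl_poly (f i))
          \<in> I_f f"
        unfolding I_f_def by (intro hull_inc) blast
      ultimately show ?thesis by (simp add: cl)
    qed
    then show ?thesis by blast
  qed
  moreover have "weyl_D (Inl j) + (\<Sum>i\<in>UNIV. weyl_poly (mp_deriv j (f i)) * weyl_D (Inr i)) \<in> ?G" for j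
  proof -
    let ?g = "weyl_D (Inl j) + (\<Sum>i\<in>UNIV. weyl_poly (mp_deriv j (f i)) * weyl_D (Inr i))"
    have h: "homog 1 (weyl_poly (mp_deriv j (f i)) * weyl_D (Inr i))" for i
      using homog_mult[OF homog_weyl_poly homog_gens(4)] by simp
    have "homogenize M ?g \<in> I_f f" if "M \<ge> 1" for M
    proof -
      \<comment> \<open>Here the \<open>d_t\<close> terms carry only \<open>u_1^(M-1)\<close>, which
        is why \<open>M\<close> starts at 1.\<close>
      have "nat M = nat (M - 1) + 1" using that by simp
      then have "homogenize M ?g = Poly_Mapping.single (nat (M - 1), 0) 1
        * (u1 * Poly_Mapping.single 0 (weyl_D (Inl j))
        + (\<Sum>i\<in>UNIV. Poly_Mapping.single 0 (weyl_poly (mp_deriv j (f i)) * weyl_D (Inr i))))"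
        by (simp add: homogenize_add homogenize_sum homogenize_homog[OF h] homogenize_homog[OF homog_gens(2)]
          u1_def mult_single distrib_left sum_distrib_left zero_prod_def)
      moreover have "u1 * Poly_Mapping.single 0 (weyl_D (Inl j))
        + (\<Sum>i\<in>UNIV. Poly_Mapping.single 0 (weyl_poly (mp_deriv j (f i)) * weyl_D (Inr i))) \<in> I_f f"
        unfolding I_f_def by (intro hull_inc) blast
      ultimately show ?thesis by (simp add: cl)
    qed
    then show ?thesis by blast
  qed
  ultimately have "It_f f \<subseteq> ?G"
    unfolding It_f_def by (intro left_ideal_hull_subset) auto
  then show ?thesis using assms by blast
qed

text \<open>The homogenization of a homogeneous \<open>P\<close> is a single term
  \<open>u_1^m P\<close>. Multiplying it by \<open>u_2^m\<close> removes the power modulo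
  \<open>u_1 u_2 - 1\<close>.\<close>

lemma It_f_I_f1:
  fixes f :: "'r::finite \<Rightarrow> 'n::{finite,linorder} cpol"
  assumes "P \<in> It_f f" "homog k P"
  shows "P \<in> I_f1 f"
proof -
  have I: "left_ideal (I_f f)"
    unfolding I_f_def by (rule left_ideal_hull)
  note cl = left_ideal_closed[OF I]
  obtain m where "Poly_Mapping.single (m, 0) P \<in> I_f f"
    using It_f_homogenize[OF assms(1)] homogenize_homog[OF assms(2)] by (metis order_refl)
  then have "Poly_Mapping.single (0, m) 1 * Poly_Mapping.single (m, 0) P \<in> I_f f"
    by (rule cl)
  then have 1: "Poly_Mapping.single (m, m) P \<in> I_f f"
    by (simp add: mult_single)
  have u: "u1 * u2 - 1 \<in> I_f f"
    unfolding I_f_def by (intro hull_inc) blast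
  have "Poly_Mapping.single (n, n) 1 - 1 \<in> I_f f" for n
  proof (induction n)
    case 0
    show ?case using cl(1) by (simp flip: zero_prod_def)
  next
    case (Suc n)
    have "Poly_Mapping.single (Suc n, Suc n) (1 :: ('n + 'r) weyl) - 1
        = Poly_Mapping.single (n, n) 1 * (u1 * u2 - 1) + (Poly_Mapping.single (n, n) 1 - 1)"
      by (simp add: u1_def u2_def mult_single right_diff_distrib)
    then show ?case using cl(2)[OF cl(3)[OF u] Suc] by (simp only:)
  qed
  then have "Poly_Mapping.single 0 P * (Poly_Mapping.single (m, m) 1 - 1) \<in> I_f f"
    by (rule cl)
  then have "Poly_Mapping.single (m, m) P - Poly_Mapping.single 0 P \<in> I_f f"
    by (simp add: right_diff_distrib mult_single)
  from cl(5)[OF 1 this] show ?thesis by (simp add: I_f1_def)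
qed

subsection \<open>The annihilator of \<open>\<Prod>\<^sub>i f_i^{s_i}\<close>\<close>

text \<open>With multisets as exponents the order of the commuting \<open>d_t\<close> disappears,
  and induction adds one derivative at a time.\<close>

definition D_monomial :: "'r multiset \<Rightarrow> ('n + 'r) weyl"
  where "D_monomial M = fold_mset (\<lambda>j P. weyl_D (Inr j) * P) 1 M"

lemma D_monomial_empty [simp]: "D_monomial {#} = 1"
  by (simp add: D_monomial_def)

lemma D_monomial_add_mset [simp]: "D_monomial (add_mset j M) = weyl_D (Inr j) * D_monomial M"
proof -
  have comm: "weyl_D (Inr j) * (weyl_D (Inr k) * P) = weyl_D (Inr k) * (weyl_D (Inr j) * P)"
    for j k and P :: "('a + 'b) weyl"
    unfolding mult.assoc[symmetric] weyl_relations(2)[of "Inr j" "Inr k"] ..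
  interpret comp_fun_commute "\<lambda>j P. weyl_D (Inr j) * P :: ('a + 'b) weyl"
    by standard (rule ext, simp only: o_apply comm)
  show ?thesis by (simp add: D_monomial_def)
qed

definition normal_form :: "('r multiset \<Rightarrow>\<^sub>0 'n cpol) \<Rightarrow> ('n::{finite,linorder} + 'r) weyl"
  where "normal_form = pm_extend (\<lambda>M a. weyl_poly a * D_monomial M)"

lemma normal_form_add: "normal_form (u + v) = normal_form u + normal_form v"
  unfolding normal_form_def by (rule pm_extend_add) (auto simp: weyl_poly_add distrib_right)

lemma normal_form_0 [simp]: "normal_form 0 = 0"
  by (simp add: normal_form_def)

lemma normal_form_single: "normal_form (Poly_Mapping.single M a) = weyl_poly a * D_monomial M"
  unfolding normal_form_def by (rule pm_extend_single) simp

text \<open>A left ideal allows \<open>t_j\<close> to be replaced by \<open>f_j\<close>, and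
  \<open>d_{x_j}\<close> by a combination of the \<open>d_t\<close>, only at the right end of a
  word. Hence these letters are first moved right through \<open>d_t^M\<close>.\<close>

lemma normal_form_exists:
  fixes f :: "'r::finite \<Rightarrow> 'n::{finite,linorder} cpol" and P :: "('n + 'r) weyl"
  shows "\<exists>u. P - normal_form u \<in> It_f f"
proof -
  have I: "left_ideal (It_f f)"
    unfolding It_f_def by (rule left_ideal_hull)
  note cl = left_ideal_closed[OF I]
  define T where "T = {P. \<exists>u. P - normal_form u \<in> It_f f}"
  have T_normal_form: "normal_form u \<in> T" for u
    unfolding T_def using cl(1) by (auto intro!: exI[of _ u])
  have T_single: "weyl_poly a * D_monomial M \<in> T" for a M
    using T_normal_form[of "Poly_Mapping.single M a"] by (simp add: normal_form_single)
  have T_It: "P \<in> T" if "P \<in> It_f f" for P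
    unfolding T_def using that by (auto intro!: exI[of _ 0])
  have T_add: "P + Q \<in> T" if PQ: "P \<in> T" "Q \<in> T" for P Q
  proof -
    obtain u v where "P - normal_form u \<in> It_f f" "Q - normal_form v \<in> It_f f"
      using PQ unfolding T_def by blast
    from cl(2)[OF this] have "(P + Q) - normal_form (u + v) \<in> It_f f"
      by (simp add: normal_form_add algebra_simps)
    then show ?thesis unfolding T_def by blast
  qed
  \<comment> \<open>Left multiplication preserves \<open>It_f\<close>, so a generator
    \<open>y\<close> has to be checked on the terms \<open>a(x) d_t^M\<close> only.\<close>
  have T_gen: "y * P \<in> T" if y: "\<And>a M. y * (weyl_poly a * D_monomial M) \<in> T" and P: "P \<in> T" for y P
  proof -
    obtain u where u: "P - normal_form u \<in> It_f f"
      using P unfolding T_def by blast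
    have "y * normal_form u \<in> T"
      using T_normal_form[of 0] y
      by (induction u rule: pm_induct) (auto simp: normal_form_single normal_form_add distrib_left T_add)
    from T_add[OF T_It[OF cl(3)[OF u, of y]] this] show ?thesis
      by (simp add: algebra_simps)
  qed
  have T_poly: "weyl_poly b * P \<in> T" if "P \<in> T" for b P
    using that
  proof (rule T_gen[rotated])
    show "weyl_poly b * (weyl_poly a * D_monomial M) \<in> T" for a M
      using T_single[of "b * a" M] by (simp add: weyl_poly_mult mult.assoc)
  qed
  have T_Dr: "weyl_D (Inr j) * P \<in> T" if "P \<in> T" for j P
    using that
  proof (rule T_gen[rotated])
    show "weyl_D (Inr j) * (weyl_poly a * D_monomial M) \<in> T" for a M
      using T_single[of a "add_mset j M"] by (simp add: weyl_poly_Dr flip: mult.assoc)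
  qed
  have T_uminus: "- P \<in> T" if "P \<in> T" for P
    using T_poly[OF that, of "- 1"] by (simp add: weyl_poly_uminus)
  have T_sum: "(\<And>i. h i \<in> T) \<Longrightarrow> sum h A \<in> T" for h and A :: "'r set"
    by (induction A rule: infinite_finite_induct) (auto simp: T_add T_It[OF cl(1)])
  have Xr_D_monomial: "weyl_X (Inr j) * D_monomial M \<in> T" for j M
  proof (induction M)
    case empty
    have "weyl_X (Inr j) - weyl_poly (f j) \<in> It_f f"
      unfolding It_f_def by (intro hull_inc) blast
    from T_add[OF T_It[OF this] T_single[of "f j" "{#}"]] show ?case by simp
  next
    case (add i M)
    have "(weyl_X (Inr j) :: ('n + 'r) weyl) * D_monomial (add_mset i M)
        = weyl_D (Inr i) * (weyl_X (Inr j) * D_monomial M)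
          + (- (weyl_poly (if i = j then 1 else 0) * D_monomial M))"
      by (simp add: Xr_Dr left_diff_distrib flip: mult.assoc)
    then show ?case by (simp only: T_add[OF T_Dr[OF add] T_uminus[OF T_single]])
  qed
  have Dl_D_monomial: "weyl_D (Inl j) * D_monomial M \<in> T" for j M
  proof (induction M)
    case empty
    have "weyl_D (Inl j) + (\<Sum>i\<in>UNIV. weyl_poly (mp_deriv j (f i)) * weyl_D (Inr i)) \<in> It_f f"
      unfolding It_f_def by (intro hull_inc) blast
    moreover have "(\<Sum>i\<in>UNIV. weyl_poly (mp_deriv j (f i)) * weyl_D (Inr i)) \<in> T"
    proof (rule T_sum)
      show "weyl_poly (mp_deriv j (f i)) * weyl_D (Inr i) \<in> T" for i
        using T_single[of "mp_deriv j (f i)" "{#i#}"] by simp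
    qed
    ultimately show ?case
      using T_add[OF T_It T_uminus] by fastforce
  next
    case (add i M)
    have "weyl_D (Inl j) * D_monomial (add_mset i M) = weyl_D (Inr i) * (weyl_D (Inl j) * D_monomial M)"
      by (simp add: weyl_relations(2)[of "Inl j"] flip: mult.assoc)
    then show ?case using T_Dr[OF add] by simp
  qed
  have T_Xr: "weyl_X (Inr j) * P \<in> T" if "P \<in> T" for j P
    using that
  proof (rule T_gen[rotated])
    show "weyl_X (Inr j) * (weyl_poly a * D_monomial M) \<in> T" for a M
      using T_poly[OF Xr_D_monomial, of a j M] by (simp add: weyl_poly_X flip: mult.assoc)
  qed
  have T_Dl: "weyl_D (Inl j) * P \<in> T" if "P \<in> T" for j P
    using that
  proof (rule T_gen[rotated])
    show "weyl_D (Inl j) * (weyl_poly a * D_monomial M) \<in> T" for a M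
      using T_add[OF T_poly[OF Dl_D_monomial, of a j M] T_single[of "mp_deriv j a" M]]
      by (simp add: weyl_poly_Dl distrib_right flip: mult.assoc)
  qed
  have "hom_comp k P \<in> T" for k
  proof (induction k P rule: weyl_graded_induct)
    case (zero k)
    show ?case using T_It[OF cl(1)] .
  next
    case (const c)
    show ?case using T_single[of "Cst c" "{#}"] by simp
  next
    case (Xl i k P)
    then show ?case using T_poly[of P "Ind i"] by simp
  qed (auto intro: T_add T_Xr T_Dr T_Dl)
  then have "(\<Sum>k\<in>K. hom_comp k P) \<in> T" for K
    by (induction K rule: infinite_finite_induct) (auto simp: T_add T_It[OF cl(1)])
  then have "P \<in> T" using hom_comp_decomp[of P] by metis
  then show ?thesis unfolding T_def by blast
qed

locale nonzero_family =
  fixes f :: "'r::finite \<Rightarrow> 'n::{finite,linorder} cpol"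
  assumes f_nonzero: "f j \<noteq> 0"
begin

abbreviation act :: "('n + 'r) weyl \<Rightarrow> ('n, 'r) smod"
  where "act P \<equiv> s_act f P 1"

lemmas s_act_simps = s_act_add[where f = f, OF f_nonzero] s_act_add_right[where f = f, OF f_nonzero]
  s_act_mult[where f = f, OF f_nonzero]
  s_act_1[where f = f, OF f_nonzero] s_act_const[where f = f, OF f_nonzero] s_act_gen[where f = f, OF f_nonzero]
  s_act_weyl_poly[where f = f, OF f_nonzero]

lemma s_act_0 [simp]: "s_act f 0 h = 0"
  using s_act_simps(1)[of 0 0 h] by simp

lemma s_act_0_right [simp]: "s_act f P 0 = 0"
  using s_act_simps(2)[of P 0 0] by simp

lemma s_act_uminus: "s_act f (- P) h = - s_act f P h"
  using s_act_simps(1)[of P "- P" h] by (simp add: eq_neg_iff_add_eq_0 add.commute)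

lemma s_act_diff: "s_act f (P - Q) h = s_act f P h - s_act f Q h"
  using s_act_simps(1)[of P "- Q" h] by (simp add: s_act_uminus)

lemma s_act_sum: "s_act f (sum P A) h = (\<Sum>i\<in>A. s_act f (P i) h)"
  by (induction A rule: infinite_finite_induct) (auto simp: s_act_simps(1))

lemma It_f_annihilates:
  assumes "P \<in> It_f f"
  shows "act P = 0"
proof -
  have "left_ideal {P. act P = 0}"
    by (auto simp: left_ideal_def s_act_simps)
  moreover have "act (weyl_X (Inr i) - weyl_poly (f i)) = 0" for i
    by (simp add: s_act_diff s_act_simps)
  moreover have "act (weyl_D (Inl j) + (\<Sum>i\<in>UNIV. weyl_poly (mp_deriv j (f i)) * weyl_D (Inr i))) = 0" for j
  proof -
    have "fpol (mp_deriv j (f i)) * (Ind i * Cst (Fract 1 (f i)))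
        = (Ind i * Cst (Fract (mp_deriv j (f i)) (f i)) :: ('n, 'r) smod)" for i
    proof -
      have "Fract (mp_deriv j (f i)) (f i) = Fract (mp_deriv j (f i)) 1 * Fract 1 (f i)"
        by simp
      then show ?thesis
        by (simp only: fpol_def Cst_mult mult_ac)
    qed
    then show ?thesis
      by (simp add: s_act_simps s_act_sum sum_negf mult_ac del: mult_fract)
  qed
  ultimately have "It_f f \<subseteq> {P. act P = 0}"
    unfolding It_f_def by (intro left_ideal_hull_subset) auto
  then show ?thesis using assms by blast
qed

text \<open>
  Linear independence of the \<open>\<partial>_t^M \<Prod>\<^sub>i f_i^{s_i}\<close> is tested at natural points \<open>s = \<nu>\<close>: being a
  falling factorial, the value is nonzero exactly if \<open>M \<le> \<nu>\<close>.
\<close>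

definition at_nat :: "('r \<Rightarrow> nat) \<Rightarrow> ('n, 'r) smod \<Rightarrow> ('n, 'r) smod"
  where "at_nat \<nu> = mp_subst (\<lambda>j. Cst (of_nat (\<nu> j)))"

lemma of_nat_fract_eq_0_iff: "(of_nat k :: 'n cpol fract) = 0 \<longleftrightarrow> k = 0"
proof -
  have "(of_nat k :: 'n cpol) = Cst (of_nat k)"
    by (induction k) (auto simp: Cst_add)
  then have "(of_nat k :: 'n cpol) = 0 \<longleftrightarrow> k = 0"
    by simp
  then show ?thesis
    by (simp add: of_nat_fract Zero_fract_def eq_fract)
qed

lemma at_nat_D_monomial:
  "\<exists>e. at_nat \<nu> (act (D_monomial M)) = Cst e \<and> (e \<noteq> 0 \<longleftrightarrow> (\<forall>j. count M j \<le> \<nu> j))"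
proof (induction M arbitrary: \<nu>)
  case empty
  show ?case by (intro exI[of _ 1]) (simp add: s_act_simps at_nat_def)
next
  case (add j M)
  let ?h = "act (D_monomial M)"
  have eq: "at_nat \<nu> (act (D_monomial (add_mset j M)))
      = - (Cst (of_nat (\<nu> j)) * at_nat \<nu> (shift j (- 1) ?h) * Cst (Fract 1 (f j)))"
  proof -
    have "at_nat \<nu> (- p) = - at_nat \<nu> p" for p
      unfolding at_nat_def by (metis add_eq_0_iff add.right_inverse mp_subst_add mp_subst_0)
    then show ?thesis
      by (simp add: s_act_simps at_nat_def)
  qed
  show ?case
  proof (cases "\<nu> j = 0")
    case True
    then have "\<not> count (add_mset j M) j \<le> \<nu> j" by simp
    moreover have "at_nat \<nu> (act (D_monomial (add_mset j M))) = Cst 0"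
      using eq True by simp
    ultimately show ?thesis by blast
  next
    case False
    \<comment> \<open>Shifting \<open>s_j\<close> by -1 and then evaluating at \<open>\<nu>\<close>
      is evaluating at \<open>\<nu>\<close> with its \<open>j\<close>-th entry lowered by one. The
      subtraction is exact because the entry 0 was treated before, where the factor
      \<open>s_j\<close> vanishes.\<close>
    let ?\<mu> = "\<nu>(j := \<nu> j - 1)"
    have "at_nat \<nu> (shift j (- 1) ?h) = at_nat ?\<mu> ?h"
    proof -
      have "mp_subst (\<lambda>j. Cst (of_nat (\<nu> j))) (if i = j then Ind i + Cst (- 1) else Ind i)
          = (Cst (of_nat (?\<mu> i)) :: ('n, 'r) smod)" for i
        using False by (simp flip: Cst_add)
      then show ?thesis
        unfolding at_nat_def shift_def mp_subst_subst by (simp only:)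
    qed
    moreover obtain e where e: "at_nat ?\<mu> ?h = Cst e" "e \<noteq> 0 \<longleftrightarrow> (\<forall>i. count M i \<le> ?\<mu> i)"
      using add.IH[of ?\<mu>] by blast
    ultimately have "at_nat \<nu> (act (D_monomial (add_mset j M)))
        = Cst (- (of_nat (\<nu> j) * e * Fract 1 (f j)))"
      using eq by (simp add: Cst_mult Cst_uminus)
    moreover have "Fract 1 (f j) \<noteq> 0"
      using f_nonzero[of j] by (simp add: Zero_fract_def eq_fract)
    then have "- (of_nat (\<nu> j) * e * Fract 1 (f j)) \<noteq> 0 \<longleftrightarrow> e \<noteq> 0"
      using False by (simp add: of_nat_fract_eq_0_iff)
    moreover have "(\<forall>i. count M i \<le> ?\<mu> i) \<longleftrightarrow> (\<forall>i. count (add_mset j M) i \<le> \<nu> i)"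
    proof -
      have "count M i \<le> ?\<mu> i \<longleftrightarrow> count (add_mset j M) i \<le> \<nu> i" for i
        using False by (cases "i = j") auto
      then show ?thesis by blast
    qed
    ultimately show ?thesis using e(2) by blast
  qed
qed

lemma act_normal_form_eq_0:
  assumes "act (normal_form u) = 0"
  shows "u = 0"
proof (rule ccontr)
  assume "u \<noteq> 0"
  then obtain M0 where M0: "M0 \<in> Poly_Mapping.keys u"
    using keys_eq_empty[of u] by blast
  \<comment> \<open>A multiset of least size is singled out. Evaluating at its multiplicities kills
    every \<open>N\<close> not contained in it, and by minimality no other \<open>N\<close> of the
    support is contained in it.\<close>
  obtain M where M: "M \<in> Poly_Mapping.keys u"
    and min: "\<And>M'. M' \<in> Poly_Mapping.keys u \<Longrightarrow> size M \<le> size M'"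
    using ex_has_least_nat[of "\<lambda>M. M \<in> Poly_Mapping.keys u" M0 size, OF M0] by auto
  let ?E = "at_nat (count M)"
  have E_add: "?E (p + q) = ?E p + ?E q" and E_0: "?E 0 = 0" for p q
    by (simp_all add: at_nat_def)
  have E_sum: "?E (sum h A) = (\<Sum>i\<in>A. ?E (h i))" for h and A :: "'r multiset set"
    by (induction A rule: infinite_finite_induct) (auto simp: E_add E_0)
  let ?c = "\<lambda>N. Fract (Poly_Mapping.lookup u N) 1"
  have "0 = ?E (act (normal_form u))"
    using assms E_0 by simp
  also have "\<dots> = (\<Sum>N\<in>Poly_Mapping.keys u. Cst (?c N) * ?E (act (D_monomial N)))"
    unfolding normal_form_def pm_extend_def s_act_sum E_sum
    by (simp add: s_act_simps at_nat_def fpol_def)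
  also have "\<dots> = Cst (?c M) * ?E (act (D_monomial M))"
  proof -
    have "?E (act (D_monomial N)) = 0" if N: "N \<in> Poly_Mapping.keys u" "N \<noteq> M" for N
    proof -
      obtain e where e: "?E (act (D_monomial N)) = Cst e" "e \<noteq> 0 \<longleftrightarrow> (\<forall>j. count N j \<le> count M j)"
        using at_nat_D_monomial by blast
      have "\<not> N \<subseteq># M"
        using N min[of N] by (metis mset_subset_size subset_mset.le_imp_less_or_eq not_le)
      then have "e = 0" using e(2) by (auto simp: subseteq_mset_def)
      then show ?thesis using e(1) by simp
    qed
    then show ?thesis
      using M by (subst sum.remove[of _ M]) auto
  qed
  finally have 0: "Cst (?c M) * ?E (act (D_monomial M)) = 0" by simp
  obtain e where e: "?E (act (D_monomial M)) = Cst e" "e \<noteq> 0"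
    using at_nat_D_monomial[of "count M" M] by auto
  have "?c M \<noteq> 0"
    using M by (simp add: in_keys_iff Zero_fract_def eq_fract)
  then show False
    using 0 e by (simp flip: Cst_mult)
qed

lemma annihilator_It_f: "act P = 0 \<longleftrightarrow> P \<in> It_f f"
proof
  assume P: "act P = 0"
  obtain u where u: "P - normal_form u \<in> It_f f"
    using normal_form_exists by blast
  then have "act (P - normal_form u) = 0"
    by (rule It_f_annihilates)
  then have "u = 0"
    using P by (intro act_normal_form_eq_0) (simp add: s_act_diff)
  then show "P \<in> It_f f"
    using u by simp
qed (rule It_f_annihilates)

end

lemma homog_of_int [simp]: "homog 0 (of_int k)"
  by (induction k rule: int_induct[of _ 0]) (auto intro: homog_add homog_diff)

lemma left_ideal_hull_range:
  fixes f :: "'r::finite \<Rightarrow> 'a::comm_ring_1"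
  assumes "a \<in> left_ideal hull (range f)"
  obtains c where "a = (\<Sum>j\<in>UNIV. c j * f j)"
proof -
  let ?I = "{\<Sum>j\<in>UNIV. c j * f j | c. True}"
  have "left_ideal ?I"
    unfolding left_ideal_def
  proof (intro conjI ballI allI)
    show "0 \<in> ?I" by (auto intro!: exI[of _ "\<lambda>_. 0"])
    fix a b assume b: "b \<in> ?I"
    then obtain c where "b = (\<Sum>j\<in>UNIV. c j * f j)" by blast
    then show "a * b \<in> ?I"
      by (auto intro!: exI[of _ "\<lambda>j. a * c j"] simp: sum_distrib_left mult.assoc)
    assume "a \<in> ?I"
    with b obtain c d where "a = (\<Sum>j\<in>UNIV. c j * f j)" "b = (\<Sum>j\<in>UNIV. d j * f j)"
      by blast
    then show "a + b \<in> ?I"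
      by (auto intro!: exI[of _ "\<lambda>j. c j + d j"] simp: distrib_right sum.distrib)
  qed
  moreover have "f i \<in> ?I" for i
  proof -
    have "f i = (\<Sum>j\<in>UNIV. (if j = i then 1 else 0) * f j)"
      by (subst sum.remove[of _ i]) auto
    then show ?thesis
      by (intro CollectI exI[of _ "\<lambda>j. if j = i then 1 else 0"] conjI TrueI)
  qed
  ultimately have "left_ideal hull (range f) \<subseteq> ?I"
    by (intro left_ideal_hull_subset) auto
  then show ?thesis using assms that by blast
qed

section \<open>Graded pieces of the submodule generated by the \<open>g f_j F\<close>\<close>

context nonzero_family
begin

text \<open>Degree 0 gives the possible right-hand sides of the functional equation. The other
  degrees are present so that left multiplication by homogeneous operators stays within the
  family.\<close>

definition bs_span :: "int \<Rightarrow> 'n cpol \<Rightarrow> ('n, 'r) smod set"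
  where "bs_span k g = {\<Sum>j\<in>UNIV. act (R j * weyl_poly (g * f j)) | R. \<forall>j. homog k (R j)}"

lemma bs_spanI: "(\<And>j. homog k (R j)) \<Longrightarrow> (\<Sum>j\<in>UNIV. act (R j * weyl_poly (g * f j))) \<in> bs_span k g"
  unfolding bs_span_def by blast

lemma bs_spanE:
  assumes "x \<in> bs_span k g"
  obtains R where "x = (\<Sum>j\<in>UNIV. act (R j * weyl_poly (g * f j)))" "\<And>j. homog k (R j)"
  using assms unfolding bs_span_def by blast

lemma bs_span_0: "0 \<in> bs_span k g"
  using bs_spanI[of k "\<lambda>_. 0" g] by simp

lemma bs_span_single: "homog k R \<Longrightarrow> act (R * weyl_poly (g * f i)) \<in> bs_span k g"
proof -
  assume "homog k R"
  then have "(\<Sum>j\<in>UNIV. act ((if j = i then R else 0) * weyl_poly (g * f j))) \<in> bs_span k g"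
    by (intro bs_spanI) simp
  moreover have "(\<Sum>j\<in>UNIV. act ((if j = i then R else 0) * weyl_poly (g * f j)))
      = act (R * weyl_poly (g * f i))"
    by (subst sum.remove[of _ i]) auto
  ultimately show ?thesis by simp
qed

lemma bs_span_act:
  assumes "homog l P" "x \<in> bs_span k g"
  shows "s_act f P x \<in> bs_span (l + k) g"
proof -
  obtain R where R: "x = (\<Sum>j\<in>UNIV. act (R j * weyl_poly (g * f j)))" "\<And>j. homog k (R j)"
    using assms(2) by (rule bs_spanE) blast
  have "s_act f P (sum h A) = (\<Sum>i\<in>A. s_act f P (h i))" for h and A :: "'r set"
    by (induction A rule: infinite_finite_induct) (auto simp: s_act_simps(2))
  then have "s_act f P x = (\<Sum>j\<in>UNIV. act ((P * R j) * weyl_poly (g * f j)))"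
    by (simp add: R(1) s_act_simps(3))
  also have "\<dots> \<in> bs_span (l + k) g"
    by (intro bs_spanI homog_mult assms(1) R(2))
  finally show ?thesis .
qed

lemma bs_span_add: "x \<in> bs_span k g \<Longrightarrow> y \<in> bs_span k g \<Longrightarrow> x + y \<in> bs_span k g"
proof -
  assume x: "x \<in> bs_span k g" and y: "y \<in> bs_span k g"
  obtain R where R: "x = (\<Sum>j\<in>UNIV. act (R j * weyl_poly (g * f j)))" "\<And>j. homog k (R j)"
    using x by (rule bs_spanE) blast
  obtain S where S: "y = (\<Sum>j\<in>UNIV. act (S j * weyl_poly (g * f j)))" "\<And>j. homog k (S j)"
    using y by (rule bs_spanE) blast
  show ?thesis
    using bs_spanI[of k "\<lambda>j. R j + S j" g] R S
    by (simp add: distrib_right s_act_simps(1) sum.distrib homog_add)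
qed

lemma bs_span_uminus: "x \<in> bs_span k g \<Longrightarrow> - x \<in> bs_span k g"
  using bs_span_act[of 0 "- 1" x k g] by (simp add: homog_uminus s_act_uminus s_act_simps)

lemma bs_span_sum: "(\<And>i. i \<in> A \<Longrightarrow> h i \<in> bs_span k g) \<Longrightarrow> sum h A \<in> bs_span k g"
  by (induction A rule: infinite_finite_induct) (auto simp: bs_span_0 bs_span_add)

subsection \<open>Membership in the two ideals\<close>

lemma I_fg2_iff: "p \<in> I_fg2 f g \<longleftrightarrow> act (poly_at_sigma p) \<in> bs_span 0 g"
proof -
  define S where "S = I_f1 f \<union> (\<lambda>a. weyl_poly (g * a)) ` (left_ideal hull range f)"
  define H :: "(nat \<Rightarrow>\<^sub>0 ('n + 'r) weyl) set" where "H = left_ideal hull (Poly_Mapping.single 0 ` S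
    \<union> {Poly_Mapping.single 1 1 - Poly_Mapping.single 0 weyl_sigma})"
  have I_fg2: "p \<in> I_fg2 f g \<longleftrightarrow> s_embed p \<in> H"
    unfolding I_fg2_def H_def S_def by (simp add: image_Un image_image Un_assoc)
  have H: "left_ideal H"
    unfolding H_def by (rule left_ideal_hull)
  have H_S: "Poly_Mapping.single 0 P \<in> H" if "P \<in> S" for P
    unfolding H_def using that by (intro hull_inc) blast
  show ?thesis unfolding I_fg2
  proof
    \<comment> \<open>Every component is constrained, because a left factor of degree
      \<open>-k\<close> brings the component of degree \<open>k\<close> into degree 0.\<close>
    let ?J = "{P. \<forall>k. act (hom_comp k P) \<in> bs_span k g}"
    have J: "left_ideal ?J"
    proof (rule left_ideal_weylI)
      fix k and a b :: "('n + 'r) weyl" assume a: "homog k a" and b: "b \<in> ?J"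
      have "s_act f a (act (hom_comp (i - k) b)) \<in> bs_span (k + (i - k)) g" for i
        using b by (intro bs_span_act a) blast
      then show "a * b \<in> ?J"
        by (simp add: hom_comp_mult_left[OF a] s_act_simps(3))
    qed (simp_all add: hom_comp_add s_act_simps(1) bs_span_0 bs_span_add)
    have "P * weyl_sigma \<in> ?J" if P: "P \<in> ?J" for P
    proof -
      have "s_act f (weyl_sigma - of_int k) (act (hom_comp k P)) \<in> bs_span (0 + k) g" for k
        using P by (intro bs_span_act homog_diff homog_sigma homog_of_int) blast
      then show ?thesis
        by (simp add: hom_comp_mult_right[OF homog_sigma] homog_sigma_commute[OF homog_hom_comp]
          s_act_simps(3))
    qed
    moreover have "S \<subseteq> ?J"
    proof -
      have "P \<in> ?J" if "P \<in> I_f1 f" for P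
        using I_f1_hom_comp[OF that] It_f_annihilates by (simp add: bs_span_0)
      moreover have "weyl_poly (g * a) \<in> ?J" if a: "a \<in> left_ideal hull range f" for a
      proof -
        obtain c where c: "a = (\<Sum>j\<in>UNIV. c j * f j)"
          using a by (rule left_ideal_hull_range)
        have "weyl_poly (g * a) = (\<Sum>j\<in>UNIV. weyl_poly (c j) * (weyl_poly (g * f j) :: ('n + 'r) weyl))"
          by (simp add: c sum_distrib_left weyl_poly_sum mult.left_commute flip: weyl_poly_mult)
        then have "act (weyl_poly (g * a)) \<in> bs_span 0 g"
          by (simp add: s_act_sum bs_spanI)
        then show ?thesis
          by (simp add: hom_comp_homog[OF homog_weyl_poly] bs_span_0)
      qed
      ultimately show ?thesis unfolding S_def by blast
    qed
    moreover assume "s_embed p \<in> H"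
    ultimately have "eval_sigma (s_embed p) \<in> ?J"
      unfolding H_def using eval_sigma_left_ideal[OF J] by blast
    then have "act (hom_comp 0 (poly_at_sigma p)) \<in> bs_span 0 g"
      by (simp add: eval_sigma_s_embed)
    then show "act (poly_at_sigma p) \<in> bs_span 0 g"
      by (simp add: hom_comp_homog[OF homog_poly_at_sigma])
  next
    assume "act (poly_at_sigma p) \<in> bs_span 0 g"
    then obtain R where R: "act (poly_at_sigma p) = (\<Sum>j\<in>UNIV. act (R j * weyl_poly (g * f j)))"
      "\<And>j. homog 0 (R j)"
      by (rule bs_spanE) blast
    let ?Q = "\<Sum>j\<in>UNIV. R j * weyl_poly (g * f j)"
    \<comment> \<open>The difference annihilates \<open>F\<close> and is homogeneous of degree 0,
      hence lies in \<open>I_f1\<close>; \<open>?Q\<close> itself is a left combination of the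
      generators \<open>g f_j\<close>.\<close>
    have "poly_at_sigma p - ?Q \<in> It_f f"
      using R(1) by (simp add: s_act_diff s_act_sum flip: annihilator_It_f)
    moreover have "homog 0 (poly_at_sigma p - ?Q)"
      by (intro homog_diff homog_poly_at_sigma homog_sum homog_0_mult R(2) homog_weyl_poly)
    ultimately have "poly_at_sigma p - ?Q \<in> S"
      unfolding S_def using It_f_I_f1 by blast
    then have 1: "Poly_Mapping.single 0 (poly_at_sigma p - ?Q) \<in> H"
      by (rule H_S)
    have "weyl_poly (g * f j) \<in> S" for j
      unfolding S_def using hull_inc[of "f j" "range f" left_ideal] by blast
    then have "Poly_Mapping.single 0 (R j) * Poly_Mapping.single 0 (weyl_poly (g * f j)) \<in> H" for j
      by (intro left_ideal_closed(3)[OF H] H_S)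
    then have "Poly_Mapping.single 0 ?Q \<in> H"
      by (simp add: single_sum mult_single left_ideal_sum[OF H])
    from left_ideal_closed(2)[OF H 1 this] have "Poly_Mapping.single 0 (poly_at_sigma p) \<in> H"
      by (simp flip: single_add)
    then show "s_embed p \<in> H"
      by (rule s_embed_mod[OF H, rotated]) (auto simp: H_def intro!: hull_inc)
  qed
qed

lemma I_fg3_iff: "h \<in> I_fg3 f g \<longleftrightarrow> act (poly_at_sigma h * weyl_poly g) \<in> bs_span 0 g"
  by (simp only: I_fg3_def ideal_colon_def mem_Collect_eq I_fg2_iff poly_at_sigma_mult poly_at_sigma_const)

section \<open>Operators of negative degree\<close>

lemma act_Xr: "act (P * weyl_X (Inr j)) = act (P * weyl_poly (f j))"
  by (simp add: s_act_simps)

text \<open>Each trailing \<open>t_j\<close> commutes with polynomials and becomes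
  \<open>f_j\<close> on \<open>F\<close>. The newest \<open>f_j\<close> takes the place of
  \<open>f_i\<close> in the generator, and the old one is collected in \<open>a\<close>, which is
  therefore arbitrary in the induction.\<close>

lemma act_deg_part_poly:
  "R \<in> deg_part (\<lambda>j. weyl_X (Inr j)) n \<Longrightarrow> act (R * weyl_poly (g * a * f i)) \<in> bs_span 0 g"
proof (induction n arbitrary: R a i)
  case 0
  have "homog 0 (R * weyl_poly a)"
    using 0 by (intro homog_0_mult) (auto simp: D_X_gl_homog)
  from bs_span_single[OF this, of g i] show ?case
    by (simp add: mult.assoc mult.left_commute flip: weyl_poly_mult)
next
  case (Suc n)
  obtain v where v: "R = (\<Sum>j\<in>UNIV. v j * weyl_X (Inr j))"
    "\<And>j. v j \<in> deg_part (\<lambda>j. weyl_X (Inr j)) n"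
    using Suc.prems by (rule deg_part_SucE) blast
  have "act (v j * weyl_X (Inr j) * weyl_poly (g * a * f i)) \<in> bs_span 0 g" for j
  proof -
    have "act (v j * weyl_X (Inr j) * weyl_poly (g * a * f i))
        = act (v j * weyl_poly (g * a * f i) * weyl_X (Inr j))"
      by (simp add: mult.assoc weyl_poly_X)
    also have "\<dots> = act (v j * weyl_poly (g * (a * f i) * f j))"
      unfolding act_Xr by (simp add: mult.assoc flip: weyl_poly_mult)
    also have "\<dots> \<in> bs_span 0 g"
      by (rule Suc.IH) (rule v(2))
    finally show ?thesis .
  qed
  then show ?case
    by (simp add: v(1) sum_distrib_right s_act_sum bs_span_sum)
qed

text \<open>A negative degree leaves at least one trailing \<open>t_j\<close>, which supplies the
  factor \<open>f_j\<close> that a member of the span needs.\<close>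

lemma act_negative:
  assumes "k < 0"
  shows "act (hom_comp k P * weyl_poly g) \<in> bs_span 0 g"
proof -
  obtain n where n: "nat (- k) = Suc n"
    using assms by (cases "nat (- k)") auto
  have "hom_comp k P \<in> deg_part (\<lambda>j. weyl_X (Inr j)) (Suc n)"
    using hom_comp_deg_part[of k P] assms n by simp
  then obtain v where v: "hom_comp k P = (\<Sum>j\<in>UNIV. v j * weyl_X (Inr j))"
    "\<And>j. v j \<in> deg_part (\<lambda>j. weyl_X (Inr j)) n"
    by (rule deg_part_SucE) blast
  have "act (v j * weyl_X (Inr j) * weyl_poly g) \<in> bs_span 0 g" for j
  proof -
    have "act (v j * weyl_X (Inr j) * weyl_poly g) = act (v j * weyl_poly g * weyl_X (Inr j))"
      by (simp add: mult.assoc weyl_poly_X)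
    also have "\<dots> = act (v j * weyl_poly (g * 1 * f j))"
      unfolding act_Xr by (simp add: mult.assoc flip: weyl_poly_mult)
    also have "\<dots> \<in> bs_span 0 g"
      by (rule act_deg_part_poly) (rule v(2))
    finally show ?thesis .
  qed
  then show ?thesis
    by (simp add: v(1) sum_distrib_right s_act_sum bs_span_sum)
qed


section \<open>The ideal of initial forms\<close>

lemma left_ideal_It_fg0: "left_ideal (It_fg0 f g)"
proof -
  have I: "left_ideal (It_f f)"
    unfolding It_f_def by (rule left_ideal_hull)
  have "a + b \<in> range (\<lambda>P. P * weyl_poly g)"
    if "a \<in> range (\<lambda>P. P * weyl_poly g)" "b \<in> range (\<lambda>P. P * weyl_poly g)" for a b :: "('n + 'r) weyl"
    using that by (auto simp: distrib_right[symmetric])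
  moreover have "a * b \<in> range (\<lambda>P. P * weyl_poly g)"
    if "b \<in> range (\<lambda>P. P * weyl_poly g)" for a b :: "('n + 'r) weyl"
    using that by (auto simp: mult.assoc[symmetric])
  moreover have "0 \<in> range (\<lambda>P. P * weyl_poly g :: ('n + 'r) weyl)"
    by (rule range_eqI[of _ _ 0]) simp
  ultimately show ?thesis
    using left_ideal_closed[OF I] unfolding left_ideal_def It_fg0_def by blast
qed

text \<open>The elements whose every component, say of degree \<open>k\<close>, is the degree
  \<open>k\<close> component of some \<open>Q\<close> in \<open>It_fg0\<close> of order at most
  \<open>k\<close> form a left ideal containing the initial forms. Asking only for order at most
  \<open>k\<close> admits zero components.\<close>

lemma poly_at_sigma_It_fg2:
  assumes "p \<in> It_fg2 f g"
  obtains Q where "Q \<in> It_fg0 f g" "\<And>i. i > 0 \<Longrightarrow> hom_comp i Q = 0" "hom_comp 0 Q = poly_at_sigma p"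
proof -
  note cl = left_ideal_closed[OF left_ideal_It_fg0[of g]]
  let ?J = "{P. \<forall>k. \<exists>Q\<in>It_fg0 f g. (\<forall>i>k. hom_comp i Q = 0) \<and> hom_comp k Q = hom_comp k P}"
  have J: "left_ideal ?J"
  proof (rule left_ideal_weylI)
    show "0 \<in> ?J" by (auto intro!: bexI[of _ 0] cl)
  next
    fix a b assume ab: "a \<in> ?J" "b \<in> ?J"
    show "a + b \<in> ?J"
    proof (rule CollectI, rule allI)
      fix k
      obtain Q R where "Q \<in> It_fg0 f g" "\<forall>i>k. hom_comp i Q = 0" "hom_comp k Q = hom_comp k a"
        "R \<in> It_fg0 f g" "\<forall>i>k. hom_comp i R = 0" "hom_comp k R = hom_comp k b"
        using ab by blast
      then show "\<exists>Q\<in>It_fg0 f g. (\<forall>i>k. hom_comp i Q = 0) \<and> hom_comp k Q = hom_comp k (a + b)"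
        by (intro bexI[of _ "Q + R"]) (simp_all add: hom_comp_add cl)
    qed
  next
    fix l and a b :: "('n + 'r) weyl" assume a: "homog l a" and b: "b \<in> ?J"
    show "a * b \<in> ?J"
    proof (rule CollectI, rule allI)
      fix k
      obtain Q where "Q \<in> It_fg0 f g" "\<forall>i>k - l. hom_comp i Q = 0"
        "hom_comp (k - l) Q = hom_comp (k - l) b"
        using b by blast
      then show "\<exists>Q\<in>It_fg0 f g. (\<forall>i>k. hom_comp i Q = 0) \<and> hom_comp k Q = hom_comp k (a * b)"
        by (intro bexI[of _ "a * Q"]) (simp_all add: hom_comp_mult_left[OF a] cl)
    qed
  qed
  have sigma: "P * weyl_sigma \<in> ?J" if P: "P \<in> ?J" for P
  proof (rule CollectI, rule allI)
    fix k
    obtain Q where Q: "Q \<in> It_fg0 f g" "\<forall>i>k. hom_comp i Q = 0" "hom_comp k Q = hom_comp k P"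
      using P by blast
    \<comment> \<open>\<open>It_fg0\<close> is only a left ideal, so right multiplication by
      \<open>weyl_sigma\<close> is replaced by left multiplication by \<open>weyl_sigma - k\<close>,
      which agrees with it on the component of degree \<open>k\<close>.\<close>
    have "homog 0 (weyl_sigma - of_int k :: ('n + 'r) weyl)"
      by (intro homog_diff homog_sigma homog_of_int)
    with Q show "\<exists>Q\<in>It_fg0 f g. (\<forall>i>k. hom_comp i Q = 0) \<and> hom_comp k Q = hom_comp k (P * weyl_sigma)"
      by (intro bexI[of _ "(weyl_sigma - of_int k) * Q"])
        (simp_all add: hom_comp_mult_left hom_comp_mult_right[OF homog_sigma]
          homog_sigma_commute[OF homog_hom_comp] cl)
  qed
  have "in_form R \<in> ?J" if R: "R \<in> It_fg0 f g - {0}" for R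
  proof (rule CollectI, rule allI)
    fix k
    define m where "m = Max {k. hom_comp k R \<noteq> 0}"
    have m: "hom_comp i R = 0" if "i > m" for i
    proof (rule ccontr)
      assume "hom_comp i R \<noteq> 0"
      then have "i \<le> m"
        unfolding m_def by (intro Max_ge finite_hom_comp) simp
      with that show False by simp
    qed
    show "\<exists>Q\<in>It_fg0 f g. (\<forall>i>k. hom_comp i Q = 0) \<and> hom_comp k Q = hom_comp k (in_form R)"
    proof (cases "k = m")
      case True
      then show ?thesis
        using R m by (intro bexI[of _ R]) (auto simp: in_form_def hom_comp_hom_comp simp flip: m_def)
    next
      case False
      then show ?thesis
        by (intro bexI[of _ 0]) (auto simp: in_form_def hom_comp_hom_comp cl simp flip: m_def)
    qed
  qed
  then have "It_fg1 f g \<subseteq> ?J"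
    unfolding It_fg1_def by (intro left_ideal_hull_subset J) auto
  then have "eval_sigma (s_embed p) \<in> ?J"
    using assms unfolding It_fg2_def by (intro eval_sigma_left_ideal[OF J sigma]) auto
  then obtain Q where "Q \<in> It_fg0 f g" "\<forall>i>0. hom_comp i Q = 0" "hom_comp 0 Q = hom_comp 0 (poly_at_sigma p)"
    by (auto simp: eval_sigma_s_embed)
  then show ?thesis
    using that by (simp add: hom_comp_homog[OF homog_poly_at_sigma])
qed

lemma It_fg3_iff: "h \<in> It_fg3 f g \<longleftrightarrow> act (poly_at_sigma h * weyl_poly g) \<in> bs_span 0 g"
proof
  assume "h \<in> It_fg3 f g"
  then have "h * [:g:] \<in> It_fg2 f g"
    by (simp add: It_fg3_def ideal_colon_def)
  then obtain Q where Q: "Q \<in> It_fg0 f g" "\<And>i. i > 0 \<Longrightarrow> hom_comp i Q = 0"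
    "hom_comp 0 Q = poly_at_sigma (h * [:g:])"
    by (rule poly_at_sigma_It_fg2) blast
  from Q(3) have Q0: "hom_comp 0 Q = poly_at_sigma h * weyl_poly g"
    by (simp only: poly_at_sigma_mult poly_at_sigma_const)
  from Q(1) obtain Q' where Q': "Q = Q' * weyl_poly g" and "Q \<in> It_f f"
    unfolding It_fg0_def by blast
  let ?K = "{k. hom_comp k Q \<noteq> 0}"
  have "0 = act (\<Sum>k\<in>?K. hom_comp k Q)"
    using It_f_annihilates[OF \<open>Q \<in> It_f f\<close>] by (simp flip: hom_comp_decomp)
  \<comment> \<open>Degree 0 may be missing from the support, as when \<open>h\<close> is 0.\<close>
  also have "(\<Sum>k\<in>?K. hom_comp k Q) = (\<Sum>k\<in>insert 0 ?K. hom_comp k Q)"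
    using finite_hom_comp[of Q] by (intro sum.mono_neutral_left) auto
  also have "\<dots> = hom_comp 0 Q + (\<Sum>k\<in>?K - {0}. hom_comp k Q)"
    using finite_hom_comp[of Q] by (simp add: sum.insert_remove)
  finally have "act (poly_at_sigma h * weyl_poly g) = - (\<Sum>k\<in>?K - {0}. act (hom_comp k Q))"
    by (simp add: s_act_simps(1) s_act_sum Q0 eq_neg_iff_add_eq_0)
  also have "\<dots> \<in> bs_span 0 g"
  proof (intro bs_span_uminus bs_span_sum)
    fix k assume "k \<in> ?K - {0}"
    then have "k < 0"
      using Q(2)[of k] by (cases k "0 :: int" rule: linorder_cases) auto
    from act_negative[OF this, of Q' g] show "act (hom_comp k Q) \<in> bs_span 0 g"
      by (simp add: Q' hom_comp_mult_right[OF homog_weyl_poly])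
  qed
  finally show "act (poly_at_sigma h * weyl_poly g) \<in> bs_span 0 g" .
next
  assume "act (poly_at_sigma h * weyl_poly g) \<in> bs_span 0 g"
  then obtain R where R: "act (poly_at_sigma h * weyl_poly g) = (\<Sum>j\<in>UNIV. act (R j * weyl_poly (g * f j)))"
    "\<And>j. homog 0 (R j)"
    by (rule bs_spanE) blast
  \<comment> \<open>Writing \<open>t_j g\<close> for \<open>g f_j\<close> keeps the value on
    \<open>F\<close> but lowers the degree to -1, so that \<open>h(x, sigma) g\<close> becomes the
    leading form.\<close>
  let ?Q = "(poly_at_sigma h - (\<Sum>j\<in>UNIV. R j * weyl_X (Inr j))) * weyl_poly g"
  have "act (R j * weyl_X (Inr j) * weyl_poly g) = act (R j * weyl_poly (g * f j))" for j
  proof -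
    have "R j * weyl_X (Inr j) * weyl_poly g = R j * weyl_poly g * weyl_X (Inr j)"
      by (simp add: mult.assoc weyl_poly_X)
    then show ?thesis
      by (simp only: act_Xr) (simp add: mult.assoc weyl_poly_mult)
  qed
  then have "act ?Q = 0"
    using R(1) by (simp add: left_diff_distrib sum_distrib_right s_act_diff s_act_sum)
  then have Q: "?Q \<in> It_fg0 f g"
    by (simp add: It_fg0_def flip: annihilator_It_f)
  have hom: "hom_comp k ?Q = (if k = 0 then poly_at_sigma h * weyl_poly g else 0)" if "k \<ge> 0" for k
  proof -
    have "homog (- 1) (R j * weyl_X (Inr j))" for j
      using homog_mult[OF R(2) homog_gens(3)] by simp
    then show ?thesis
      using that by (simp add: hom_comp_mult_right[OF homog_weyl_poly] hom_comp_diff hom_comp_sum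
        hom_comp_homog[OF homog_poly_at_sigma] hom_comp_homog[of "- 1"])
  qed
  have "poly_at_sigma h * weyl_poly g \<in> It_fg1 f g"
  proof (cases "poly_at_sigma h * weyl_poly g = (0 :: ('n + 'r) weyl)")
    \<comment> \<open>A vanishing \<open>h(x, sigma) g\<close> is not an initial form, but 0 lies in
      the ideal anyway.\<close>
    case True
    then show ?thesis
      unfolding It_fg1_def by (simp add: left_ideal_closed(1)[OF left_ideal_hull])
  next
    case False
    then have "hom_comp 0 ?Q \<noteq> 0"
      using hom[of 0] by simp
    moreover have "hom_comp k ?Q = 0" if "k > 0" for k
      using hom[of k] that by simp
    then have "k \<le> 0" if "hom_comp k ?Q \<noteq> 0" for k
      using that by (meson not_le)
    ultimately have "Max {k. hom_comp k ?Q \<noteq> 0} = 0"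
      by (intro Max_eqI finite_hom_comp) auto
    then have "in_form ?Q = poly_at_sigma h * weyl_poly g"
      using hom[of 0] by (simp add: in_form_def)
    moreover have "?Q \<noteq> 0"
      using \<open>hom_comp 0 ?Q \<noteq> 0\<close> by (metis hom_comp_0)
    ultimately show ?thesis
      unfolding It_fg1_def using Q hull_inc[OF imageI[of ?Q "It_fg0 f g - {0}" in_form]] by simp
  qed
  then have "poly_at_sigma (h * [:g:]) \<in> It_fg1 f g"
    by (simp only: poly_at_sigma_mult poly_at_sigma_const)
  then have "s_embed (h * [:g:]) \<in> left_ideal hull (Poly_Mapping.single 0 ` It_fg1 f g
      \<union> {Poly_Mapping.single 1 1 - Poly_Mapping.single 0 weyl_sigma})"
    by (intro s_embed_mod left_ideal_hull hull_inc) auto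
  then show "h \<in> It_fg3 f g"
    by (simp add: It_fg3_def ideal_colon_def It_fg2_def)
qed

text \<open>The factor \<open>h\<close> on the right of the functional equation commutes with
  \<open>g\<close> and \<open>weyl_sigma\<close>, so it counts as a coefficient of the polynomial in
  \<open>s\<close>. Operators from \<open>D_X_gl\<close> are exactly those of degree 0.\<close>

lemma local_bs_identity_iff:
  "local_bs_identity f g p c \<longleftrightarrow> (\<exists>h. h \<notin> p \<and> [:h:] * map_poly Cst c \<in> I_fg3 f g)"
proof -
  have eval: "weyl_eval c weyl_sigma * weyl_poly g * weyl_poly h
      = (poly_at_sigma ([:h:] * map_poly Cst c) * weyl_poly g :: ('n + 'r) weyl)" for h
    by (simp only: mult.commute[of "[:h:]"])
      (simp add: poly_at_sigma_mult poly_at_sigma_const poly_at_sigma_map_poly_Cst mult.assoc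
        weyl_poly_commute[of h] del: mult_pCons_right)
  have span: "(\<exists>P. range P \<subseteq> D_X_gl \<and> x = (\<Sum>j\<in>UNIV. act (P j * weyl_poly g * weyl_poly (f j))))
      \<longleftrightarrow> x \<in> bs_span 0 g" for x
  proof -
    have "range P \<subseteq> D_X_gl \<longleftrightarrow> (\<forall>j. homog 0 (P j))" for P :: "'r \<Rightarrow> ('n + 'r) weyl"
      using D_X_gl_homog homog_0_D_X_gl by blast
    then show ?thesis
      unfolding bs_span_def by (auto simp: weyl_poly_mult mult.assoc)
  qed
  have "local_bs_identity f g p c \<longleftrightarrow> (\<exists>h. h \<notin> p \<and> (\<exists>P. range P \<subseteq> D_X_gl \<and>
      act (poly_at_sigma ([:h:] * map_poly Cst c) * weyl_poly g)
        = (\<Sum>j\<in>UNIV. act (P j * weyl_poly g * weyl_poly (f j)))))"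
    unfolding local_bs_identity_def eval by blast
  then show ?thesis
    unfolding span I_fg3_iff .
qed

end

subsection \<open>Localization of a primary decomposition\<close>

lemma prime_ideal_prod:
  assumes "prime_ideal p" "finite A" "prod a A \<in> p"
  shows "\<exists>i\<in>A. a i \<in> p"
  using assms(2,3)
proof (induction A rule: finite_induct)
  case empty
  have "left_ideal p" "p \<noteq> UNIV"
    using assms(1) by (auto simp: prime_ideal_def)
  then have False
    using empty left_ideal_closed(3)[of p 1] by auto
  then show ?case ..
next
  case (insert x A)
  then show ?case using assms(1) unfolding prime_ideal_def by auto
qed

text \<open>Localizing at \<open>p\<close> trivializes the components whose contraction is not
  contained in \<open>p\<close> and loses nothing of the others. The existence of \<open>h\<close>
  is membership in the localized ideal, written without fractions.\<close>

lemma primary_decomposition_localization: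
  fixes q :: "nat \<Rightarrow> 'n::{finite,linorder} cpol poly set"
  assumes p: "prime_ideal p" and q: "\<And>i. i < l \<Longrightarrow> primary_ideal (q i)"
  shows "c \<in> (\<Inter>i\<in>{i. i < l \<and> {a. [:a:] \<in> q i} \<subseteq> p}. q i)
    \<longleftrightarrow> (\<exists>h. h \<notin> p \<and> [:h:] * c \<in> (\<Inter>i<l. q i))"
proof
  assume c: "c \<in> (\<Inter>i\<in>{i. i < l \<and> {a. [:a:] \<in> q i} \<subseteq> p}. q i)"
  let ?B = "{i. i < l \<and> \<not> {a. [:a:] \<in> q i} \<subseteq> p}"
  have "\<forall>i\<in>?B. \<exists>a. [:a:] \<in> q i \<and> a \<notin> p" by blast
  from bchoice[OF this] obtain a where "\<forall>i\<in>?B. [:a i:] \<in> q i \<and> a i \<notin> p"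
    by blast
  then have a: "\<And>i. i \<in> ?B \<Longrightarrow> [:a i:] \<in> q i" "\<And>i. i \<in> ?B \<Longrightarrow> a i \<notin> p"
    by blast+
  \<comment> \<open>One factor outside \<open>p\<close> for each discarded component; the empty
    product 1 serves when none is discarded.\<close>
  let ?h = "\<Prod>i\<in>?B. a i"
  have "finite ?B" by simp
  then have "?h \<notin> p"
    using prime_ideal_prod[OF p _, of ?B a] a(2) by blast
  moreover have "[:?h:] * c \<in> q i" if i: "i < l" for i
  proof -
    have I: "left_ideal (q i)"
      using q[OF i] by (simp add: primary_ideal_def)
    show ?thesis
    proof (cases "i \<in> ?B")
      case True
      then have "?h = (\<Prod>j\<in>?B - {i}. a j) * a i"
        by (subst prod.remove[of _ i]) (auto simp: mult.commute)
      then have "[:?h:] * c = (c * [:\<Prod>j\<in>?B - {i}. a j:]) * [:a i:]"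
        by (simp add: mult_ac)
      then show ?thesis
        using left_ideal_closed(3)[OF I a(1)[OF True]] by (simp only:)
    next
      case False
      then have "c \<in> q i" using c i by blast
      then show ?thesis by (rule left_ideal_closed(3)[OF I])
    qed
  qed
  ultimately show "\<exists>h. h \<notin> p \<and> [:h:] * c \<in> (\<Inter>i<l. q i)" by blast
next
  assume "\<exists>h. h \<notin> p \<and> [:h:] * c \<in> (\<Inter>i<l. q i)"
  then obtain h where h: "h \<notin> p" "\<And>i. i < l \<Longrightarrow> [:h:] * c \<in> q i" by blast
  have "c \<in> q i" if i: "i < l" "{a. [:a:] \<in> q i} \<subseteq> p" for i
  proof (rule ccontr)
    assume "c \<notin> q i"
    moreover have "c * [:h:] \<in> q i"
      using h(2)[OF i(1)] by (simp only: mult.commute)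
    \<comment> \<open>Since \<open>c\<close> is outside the primary component, a power of
      \<open>h\<close> is inside it; that power lies in the contraction, hence in \<open>p\<close>,
      and so does \<open>h\<close>.\<close>
    ultimately obtain k where "[:h:] ^ k \<in> q i"
      using q[OF i(1)] unfolding primary_ideal_def by blast
    then have "h ^ k \<in> p"
      using i(2) by (auto simp: poly_const_pow)
    then have "(\<Prod>i<k. h) \<in> p" by simp
    then show False
      using prime_ideal_prod[OF p, of "{..<k}" "\<lambda>_. h"] h(1) by auto
  qed
  then show "c \<in> (\<Inter>i\<in>{i. i < l \<and> {a. [:a:] \<in> q i} \<subseteq> p}. q i)" by blast
qed

section \<open>Generators of ideals of \<open>C[s]\<close>\<close>

lemma left_ideal_hull_single: "left_ideal hull {b} = {c. b dvd (c :: 'a::comm_ring_1)}"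
proof
  have "left_ideal {c. b dvd c}"
    by (auto simp: left_ideal_def)
  then show "left_ideal hull {b} \<subseteq> {c. b dvd c}"
    by (intro left_ideal_hull_subset) auto
  have "c * b \<in> left_ideal hull {b}" for c
    by (intro left_ideal_closed(3)[OF left_ideal_hull] hull_inc) simp
  then show "{c. b dvd c} \<subseteq> left_ideal hull {b}"
    by (auto simp: dvd_def mult.commute)
qed

lemma monic_min_degree_iff:
  fixes b :: "'a::field poly"
  assumes J: "left_ideal J"
  shows "(lead_coeff b = 1 \<and> b \<in> J \<and> (\<forall>c. lead_coeff c = 1 \<and> c \<in> J \<longrightarrow> degree b \<le> degree c))
    \<longleftrightarrow> lead_coeff b = 1 \<and> J = left_ideal hull {b}"
proof (intro iffI conjI; (elim conjE)?)
  assume b: "lead_coeff b = 1" "b \<in> J" and min: "\<forall>c. lead_coeff c = 1 \<and> c \<in> J \<longrightarrow> degree b \<le> degree c"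
  note cl = left_ideal_closed[OF J]
  have "b dvd c" if c: "c \<in> J" for c
  proof (rule ccontr)
    assume "\<not> b dvd c"
    let ?r = "c mod b"
    have r0: "?r \<noteq> 0" using \<open>\<not> b dvd c\<close> by (simp add: dvd_eq_mod_eq_0)
    have "?r = c - (c div b) * b"
      by (simp add: minus_div_mult_eq_mod)
    then have "?r \<in> J" using cl(5)[OF c cl(3)[OF b(2)]] by simp
    \<comment> \<open>The remainder is made monic, since minimality is assumed only against monic
      polynomials.\<close>
    from cl(3)[OF this, of "[:inverse (lead_coeff ?r):]"]
    have "smult (inverse (lead_coeff ?r)) ?r \<in> J" by simp
    moreover have "lead_coeff (smult (inverse (lead_coeff ?r)) ?r) = 1"
      using r0 by simp
    ultimately have "degree b \<le> degree (smult (inverse (lead_coeff ?r)) ?r)"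
      using min by blast
    then have "degree b \<le> degree ?r"
      using r0 by simp
    moreover have "degree ?r < degree b"
    proof -
      have "b \<noteq> 0" using b(1) by auto
      then show ?thesis using degree_mod_less[of b c] r0 by simp
    qed
    ultimately show False by simp
  qed
  moreover have "c \<in> J" if "b dvd c" for c
    using that cl(3)[OF b(2)] by (auto simp: dvd_def mult.commute)
  ultimately show "J = left_ideal hull {b}"
    by (auto simp: left_ideal_hull_single)
next
  assume b: "lead_coeff b = 1" and J: "J = left_ideal hull {b}"
  show "b \<in> J"
    by (simp add: J left_ideal_hull_single)
  show "\<forall>c. lead_coeff c = 1 \<and> c \<in> J \<longrightarrow> degree b \<le> degree c"
    by (auto simp: J left_ideal_hull_single intro!: dvd_imp_degree_le)
qed

lemma Cst_sum: "Cst (sum h A) = (\<Sum>i\<in>A. Cst (h i))"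
  by (induction A rule: infinite_finite_induct) (auto simp: Cst_add)

lemma left_ideal_map_poly_Cst:
  fixes q :: "'i \<Rightarrow> ('v, 'a::comm_ring_1) mpol poly set"
  assumes "\<And>i. i \<in> A \<Longrightarrow> left_ideal (q i)"
  shows "left_ideal {c. map_poly Cst c \<in> (\<Inter>i\<in>A. q i)}"
proof -
  have add: "map_poly Cst (a + b) = map_poly Cst a +  map_poly Cst (b :: 'a poly)" for a b
    by (rule poly_eqI) (simp add: coeff_map_poly Cst_add)
  have mult: "map_poly Cst (a * b) = map_poly Cst a * map_poly Cst (b :: 'a poly)" for a b
    by (intro poly_eqI) (simp add: coeff_map_poly coeff_mult Cst_sum Cst_mult)
  show ?thesis
    using left_ideal_closed(1-3)[OF assms] unfolding left_ideal_def by (auto simp: add mult)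
qed

text \<open>The polynomials satisfying the local functional equation form precisely the displayed
  ideal of \<open>C[s]\<close>, so being monic of least degree among them is the same as being its
  monic generator.\<close>

theorem theorem3p7:
  fixes f :: "'r::finite \<Rightarrow> 'n::{finite,linorder} cpol" and g :: "'n cpol" and p :: "'n cpol set"
    and q :: "nat \<Rightarrow> 'n cpol poly set" and l :: nat and b :: "complex poly"
  assumes "\<forall>i. f i \<noteq> 0" and "g \<noteq> 0" and "prime_ideal p"
    and "\<forall>i<l. primary_ideal (q i)" and "I_fg3 f g = (\<Inter>i<l. q i)"
  shows "I_fg3 f g = It_fg3 f g \<and>
    (is_local_bs_poly f g p b \<longleftrightarrow>
      lead_coeff b = 1 \<and>
      {c. map_poly Cst c \<in> (\<Inter>i\<in>{i. i < l \<and> {a. [:a:] \<in> q i} \<subseteq> p}. q i)} = left_ideal hull {b})"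
proof
  interpret nonzero_family f
    using assms(1) by unfold_locales blast
  show "I_fg3 f g = It_fg3 f g"
    using I_fg3_iff It_fg3_iff by blast
  let ?J = "{c. map_poly Cst c \<in> (\<Inter>i\<in>{i. i < l \<and> {a. [:a:] \<in> q i} \<subseteq> p}. q i)}"
  have "local_bs_identity f g p c \<longleftrightarrow> c \<in> ?J" for c
    unfolding local_bs_identity_iff assms(5) mem_Collect_eq
    using primary_decomposition_localization[OF assms(3), of l q "map_poly Cst c"] assms(4) by blast
  moreover have "left_ideal ?J"
    using assms(4) by (intro left_ideal_map_poly_Cst) (auto simp: primary_ideal_def)
  ultimately show "is_local_bs_poly f g p b \<longleftrightarrow> lead_coeff b = 1 \<and> ?J = left_ideal hull {b}"
    using monic_min_degree_iff[of ?J b] unfolding is_local_bs_poly_def by simp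
qed

end
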